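(* Let $u\in S_{p+1}$, $p\ge 1$, be an indecomposable vexillary permutation of shape $\lambda\vdash n-1$. Let $\epsilon_u$ be a signature on $\lambda$ and $N_u$ a nonnegative integer such that $\phi(u)=\phi_{\epsilon_u,N_u}$ and $N_u=\max_{1\le q\le r}\bigl(F_{p_q}(\epsilon_u)+E_{M_q}(\epsilon_u)\bigr)$, and let $\omega_u$ be an $\epsilon_u$-compatible labeling of $\lambda$. Then $$\sum_{j\ge 0}\nu_u(j)t^j=\frac{\displaystyle\sum_{T\in \mathrm{SYT}(\lambda)}t^{\mathrm{des}(T;\omega_u)-N_u}}{(1-t)^n}.$$
   Context: Permutations. $u\in S_{p+1}$ is indecomposable if $u(\{1,\dots,i\})\ne\{1,\dots,i\}$ for $i=1,\dots,p$; it is vexillary if it avoids the pattern $2143$. The code of $u$ is $(c_1,c_2,\dots)$ with $c_i=|\{j>i : u(j)<u(i)\}|$; the shape $\lambda=\lambda(u)$ is the partition obtained by sorting the nonzero entries of the code in nonincreasing order. For $i$ with $c_i>0$ let $e_i$ be the maximal $j$ with $c_j\ge c_i$; the flag $\phi(u)$ is the sequence of these $e_i$ sorted in nondecreasing order. Schubert polynomials: in $S_m$, with $w_o=m(m-1)\cdots1$, $\mathfrak{S}_{w_o}=x_1^{m-1}x_2^{m-2}\cdots x_{m-1}$, and $\mathfrak{S}_{ws_i}=\partial_i\mathfrak{S}_w$ whenever $w(i)>w(i+1)$, where $s_i=(i,i+1)$ and $\partial_i f=(f-s_i\cdot f)/(x_i-x_{i+1})$. For $j\ge0$, $1^j\times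 u$ fixes $1,\dots,j$ and sends $j+i\mapsto j+u(i)$, and $\nu_u(j)=\mathfrak{S}_{1^j\times u}(1,1,\dots)$. Signatures. Let $\lambda$ be a nonempty partition with $l$ parts, written $\lambda=(p_1^{m_1},\dots,p_r^{m_r})$ with $p_1>\cdots>p_r>0$ and $m_q\geq 1$, and let $M_q=m_1+\cdots+m_q$ (the $p_q$ are unrelated to the $p$ in $S_{p+1}$). A signature on $\lambda$ is a pair $\epsilon=(e,f)\in\{0,1\}^{l-1}\times\{0,1\}^{\lambda_1-1}$. Put $E_i=E_i(\epsilon)=\sum_{k=1}^{i-1}e_k$ for $1\le i\le l$, $F_j=F_j(\epsilon)=\sum_{k=1}^{j-1}f_k$ for $1\le j\le\lambda_1$, and $\bar E_i=i-1-E_i$. For an integer $N$, $\phi_{\epsilon,N}=(\phi_1^{m_1},\dots,\phi_r^{m_r})$ (meaning $\phi_q$ repeated $m_q$ times) where $\phi_q=N+1-F_{p_q}+\bar E_{M_q}$. Labelings. A labeling of $\lambda$ is a bijection $\omega$ from the cells $(i,j)$ (row $i$, column $j$) of its Young diagram to $\{1,\dots,|\lambda|\}$. It is $\epsilon$-compatible if, for all pairs of adjacent cells of $\lambda$, $\omega(i,j)>\omega(i+1,j)$ if and only if $e_i=1$, and $\omega(i,j)>\omega(i,j+1)$ if and only if $f_j=1$. $\mathrm{SYT}(\lambda)$ is the set of standard Young tableaux of shape $\lambda$; $\mathrm{des}(T;\omega)$ is the number of $k<|\lambda|$ with $\omega(T^{-1}(k))>\omega(T^{-1}(k+1))$, where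 $T^{-1}(k)$ is the cell of $T$ containing $k$. *)

theory Defs
  imports
    "HOL-Library.FuncSet"
    "HOL-Library.Poly_Mapping"
    "HOL-Combinatorics.Permutations"
    "HOL-Computational_Algebra.Formal_Laurent_Series"
begin

section \<open>Permutations\<close>

text \<open>
  An element of \<open>S\<^sub>m\<close> is a function \<open>u :: nat \<Rightarrow> nat\<close> with \<open>u permutes {1..m}\<close>. Positions, rows,
  columns and all other indices are counted from 1, as in the mathematical text.
\<close>

definition indecomposable :: "nat \<Rightarrow> (nat \<Rightarrow> nat) \<Rightarrow> bool" where
  "indecomposable m u \<longleftrightarrow> (\<forall>i. 1 \<le> i \<and> i < m \<longrightarrow> u ` {1..i} \<noteq> {1..i})"

definition vexillary :: "nat \<Rightarrow> (nat \<Rightarrow> nat) \<Rightarrow> bool" where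
  "vexillary m u \<longleftrightarrow>
     \<not> (\<exists>a b c d. 1 \<le> a \<and> a < b \<and> b < c \<and> c < d \<and> d \<le> m \<and> u b < u a \<and> u a < u d \<and> u d < u c)"

text \<open>No bound on \<open>j\<close> is needed: \<open>u\<close> fixes everything above \<open>m\<close>, so such \<open>j\<close> never contribute.\<close>

definition code :: "(nat \<Rightarrow> nat) \<Rightarrow> nat \<Rightarrow> nat" where
  "code u i = card {j. i < j \<and> u j < u i}"

definition shape :: "nat \<Rightarrow> (nat \<Rightarrow> nat) \<Rightarrow> nat list" where
  "shape m u = rev (sort [code u i. i \<leftarrow> [1..<m+1], code u i > 0])"

definition flag :: "nat \<Rightarrow> (nat \<Rightarrow> nat) \<Rightarrow> nat list" where
  "flag m u = sort [Max {j. code u j \<ge> code u i}. i \<leftarrow> [1..<m+1], code u i > 0]"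

section \<open>Schubert polynomials\<close>

text \<open>
  A polynomial with integer coefficients in \<open>x\<^sub>0, x\<^sub>1, x\<^sub>2, \<dots>\<close> is a finitely supported map from
  exponent vectors to coefficients; the variable \<open>x\<^sub>0\<close> is never used.
\<close>

type_synonym int_mpoly = "(nat \<Rightarrow>\<^sub>0 nat) \<Rightarrow>\<^sub>0 int"

definition var :: "nat \<Rightarrow> int_mpoly" where
  "var i = Poly_Mapping.single (Poly_Mapping.single i 1) 1"

definition eval_mpoly :: "(nat \<Rightarrow> int) \<Rightarrow> int_mpoly \<Rightarrow> int" where
  "eval_mpoly x f = (\<Sum>a\<in>Poly_Mapping.keys f.
     Poly_Mapping.lookup f a * (\<Prod>i\<in>Poly_Mapping.keys a. x i ^ Poly_Mapping.lookup a i))"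

text \<open>
  The polynomial \<open>s\<^sub>i \<cdot> f\<close>: its coefficient at \<open>a\<close> is the coefficient of \<open>f\<close> at
  \<open>a \<circ> s\<^sub>i\<close>, and \<open>s\<^sub>i\<close> is an involution.
\<close>

definition swap_vars :: "nat \<Rightarrow> int_mpoly \<Rightarrow> int_mpoly" where
  "swap_vars i f = Poly_Mapping.map_key (Poly_Mapping.map_key (transpose i (i+1))) f"

text \<open>
  The quotient is unique because \<open>int_mpoly\<close> is an integral domain, and it exists because
  \<open>f - s\<^sub>i \<cdot> f\<close> vanishes at \<open>x\<^sub>i = x\<^sub>i\<^sub>+\<^sub>1\<close>.
\<close>

definition divided_diff :: "nat \<Rightarrow> int_mpoly \<Rightarrow> int_mpoly" where
  "divided_diff i f = (THE g. (var i - var (i+1)) * g = f - swap_vars i f)"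

definition longest_perm :: "nat \<Rightarrow> nat \<Rightarrow> nat" where
  "longest_perm m i = (if i \<in> {1..m} then m + 1 - i else i)"

text \<open>
  \<open>is_schubert m w P\<close>: the polynomial \<open>P\<close> is obtained for \<open>w \<in> S\<^sub>m\<close> by following some chain of
  descents from \<open>w\<^sub>o\<close> down to \<open>w\<close>. By the braid relations for the divided differences, \<open>P\<close> does
  not depend on the chain.
\<close>

inductive is_schubert :: "nat \<Rightarrow> (nat \<Rightarrow> nat) \<Rightarrow> int_mpoly \<Rightarrow> bool" for m where
  longest: "is_schubert m (longest_perm m) (\<Prod>i\<in>{1..<m}. var i ^ (m - i))"
| descent: "is_schubert m w P \<Longrightarrow> 1 \<le> i \<Longrightarrow> i < m \<Longrightarrow> w i > w (i+1) \<Longrightarrow>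
    is_schubert m (w \<circ> transpose i (i+1)) (divided_diff i P)"

definition schubert :: "nat \<Rightarrow> (nat \<Rightarrow> nat) \<Rightarrow> int_mpoly" where
  "schubert m w = (THE P. is_schubert m w P)"

text \<open>The permutation \<open>1\<^sup>j \<times> u\<close>.\<close>

definition shift_perm :: "nat \<Rightarrow> (nat \<Rightarrow> nat) \<Rightarrow> nat \<Rightarrow> nat" where
  "shift_perm j u i = (if i \<le> j then i else j + u (i - j))"

definition nu :: "nat \<Rightarrow> (nat \<Rightarrow> nat) \<Rightarrow> nat \<Rightarrow> int" where
  "nu m u j = eval_mpoly (\<lambda>_. 1) (schubert (j + m) (shift_perm j u))"

section \<open>Partitions and signatures\<close>

text \<open>
  A partition is the weakly decreasing list of its (positive) parts, so \<open>\<lambda>\<^sub>i\<close> is \<open>lam ! (i - 1)\<close>.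
  In exponential notation \<open>lam = (p\<^sub>1^m\<^sub>1, \<dots>, p\<^sub>r^m\<^sub>r)\<close>, the numbers \<open>r\<close>, \<open>p\<^sub>q\<close>, \<open>m\<^sub>q\<close>, \<open>M\<^sub>q\<close> are
  \<open>num_blocks lam\<close>, \<open>block_part lam q\<close>, \<open>block_mult lam q\<close> and \<open>block_end lam q\<close>.
\<close>

definition num_blocks :: "nat list \<Rightarrow> nat" where
  "num_blocks lam = card (set lam)"

definition block_part :: "nat list \<Rightarrow> nat \<Rightarrow> nat" where
  "block_part lam q = rev (sorted_list_of_set (set lam)) ! (q - 1)"

definition block_mult :: "nat list \<Rightarrow> nat \<Rightarrow> nat" where
  "block_mult lam q = count_list lam (block_part lam q)"

definition block_end :: "nat list \<Rightarrow> nat \<Rightarrow> nat" where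
  "block_end lam q = (\<Sum>k\<in>{1..q}. block_mult lam k)"

text \<open>
  The two components of a signature are functions of which only the values at \<open>1, \<dots>, l - 1\<close> and
  at \<open>1, \<dots>, \<lambda>\<^sub>1 - 1\<close>, respectively, are constrained or ever used.
\<close>

type_synonym signature = "(nat \<Rightarrow> nat) \<times> (nat \<Rightarrow> nat)"

definition is_signature :: "nat list \<Rightarrow> signature \<Rightarrow> bool" where
  "is_signature lam \<epsilon> \<longleftrightarrow>
     (\<forall>k\<in>{1..<length lam}. fst \<epsilon> k \<in> {0, 1}) \<and> (\<forall>k\<in>{1..<hd lam}. snd \<epsilon> k \<in> {0, 1})"

definition sig_E :: "signature \<Rightarrow> nat \<Rightarrow> nat" where
  "sig_E \<epsilon> i = (\<Sum>k\<in>{1..<i}. fst \<epsilon> k)"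

definition sig_F :: "signature \<Rightarrow> nat \<Rightarrow> nat" where
  "sig_F \<epsilon> j = (\<Sum>k\<in>{1..<j}. snd \<epsilon> k)"

definition sig_Ebar :: "signature \<Rightarrow> nat \<Rightarrow> int" where
  "sig_Ebar \<epsilon> i = int i - 1 - int (sig_E \<epsilon> i)"

definition sig_flag :: "nat list \<Rightarrow> signature \<Rightarrow> int \<Rightarrow> int list" where
  "sig_flag lam \<epsilon> N = concat (map
     (\<lambda>q. replicate (block_mult lam q)
        (N + 1 - int (sig_F \<epsilon> (block_part lam q)) + sig_Ebar \<epsilon> (block_end lam q)))
     [1..<num_blocks lam + 1])"

section \<open>Labelings and standard Young tableaux\<close>

definition cells :: "nat list \<Rightarrow> (nat \<times> nat) set" where
  "cells lam = {(i, j). 1 \<le> i \<and> i \<le> length lam \<and> 1 \<le> j \<and> j \<le> lam ! (i - 1)}"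

definition labeling :: "nat list \<Rightarrow> (nat \<times> nat \<Rightarrow> nat) \<Rightarrow> bool" where
  "labeling lam \<omega> \<longleftrightarrow> bij_betw \<omega> (cells lam) {1..sum_list lam}"

definition compatible :: "nat list \<Rightarrow> signature \<Rightarrow> (nat \<times> nat \<Rightarrow> nat) \<Rightarrow> bool" where
  "compatible lam \<epsilon> \<omega> \<longleftrightarrow>
     (\<forall>i j. (i, j) \<in> cells lam \<and> (i+1, j) \<in> cells lam \<longrightarrow> (\<omega> (i, j) > \<omega> (i+1, j) \<longleftrightarrow> fst \<epsilon> i = 1)) \<and>
     (\<forall>i j. (i, j) \<in> cells lam \<and> (i, j+1) \<in> cells lam \<longrightarrow> (\<omega> (i, j) > \<omega> (i, j+1) \<longleftrightarrow> snd \<epsilon> j = 1))"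

text \<open>Tableaux are extensional outside the diagram, so each one is counted exactly once.\<close>

definition SYT :: "nat list \<Rightarrow> (nat \<times> nat \<Rightarrow> nat) set" where
  "SYT lam = {T \<in> extensional (cells lam). bij_betw T (cells lam) {1..sum_list lam} \<and>
     (\<forall>i j. (i, j) \<in> cells lam \<and> (i+1, j) \<in> cells lam \<longrightarrow> T (i, j) < T (i+1, j)) \<and>
     (\<forall>i j. (i, j) \<in> cells lam \<and> (i, j+1) \<in> cells lam \<longrightarrow> T (i, j) < T (i, j+1))}"

definition des :: "nat list \<Rightarrow> (nat \<times> nat \<Rightarrow> nat) \<Rightarrow> (nat \<times> nat \<Rightarrow> nat) \<Rightarrow> nat" where
  "des lam \<omega> T = card {k. 1 \<le> k \<and> k < sum_list lam \<and>
     \<omega> (inv_into (cells lam) T k) > \<omega> (inv_into (cells lam) T (k+1))}"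

end

theory Submission
  imports Defs
begin

text \<open>
  The Schubert polynomial of a vexillary permutation is a generating function of column strict
  tableaux of shape \<open>\<lambda>\<close> whose rows are bounded by the flag. This is proved by descending induction on
  the length: a divided difference that meets only one row of the flag acts on that row of the
  Jacobi--Trudi determinant as \<open>h\<^sub>n(x\<^sub>1,\<dots>,x\<^sub>i) \<mapsto> h\<^sub>n\<^sub>-\<^sub>1(x\<^sub>1,\<dots>,x\<^sub>i\<^sub>+\<^sub>1)\<close>, and a vexillary \<open>w\<close> always has an
  ascent \<open>i\<close> such that \<open>w s\<^sub>i\<close> is vexillary and its flag can be brought into that form.

  Hence \<open>\<nu>\<^sub>u(j)\<close> counts the tableaux with flag \<open>\<phi>(u) + j\<close>. Adding \<open>F\<^sub>k + E\<^sub>i - i\<close> to the entry in cell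
  \<open>(i,k)\<close> turns them into the fillings with entries in \<open>{0,\<dots>,N\<^sub>u+j}\<close> that increase weakly along rows
  and columns, and strictly at the descents of \<open>\<omega>\<^sub>u\<close>; by Stanley's theory of \<open>P\<close>-partitions the
  generating function of these is \<open>\<Sum>\<^sub>T t\<^bsup>des(T)\<^esup> / (1 - t)\<^sup>n\<close>, up to the shift by \<open>N\<^sub>u\<close>. By the maximality
  in the definition of \<open>N\<^sub>u\<close> there is no such filling with entries in \<open>{0,\<dots>,m}\<close> for \<open>m < N\<^sub>u\<close>, so the
  shift loses nothing.
\<close>

section \<open>Divided differences\<close>

text \<open>Tableaux and determinants do different work. A divided difference has no visible effect
  on a set of tableaux but acts on one row of a determinant; conversely, that different flags can
  allow exactly the same tableaux is seen from column strictness and not from the matrix. Hence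
  every induction step adjusts the flag on tableaux, differentiates the determinant, and restores
  the flag on tableaux. The obstacle is that \<open>w s_i\<close> need not be vexillary and that
  several rows may carry the flag \<open>i\<close>. Both are controlled by the choice of the ascent:
  the last ascent of the code or, if the code decreases weakly, the first ascent of
  \<open>w\<close>. The shift F_k + E_i - i matches two lower bounds: strict steps force at least
  F_k + E_i into cell (i,k) of a filling, and column strictness forces at least i into row i of a
  tableau. The formula for the flag of a signature says that at the last row of each block of equal
  parts the upper bounds match as well.\<close>

lemma inj_map_key_transpose: "inj (Poly_Mapping.map_key (transpose i (i+1)) :: (nat \<Rightarrow>\<^sub>0 nat) \<Rightarrow> nat \<Rightarrow>\<^sub>0 nat)"
proof (rule inj_on_inverseI)
  fix a :: "nat \<Rightarrow>\<^sub>0 nat"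
  show "Poly_Mapping.map_key (transpose i (i+1)) (Poly_Mapping.map_key (transpose i (i+1)) a) = a"
    by (rule poly_mapping_eqI) (simp add: map_key.rep_eq)
qed

lemma lookup_swap_vars: "Poly_Mapping.lookup (swap_vars i f) a
    = Poly_Mapping.lookup f (Poly_Mapping.map_key (transpose i (i+1)) a)"
  using inj_map_key_transpose[of i] by (simp add: swap_vars_def map_key.rep_eq)

lemma map_key_transpose_idem: "Poly_Mapping.map_key (transpose i (i+1)) (Poly_Mapping.map_key (transpose i (i+1)) a) = (a :: nat \<Rightarrow>\<^sub>0 nat)"
    by (rule poly_mapping_eqI) (simp add: map_key.rep_eq)

lemma swap_vars_idem [simp]: "swap_vars i (swap_vars i f) = f"
  by (rule poly_mapping_eqI) (simp only: lookup_swap_vars map_key_transpose_idem)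

lemma swap_vars_add: "swap_vars i (f + g) = swap_vars i f + swap_vars i g"
  by (rule poly_mapping_eqI) (simp add: lookup_swap_vars lookup_add)

lemma swap_vars_0 [simp]: "swap_vars i 0 = 0"
  by (rule poly_mapping_eqI) (simp add: lookup_swap_vars)

lemma swap_vars_diff: "swap_vars i (f - g) = swap_vars i f - swap_vars i g"
  by (rule poly_mapping_eqI) (simp add: lookup_swap_vars lookup_minus)

lemma swap_vars_single: "swap_vars i (Poly_Mapping.single a c) = Poly_Mapping.single (Poly_Mapping.map_key (transpose i (i+1)) a) c"
proof -
  have "Poly_Mapping.map_key (transpose i (i+1)) b = a \<longleftrightarrow> b = Poly_Mapping.map_key (transpose i (i+1)) a" for b
    by (metis map_key_transpose_idem)
  then show ?thesis
    by (intro poly_mapping_eqI) (unfold lookup_swap_vars lookup_single when_def, metis)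
qed

text \<open>Reduces additive statements to monomials. Multiplicativity of \<open>swap_vars\<close>
  and the divisibility behind \<open>divided_diff\<close> are obtained in this way.\<close>

lemma poly_mapping_single_induct [case_names single add zero]:
  fixes f :: "'a \<Rightarrow>\<^sub>0 'b::ab_group_add"
  assumes "\<And>a c. P (Poly_Mapping.single a c)" and "\<And>f g. P f \<Longrightarrow> P g \<Longrightarrow> P (f + g)" and "P 0"
  shows "P f"
proof (induction f rule: update_induct)
  case const
  then show ?case by (rule assms(3))
next
  case (update f a b)
  have "Poly_Mapping.update a b f = f + Poly_Mapping.single a b"
    using update(1) by (intro poly_mapping_eqI)
      (auto simp: lookup_update lookup_add lookup_single when_def not_in_keys_iff_lookup_eq_zero)
  then show ?case using assms update by auto
qed

lemma swap_vars_mult: "swap_vars i (f * g) = swap_vars i f * swap_vars i g"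
proof (induction f rule: poly_mapping_single_induct)
  case (single a c)
  then show ?case
  proof (induction g rule: poly_mapping_single_induct)
    case (single b d)
    then show ?case
      by (simp add: swap_vars_single mult_single map_key_plus inj_transpose)
  qed (auto simp: swap_vars_add distrib_left)
qed (auto simp: swap_vars_add distrib_right)

lemma swap_vars_1 [simp]: "swap_vars i 1 = 1"
  using swap_vars_single[of i 0 1] by (simp add: map_key_zero)

lemma swap_vars_of_int [simp]: "swap_vars i (of_int c) = of_int c"
proof -
  have "Poly_Mapping.single 0 c = (of_int c :: int_mpoly)"
    using single_of_int[where 'b = int, of c] by simp
  moreover have "swap_vars i (Poly_Mapping.single 0 c) = Poly_Mapping.single 0 c"
    using swap_vars_single[of i 0 c] by simp
  ultimately show ?thesis by metis
qed

lemma swap_vars_prod: "swap_vars i (prod f A) = (\<Prod>a\<in>A. swap_vars i (f a))"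
  by (induction A rule: infinite_finite_induct) (auto simp: swap_vars_mult)

lemma swap_vars_var: "swap_vars i (var k) = var (transpose i (i+1) k)"
proof -
  have "Poly_Mapping.map_key (transpose i (i+1)) (Poly_Mapping.single k (1::nat)) = Poly_Mapping.single (transpose i (i+1) k) 1"
    by (rule poly_mapping_eqI)
      (auto simp: map_key.rep_eq lookup_single when_def transpose_def split: if_splits)
  then show ?thesis by (simp add: var_def swap_vars_single)
qed

lemma swap_vars_braid: "swap_vars i (swap_vars (i+1) (swap_vars i f)) = swap_vars (i+1) (swap_vars i (swap_vars (i+1) f))"
proof -
  have *: "transpose i (i+1) (transpose (i+1) (i+2) (transpose i (i+1) x)) = transpose (i+1) (i+2) (transpose i (i+1) (transpose (i+1) (i+2) x))" for x
    by (auto simp: transpose_def)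
  show ?thesis
    by (rule poly_mapping_eqI, simp only: lookup_swap_vars, rule arg_cong[where f = "Poly_Mapping.lookup f"], rule poly_mapping_eqI)
       (simp add: map_key.rep_eq *[simplified])
qed

lemma swap_vars_commute:
  assumes "i + 1 < j"
  shows "swap_vars i (swap_vars j f) = swap_vars j (swap_vars i f)"
proof -
  have *: "transpose i (i+1) (transpose j (j+1) x) = transpose j (j+1) (transpose i (i+1) x)" for x
    using assms by (auto simp: transpose_def)
  show ?thesis
    by (rule poly_mapping_eqI, simp only: lookup_swap_vars, rule arg_cong[where f = "Poly_Mapping.lookup f"], rule poly_mapping_eqI)
       (simp add: map_key.rep_eq *[simplified])
qed

lemma var_inject: "var i = var j \<longleftrightarrow> i = j"
proof -
  have "Poly_Mapping.single i (1::nat) = Poly_Mapping.single j 1 \<longleftrightarrow> i = j"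
    by (metis lookup_single_eq lookup_single_not_eq one_neq_zero)
  then show ?thesis
    unfolding var_def by (metis lookup_single_eq lookup_single_not_eq one_neq_zero)
qed

lemma single_eq_prod_var:
  "Poly_Mapping.single a (c::int) = of_int c * (\<Prod>i\<in>Poly_Mapping.keys a. var i ^ Poly_Mapping.lookup a i)"
proof -
  have pow: "var i ^ k = Poly_Mapping.single (Poly_Mapping.single i k) 1" for i k
    by (induction k) (auto simp: var_def mult_single simp flip: single_add)
  have "(\<Prod>i\<in>A. Poly_Mapping.single (g i) (1::int)) = Poly_Mapping.single (sum g A) 1"
    if "finite A" for g :: "nat \<Rightarrow> nat \<Rightarrow>\<^sub>0 nat" and A
    using that by induction (auto simp: mult_single)
  moreover have "(\<Sum>i\<in>Poly_Mapping.keys a. Poly_Mapping.single i (Poly_Mapping.lookup a i)) = a"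
    by (rule poly_mapping_eqI) (auto simp: lookup_sum lookup_single when_def in_keys_iff)
  ultimately have "(\<Prod>i\<in>Poly_Mapping.keys a. var i ^ Poly_Mapping.lookup a i) = Poly_Mapping.single a 1"
    by (simp add: pow)
  then show ?thesis
    by (simp add: mult_single flip: single_of_int)
qed

text \<open>The twisted Leibniz rule
  \<open>f * g - s f * s g = (f - s f) * g + s f * (g - s g)\<close>, with
  \<open>s = swap_vars i\<close>, shows that the polynomials with this divisibility are closed under
  products. As they are closed under sums too, constants and variables suffice.\<close>

lemma divided_diff_exists: "\<exists>g. (var i - var (i+1)) * g = f - swap_vars i f"
proof -
  define D where "D f \<longleftrightarrow> (var i - var (i+1)) dvd (f - swap_vars i f)" for f
  have add: "D (f + g)" if "D f" "D g" for f g
  proof -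
    have "(f + g) - swap_vars i (f + g) = (f - swap_vars i f) + (g - swap_vars i g)"
      by (simp add: swap_vars_add)
    then show ?thesis using that unfolding D_def by (metis dvd_add)
  qed
  have mult: "D (f * g)" if "D f" "D g" for f g
  proof -
    have "(f * g) - swap_vars i (f * g) = (f - swap_vars i f) * g + swap_vars i f * (g - swap_vars i g)"
      by (simp add: swap_vars_mult algebra_simps)
    then show ?thesis using that unfolding D_def by (metis dvd_add dvd_mult dvd_mult2)
  qed
  have const: "D (of_int c)" for c
    by (simp add: D_def)
  have one: "D 1" using const[of 1] by simp
  have pow: "D (f ^ k)" if "D f" for f k
    using that by (induction k) (auto intro: mult one)
  have prod: "D (prod g A)" if "\<And>a. a \<in> A \<Longrightarrow> D (g a)" for g :: "nat \<Rightarrow> int_mpoly" and A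
    using that by (induction A rule: infinite_finite_induct) (auto intro: mult one)
  have var: "D (var k)" for k
  proof -
    consider "k = i" | "k = i + 1" | "k \<noteq> i" "k \<noteq> i+1" by blast
    then show ?thesis
    proof cases
      case 2
      then have "var k - swap_vars i (var k) = (var i - var (i+1)) * (- 1)" by (simp add: swap_vars_var)
      then show ?thesis unfolding D_def by (metis dvd_triv_left)
    qed (auto simp: D_def swap_vars_var)
  qed
  have "D f" for f
    by (induction f rule: poly_mapping_single_induct)
       (auto simp: single_eq_prod_var add const[of 0, simplified] intro!: mult const prod pow var)
  then show ?thesis unfolding D_def dvd_def by metis
qed

lemma var_diff_nonzero: "i \<noteq> j \<Longrightarrow> var i - var j \<noteq> 0"
  by (simp add: var_inject)

lemma divided_diff_eqI:
  assumes "(var i - var (i+1)) * g = f - swap_vars i f"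
  shows "divided_diff i f = g"
  unfolding divided_diff_def
proof (rule the_equality)
  show "h = g" if "(var i - var (i + 1)) * h = f - swap_vars i f" for h
    using that assms var_diff_nonzero[of i "i+1"] by (metis mult_left_cancel n_not_Suc_n Suc_eq_plus1)
qed fact

lemma divided_diff_mult: "(var i - var (i+1)) * divided_diff i f = f - swap_vars i f"
  using divided_diff_exists[of i f] divided_diff_eqI by auto

lemma divided_diff_0 [simp]: "divided_diff i 0 = 0"
  by (rule divided_diff_eqI) simp

lemma divided_diff_add: "divided_diff i (f + g) = divided_diff i f + divided_diff i g"
  by (rule divided_diff_eqI) (simp only: distrib_left divided_diff_mult swap_vars_add, simp)

lemma divided_diff_sum: "divided_diff i (sum f A) = (\<Sum>a\<in>A. divided_diff i (f a))"
  by (induction A rule: infinite_finite_induct) (auto simp: divided_diff_add)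

text \<open>Invariant polynomials are scalars for \<open>divided_diff i\<close>; this is what lets
  it act on one row of a determinant whose other rows are invariant.\<close>

lemma divided_diff_mult_left:
  assumes "swap_vars i g = g"
  shows "divided_diff i (g * f) = g * divided_diff i f"
proof (rule divided_diff_eqI)
  have "(var i - var (i + 1)) * (g * divided_diff i f) = g * ((var i - var (i + 1)) * divided_diff i f)"
    by (simp only: ac_simps)
  then show "(var i - var (i + 1)) * (g * divided_diff i f) = g * f - swap_vars i (g * f)"
    unfolding divided_diff_mult by (simp add: swap_vars_mult assms right_diff_distrib)
qed

lemma divided_diff_commute:
  assumes "i + 1 < j"
  shows "divided_diff i (divided_diff j f) = divided_diff j (divided_diff i f)"
proof (rule divided_diff_eqI)
  let ?a = "var i - var (i + 1)" and ?b = "var j - var (j + 1)"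
  have sa: "swap_vars j ?a = ?a" and sb: "swap_vars i ?b = ?b"
    using assms by (auto simp: swap_vars_diff swap_vars_var)
  have 1: "divided_diff j (?a * divided_diff i f) = ?a * divided_diff j (divided_diff i f)"
    using sa by (rule divided_diff_mult_left)
  \<comment> \<open>The factor \<open>?b\<close> is invariant under \<open>swap_vars i\<close>, so
    \<open>swap_vars i\<close> commutes with \<open>divided_diff j\<close>.\<close>
  have 2: "divided_diff j (swap_vars i f) = swap_vars i (divided_diff j f)"
  proof (rule divided_diff_eqI)
    have "?b * swap_vars i (divided_diff j f) = swap_vars i (?b * divided_diff j f)"
      by (simp only: swap_vars_mult sb)
    also have "\<dots> = swap_vars i f - swap_vars j (swap_vars i f)"
      unfolding divided_diff_mult swap_vars_diff swap_vars_commute[OF assms] ..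
    finally show "?b * swap_vars i (divided_diff j f) = swap_vars i f - swap_vars j (swap_vars i f)" .
  qed
  have 3: "divided_diff j (f - g) = divided_diff j f - divided_diff j g" for g
    using divided_diff_add[of j "f - g" g] by simp
  show "?a * divided_diff j (divided_diff i f) = divided_diff j f - swap_vars i (divided_diff j f)"
    unfolding 1[symmetric] divided_diff_mult 3 2 ..
qed

text \<open>
  Multiplied by the Vandermonde polynomial in \<open>x\<^sub>i, x\<^sub>i\<^sub>+\<^sub>1, x\<^sub>i\<^sub>+\<^sub>2\<close>, both sides of the braid relation
  become the antisymmetrization of \<open>f\<close>.
\<close>

lemma divided_diff_braid:
  "divided_diff i (divided_diff (i+1) (divided_diff i f)) = divided_diff (i+1) (divided_diff i (divided_diff (i+1) f))"
proof -
  define a b c where "a = var i" and "b = var (i+1)" and "c = var (i+2)"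
  define S T where "S = swap_vars i" and "T = swap_vars (i+1)"
  define d e where "d = divided_diff i" and "e = divided_diff (i+1)"
  have S: "S a = b" "S b = a" "S c = c" and T: "T a = a" "T b = c" "T c = b"
    by (auto simp: S_def T_def a_def b_def c_def swap_vars_var)
  have hom: "S (f - g) = S f - S g" "S (f * g) = S f * S g" "T (f - g) = T f - T g" "T (f * g) = T f * T g" for f g
    by (auto simp: S_def T_def swap_vars_diff swap_vars_mult)
  have d: "(a - b) * d f = f - S f" and e: "(b - c) * e f = f - T f" for f
    using divided_diff_mult[of i f] divided_diff_mult[of "i+1" f]
    by (auto simp: a_def b_def c_def d_def e_def S_def T_def)
  have braid: "S (T (S f)) = T (S (T f))"
    unfolding S_def T_def by (rule swap_vars_braid)
  have Td: "(a - c) * T (d f) = T f - T (S f)" for f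
    using arg_cong[OF d, of T f] by (simp add: hom T)
  have Se: "(a - c) * S (e f) = S f - S (T f)" for f
    using arg_cong[OF e, of S f] by (simp add: hom S)
  have aux: "q * r * p * E = r * X - q * Y" if "p * E = x - y" "q * x = X" "r * y = Y" for p q r E x y X Y :: int_mpoly
  proof -
    have "q * r * p * E = q * r * (p * E)" by (simp only: mult.assoc)
    also have "\<dots> = r * (q * x) - q * (r * y)" unfolding that(1) by (simp add: algebra_simps)
    finally show ?thesis using that by simp
  qed
  have aux2: "z * (D * k) = R - R'" if "z * k = x - y" "D * x = R" "D * y = R'" for z k D x y R R' :: int_mpoly
  proof -
    have "z * (D * k) = D * (z * k)" by (simp only: ac_simps)
    then show ?thesis unfolding that(1) using that by (simp add: right_diff_distrib)
  qed
  have ed: "(a - b) * (a - c) * (b - c) * e (d f) = (a - c) * (f - S f) - (a - b) * (T f - T (S f))"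
    using aux[OF e[of "d f"] d[of f] Td[of f]] by (simp only: ac_simps)
  have de: "(a - b) * (a - c) * (b - c) * d (e f) = (a - c) * (f - T f) - (b - c) * (S f - S (T f))"
    using aux[OF d[of "e f"] e[of f] Se[of f]] by (simp only: ac_simps)
  have Sed: "(b - a) * (b - c) * (a - c) * S (e (d f)) = (b - c) * (S f - f) - (b - a) * (S (T f) - S (T (S f)))"
    using arg_cong[OF ed, of S] unfolding hom S unfolding S_def swap_vars_idem .
  have Tde: "(a - c) * (a - b) * (c - b) * T (d (e f)) = (a - b) * (T f - f) - (c - b) * (T (S f) - T (S (T f)))"
    using arg_cong[OF de, of T] unfolding hom T unfolding T_def swap_vars_idem
    by (simp only: ac_simps)
  let ?A = "f - S f - T f + T (S f) + S (T f) - S (T (S f))"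
  have nz: "a - b \<noteq> 0" "a - c \<noteq> 0" "b - c \<noteq> 0"
    by (auto simp: a_def b_def c_def var_inject)
  \<comment> \<open>The defining equation of \<open>d\<close> costs one more factor
    \<open>a - b\<close>, which is cancelled afterwards. Since \<open>S\<close> changes the sign of
    the Vandermonde product, \<open>Sed\<close> supplies the other half of the
    antisymmetrization.\<close>
  have "(a - b) * ((a - b) * (a - c) * (b - c) * d (e (d f))) = (a - b) * ?A"
  proof -
    have "(a - b) * (a - c) * (b - c) * S (e (d f)) = - ((b - a) * (b - c) * (a - c) * S (e (d f)))"
      by (simp add: algebra_simps)
    from aux2[OF d[of "e (d f)"] ed this] show ?thesis
      unfolding Sed by (simp add: algebra_simps)
  qed
  then have 1: "(a - b) * (a - c) * (b - c) * d (e (d f)) = ?A" using nz(1) by simp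
  have "(b - c) * ((a - b) * (a - c) * (b - c) * e (d (e f))) = (b - c) * ?A"
  proof -
    have "(a - b) * (a - c) * (b - c) * T (d (e f)) = - ((a - c) * (a - b) * (c - b) * T (d (e f)))"
      by (simp add: algebra_simps)
    from aux2[OF e[of "d (e f)"] de this] show ?thesis
      unfolding Tde braid by (simp add: algebra_simps)
  qed
  then have "(a - b) * (a - c) * (b - c) * e (d (e f)) = ?A" using nz(3) by simp
  with 1 have "d (e (d f)) = e (d (e f))"
    using nz by (metis mult_eq_0_iff mult_left_cancel)
  then show ?thesis by (simp add: d_def e_def)
qed

section \<open>Schubert polynomials are well defined\<close>

lemma longest_perm_permutes: "longest_perm m permutes {1..m}"
proof (rule bij_imp_permutes)
  show "bij_betw (longest_perm m) {1..m} {1..m}"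
    by (rule bij_betw_byWitness[where f' = "longest_perm m"]) (auto simp: longest_perm_def)
qed (auto simp: longest_perm_def)

lemma permutes_comp_transpose:
  fixes m :: nat
  assumes "w permutes {1..m}" "1 \<le> i" "i < m"
  shows "(w \<circ> transpose i (i+1)) permutes {1..m}"
proof -
  have "i \<in> {1..m}" "i + 1 \<in> {1..m}" using assms by auto
  then show ?thesis using assms(1) by (intro permutes_compose permutes_swap_id)
qed

lemma comp_transpose_idem [simp]: "w \<circ> transpose a b \<circ> transpose a b = w"
  by (simp add: comp_assoc)

lemma is_schubert_permutes: "is_schubert m w P \<Longrightarrow> w permutes {1..m}"
proof (induction rule: is_schubert.induct)
  case longest
  show ?case by (rule longest_perm_permutes)
next
  case (descent w P i)
  then show ?case by (intro permutes_comp_transpose)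
qed

text \<open>The induction measure: exchanging the values of an ascent at \<open>i\<close> lowers it
  by \<open>w (i+1) - w i\<close>, so it decreases towards the longest permutation without any
  counting of inversions.\<close>

definition perm_moment :: "nat \<Rightarrow> (nat \<Rightarrow> nat) \<Rightarrow> nat" where
  "perm_moment m w = (\<Sum>k=1..m. k * w k)"

lemma perm_moment_comp_transpose:
  assumes "1 \<le> i" "i < m" "w i < w (i+1)"
  shows "perm_moment m (w \<circ> transpose i (i+1)) < perm_moment m w"
proof -
  have S: "{1..m} = insert i (insert (i+1) ({1..m} - {i, i+1}))" using assms by auto
  have rest: "(\<Sum>k\<in>{1..m} - {i, i+1}. k * (w \<circ> transpose i (i+1)) k) = (\<Sum>k\<in>{1..m} - {i, i+1}. k * w k)"
    by (intro sum.cong) (auto simp: transpose_def)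
  obtain d where "w (i+1) = w i + d" "d > 0" using assms(3) less_imp_add_positive by metis
  then show ?thesis
    unfolding perm_moment_def by (subst (1 2) S) (use rest in \<open>simp add: algebra_simps\<close>)
qed

text \<open>Strict descents squeeze \<open>w i\<close>: counting from the left end, where
  \<open>w 1 \<le> m\<close>, bounds it above, and counting from the right end, where
  \<open>w m \<ge> 1\<close>, bounds it below by the same number.\<close>

lemma no_ascent_imp_longest:
  assumes w: "w permutes {1..m}" and desc: "\<And>i. 1 \<le> i \<Longrightarrow> i < m \<Longrightarrow> w (i+1) \<le> w i"
  shows "w = longest_perm m"
proof -
  have inj: "w i \<noteq> w (i+1)" for i
    using permutes_inj[OF w] by (metis Suc_eq_plus1 injD n_not_Suc_n)
  have strict: "w (i+1) < w i" if "1 \<le> i" "i < m" for i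
    using desc[OF that] inj[of i] by linarith
  have in_range: "1 \<le> w i \<and> w i \<le> m" if "1 \<le> i" "i \<le> m" for i
    using permutes_in_image[OF w, of i] that by auto
  have upper: "w i + i \<le> m + 1" if "1 \<le> i" "i \<le> m" for i
    using that
  proof (induction i rule: nat_induct_at_least)
    case base
    then show ?case using in_range[of 1] by simp
  next
    case (Suc i)
    then show ?case using strict[of i] by simp
  qed
  have lower: "w (m - k) \<ge> k + 1" if "k < m" for k
    using that
  proof (induction k)
    case 0
    then show ?case using in_range[of m] by simp
  next
    case (Suc k)
    then have "w (m - k) < w (m - Suc k)"
      using strict[of "m - Suc k"] by (simp add: Suc_diff_Suc)
    then show ?case using Suc by simp
  qed
  show ?thesis
  proof
    fix i
    show "w i = longest_perm m i"
    proof (cases "i \<in> {1..m}")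
      case True
      then show ?thesis using upper[of i] lower[of "m - i"] by (simp add: longest_perm_def)
    next
      case False
      then show ?thesis using w by (auto simp: longest_perm_def permutes_def)
    qed
  qed
qed

lemma is_schubert_ascent:
  assumes "is_schubert m (w \<circ> transpose i (i+1)) P" "1 \<le> i" "i < m" "w i < w (i+1)"
  shows "is_schubert m w (divided_diff i P)"
  using is_schubert.descent[OF assms(1-3)] assms(4) by simp

lemma is_schubert_exists:
  assumes "w permutes {1..m}"
  shows "\<exists>P. is_schubert m w P"
  using assms
proof (induction "perm_moment m w" arbitrary: w rule: less_induct)
  case less
  show ?case
  proof (cases "\<exists>i. 1 \<le> i \<and> i < m \<and> w i < w (i+1)")
    case True
    then obtain i where i: "1 \<le> i" "i < m" "w i < w (i+1)" by blast
    then show ?thesis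
      using less.hyps[OF perm_moment_comp_transpose[OF i] permutes_comp_transpose[OF less.prems i(1,2)]]
        is_schubert_ascent by blast
  next
    case False
    then have "w = longest_perm m"
      using no_ascent_imp_longest[OF less.prems] by (meson not_le)
    then show ?thesis using is_schubert.longest by blast
  qed
qed

lemma is_schubert_cases:
  assumes "is_schubert m w P"
  shows "w = longest_perm m \<and> P = (\<Prod>i\<in>{1..<m}. var i ^ (m - i)) \<or>
    (\<exists>i Q. is_schubert m (w \<circ> transpose i (i+1)) Q \<and> 1 \<le> i \<and> i < m \<and> w i < w (i+1) \<and> P = divided_diff i Q)"
  using assms
proof cases
  case (descent v Q i)
  then have "w \<circ> transpose i (i+1) = v" by (simp only: comp_transpose_idem)
  then have "is_schubert m (w \<circ> transpose i (i+1)) Q \<and> 1 \<le> i \<and> i < m \<and> w i < w (i+1) \<and> P = divided_diff i Q"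
    using descent by auto
  then show ?thesis by blast
qed simp

text \<open>A confluence argument. Two chains ending in \<open>w\<close> arrive through ascents
  \<open>i\<close> and \<open>j\<close> of \<open>w\<close>. Both \<open>w s_i\<close> and
  \<open>w s_j\<close> lie below a common permutation, which has some Schubert polynomial
  \<open>R\<close>. By induction \<open>P'\<close> and \<open>Q'\<close> are the results of
  descending from \<open>R\<close> along the two sides, and the commutation or braid relation makes
  the last steps agree.\<close>

theorem is_schubert_unique:
  assumes "is_schubert m w P" "is_schubert m w Q"
  shows "P = Q"
  using assms
proof (induction "perm_moment m w" arbitrary: w P Q rule: less_induct)
  case less
  have w: "w permutes {1..m}" using less.prems(1) by (rule is_schubert_permutes)
  have commuting: "divided_diff i P' = divided_diff j Q'"
    if P': "is_schubert m (w \<circ> transpose i (i+1)) P'" and Q': "is_schubert m (w \<circ> transpose j (j+1)) Q'"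
      and i: "1 \<le> i" "i < m" "w i < w (i+1)" and j: "1 \<le> j" "j < m" "w j < w (j+1)" and "i < j"
    for i j P' Q'
  proof (cases "j = i + 1")
    case False
    let ?v = "w \<circ> transpose i (i+1) \<circ> transpose j (j+1)"
    have v: "?v = w \<circ> transpose j (j+1) \<circ> transpose i (i+1)"
      using False \<open>i < j\<close> by (auto simp: fun_eq_iff transpose_def)
    have "?v permutes {1..m}"
      using i j w by (intro permutes_comp_transpose)
    then obtain R where R: "is_schubert m ?v R"
      using is_schubert_exists by blast
    have "is_schubert m (w \<circ> transpose i (i+1)) (divided_diff j R)"
      by (rule is_schubert_ascent[OF R j(1,2)]) (use j False \<open>i < j\<close> in \<open>auto simp: transpose_def\<close>)
    then have 1: "P' = divided_diff j R"
      using less.hyps[OF perm_moment_comp_transpose[OF i] P'] by blast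
    have "is_schubert m (w \<circ> transpose j (j+1)) (divided_diff i R)"
      by (rule is_schubert_ascent[OF R[unfolded v] i(1,2)]) (use i False \<open>i < j\<close> in \<open>auto simp: transpose_def\<close>)
    then have 2: "Q' = divided_diff i R"
      using less.hyps[OF perm_moment_comp_transpose[OF j] Q'] by blast
    show ?thesis unfolding 1 2 using False \<open>i < j\<close> by (intro divided_diff_commute) auto
  next
    case True
    \<comment> \<open>Here \<open>w\<close> increases on \<open>i\<close>, \<open>i + 1\<close>,
      \<open>i + 2\<close>; the common permutation reverses these three values, and the two sides of
      the braid relation are the two ways down from it.\<close>
    let ?s = "transpose i (i+1)" and ?t = "transpose (i+1) (i+2)"
    have v: "w \<circ> ?s \<circ> ?t \<circ> ?s = w \<circ> ?t \<circ> ?s \<circ> ?t"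
      by (auto simp: fun_eq_iff transpose_def)
    have lt: "w i < w (i+1)" "w (i+1) < w (i+2)" using i j True by auto
    have m: "1 \<le> i+1" "i + 1 < m" using i j True by auto
    have t: "transpose (i+1) (i+1+1) = ?t" by simp
    have "w \<circ> ?s \<circ> ?t \<circ> ?s permutes {1..m}"
      using i m w unfolding t[symmetric] by (intro permutes_comp_transpose)
    then obtain R where R: "is_schubert m (w \<circ> ?s \<circ> ?t \<circ> ?s) R"
      using is_schubert_exists by blast
    have "is_schubert m (w \<circ> ?s \<circ> ?t) (divided_diff i R)"
      by (rule is_schubert_ascent[OF R i(1,2)]) (use lt in \<open>auto simp: transpose_def\<close>)
    then have "is_schubert m (w \<circ> ?s) (divided_diff (i+1) (divided_diff i R))"
      by (rule is_schubert_ascent[OF _ m, unfolded t]) (use lt in \<open>auto simp: transpose_def\<close>)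
    then have 1: "P' = divided_diff (i+1) (divided_diff i R)"
      using less.hyps[OF perm_moment_comp_transpose[OF i] P'] by blast
    have "is_schubert m (w \<circ> ?t \<circ> ?s) (divided_diff (i+1) R)"
      by (rule is_schubert_ascent[OF _ m, unfolded t]) (use lt R v in \<open>auto simp: transpose_def\<close>)
    then have "is_schubert m (w \<circ> ?t) (divided_diff i (divided_diff (i+1) R))"
      by (rule is_schubert_ascent[OF _ i(1,2)]) (use lt in \<open>auto simp: transpose_def\<close>)
    then have 2: "Q' = divided_diff i (divided_diff (i+1) R)"
      using less.hyps[OF perm_moment_comp_transpose[OF j] Q'] True by simp
    show ?thesis unfolding 1 2 True by (rule divided_diff_braid)
  qed
  have no_asc: "\<not> longest_perm m i < longest_perm m (i+1)" if "1 \<le> i" "i < m" for i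
    using that by (simp add: longest_perm_def)
  show ?case
  proof (cases "w = longest_perm m")
    case True
    then show ?thesis using less.prems[THEN is_schubert_cases] no_asc by metis
  next
    case False
    obtain i P' where P: "is_schubert m (w \<circ> transpose i (i+1)) P'" "1 \<le> i" "i < m" "w i < w (i+1)" "P = divided_diff i P'"
      using is_schubert_cases[OF less.prems(1)] False by blast
    obtain j Q' where Q: "is_schubert m (w \<circ> transpose j (j+1)) Q'" "1 \<le> j" "j < m" "w j < w (j+1)" "Q = divided_diff j Q'"
      using is_schubert_cases[OF less.prems(2)] False by blast
    consider "i < j" | "j < i" | "i = j" by linarith
    then show ?thesis
    proof cases
      case 1
      then show ?thesis using commuting[OF P(1) Q(1) P(2-4) Q(2-4)] P(5) Q(5) by simp
    next
      case 2
      then show ?thesis using commuting[OF Q(1) P(1) Q(2-4) P(2-4)] P(5) Q(5) by simp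
    next
      case 3
      then show ?thesis using less.hyps[OF perm_moment_comp_transpose[OF P(2-4)] P(1)] P(5) Q by blast
    qed
  qed
qed

lemma schubert_eqI: "is_schubert m w P \<Longrightarrow> schubert m w = P"
  unfolding schubert_def using is_schubert_unique by blast

section \<open>Flagged tableaux\<close>

definition flagged_tab :: "nat list \<Rightarrow> (nat \<Rightarrow> nat) \<Rightarrow> (nat \<times> nat \<Rightarrow> nat) set" where
  "flagged_tab lam \<phi> = {T \<in> extensional (cells lam).
     (\<forall>i j. (i, j) \<in> cells lam \<longrightarrow> 1 \<le> T (i, j) \<and> T (i, j) \<le> \<phi> i) \<and>
     (\<forall>i j. (i, j) \<in> cells lam \<and> (i+1, j) \<in> cells lam \<longrightarrow> T (i, j) < T (i+1, j)) \<and>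
     (\<forall>i j. (i, j) \<in> cells lam \<and> (i, j+1) \<in> cells lam \<longrightarrow> T (i, j) \<le> T (i, j+1))}"

definition tab_poly :: "nat list \<Rightarrow> (nat \<Rightarrow> nat) \<Rightarrow> int_mpoly" where
  "tab_poly lam \<phi> = (\<Sum>T\<in>flagged_tab lam \<phi>. \<Prod>c\<in>cells lam. var (T c))"

lemma finite_cells [simp]: "finite (cells lam)"
proof -
  have "cells lam = Sigma {1..length lam} (\<lambda>i. {1..lam ! (i - 1)})"
    by (auto simp: cells_def)
  then show ?thesis by simp
qed

lemma finite_flagged_tab [simp]: "finite (flagged_tab lam \<phi>)"
proof (rule finite_subset)
  show "flagged_tab lam \<phi> \<subseteq> PiE (cells lam) (\<lambda>c. {1..\<phi> (fst c)})"
    by (auto simp: flagged_tab_def PiE_def)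
qed (auto intro: finite_PiE)

lemma cells_left: "(i, j') \<in> cells lam \<Longrightarrow> 1 \<le> j \<Longrightarrow> j \<le> j' \<Longrightarrow> (i, j) \<in> cells lam"
  by (auto simp: cells_def)

lemma sorted_desc_nth_mono: "sorted_wrt (\<ge>) (lam :: nat list) \<Longrightarrow> i \<le> j \<Longrightarrow> j < length lam \<Longrightarrow> lam ! j \<le> lam ! i"
  by (cases "i = j") (auto simp: sorted_wrt_iff_nth_less)

lemma cells_up:
  assumes "sorted_wrt (\<ge>) lam" "(i', j) \<in> cells lam" "1 \<le> i" "i \<le> i'"
  shows "(i, j) \<in> cells lam"
proof -
  have "i' - 1 < length lam" "i - 1 \<le> i' - 1" using assms by (auto simp: cells_def)
  from sorted_desc_nth_mono[OF assms(1) this(2,1)] show ?thesis using assms by (auto simp: cells_def)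
qed

text \<open>The forced increments \<open>f\<close> stay general: they are 0 for plain monotonicity
  and the entries of the signature for labeled fillings, where their sum becomes
  \<open>sig_F\<close>. Columns are treated likewise, with the additional increment 1 for column
  strictness.\<close>

lemma row_mono:
  assumes "\<And>i j. (i, j) \<in> cells lam \<Longrightarrow> (i, j+1) \<in> cells lam \<Longrightarrow> (T (i, j) :: nat) + f j \<le> T (i, j+1)"
    and "(i, j') \<in> cells lam" "1 \<le> j" "j \<le> j'"
  shows "T (i, j) + sum f {j..<j'} \<le> T (i, j')"
  using assms(4,2)
proof (induction j' rule: dec_induct)
  case (step k)
  have "(i, k) \<in> cells lam" using step cells_left[of i "Suc k" lam k] assms(3) by simp
  then show ?case using step assms(1)[of i k] by simp
qed simp

lemma column_mono:
  assumes "sorted_wrt (\<ge>) lam"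
    and "\<And>i j. (i, j) \<in> cells lam \<Longrightarrow> (i+1, j) \<in> cells lam \<Longrightarrow> (T (i, j) :: nat) + f i \<le> T (i+1, j)"
    and "(i', j) \<in> cells lam" "1 \<le> i" "i \<le> i'"
  shows "T (i, j) + sum f {i..<i'} \<le> T (i', j)"
  using assms(5,3)
proof (induction i' rule: dec_induct)
  case (step k)
  have "(k, j) \<in> cells lam" using step cells_up[of lam "Suc k" j k] assms(1,4) by simp
  then show ?case using step assms(2)[of k j] by simp
qed simp

lemma flagged_tab_row_mono:
  assumes "T \<in> flagged_tab lam \<phi>" "(i, j') \<in> cells lam" "1 \<le> j" "j \<le> j'"
  shows "T (i, j) \<le> T (i, j')"
  using row_mono[of lam T "\<lambda>_. 0" i j' j] assms by (simp add: flagged_tab_def)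

lemma flagged_tab_column_mono:
  assumes "T \<in> flagged_tab lam \<phi>" "sorted_wrt (\<ge>) lam" "(i', j) \<in> cells lam" "1 \<le> i" "i \<le> i'"
  shows "T (i, j) + (i' - i) \<le> T (i', j)"
  using column_mono[of lam T "\<lambda>_. 1" i' j i] assms by (auto simp: flagged_tab_def Suc_le_eq)

text \<open>
  Columns being strict, a flag in a row already constrains the rows of the same length above it.
\<close>

lemma flagged_tab_subset:
  assumes lam: "sorted_wrt (\<ge>) lam"
    and flags: "\<And>k. 1 \<le> k \<Longrightarrow> k \<le> length lam \<Longrightarrow> lam ! (k - 1) > 0 \<Longrightarrow>
      \<exists>r\<ge>k. r \<le> length lam \<and> lam ! (r - 1) = lam ! (k - 1) \<and> \<phi> r \<le> \<psi> k + (r - k)"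
  shows "flagged_tab lam \<phi> \<subseteq> flagged_tab lam \<psi>"
proof
  fix T assume T: "T \<in> flagged_tab lam \<phi>"
  have "T (k, j) \<le> \<psi> k" if kj: "(k, j) \<in> cells lam" for k j
  proof -
    have "1 \<le> k" "k \<le> length lam" "lam ! (k - 1) > 0" using kj by (auto simp: cells_def)
    from flags[OF this] obtain r where r: "k \<le> r" "r \<le> length lam" "lam ! (r - 1) = lam ! (k - 1)" "\<phi> r \<le> \<psi> k + (r - k)"
      by blast
    then have rj: "(r, j) \<in> cells lam" using kj by (auto simp: cells_def)
    then have "T (k, j) + (r - k) \<le> T (r, j)"
      using flagged_tab_column_mono[OF T lam] r \<open>1 \<le> k\<close> by blast
    also have "T (r, j) \<le> \<phi> r" using T rj by (auto simp: flagged_tab_def)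
    finally show ?thesis using r by simp
  qed
  then show "T \<in> flagged_tab lam \<psi>" using T by (auto simp: flagged_tab_def)
qed

text \<open>The last cell of row \<open>r + 1\<close> contains either the flag value
  \<open>x\<close> or something smaller. In the second case the whole row stays below
  \<open>x\<close>, because rows increase weakly, so the flag may be lowered. In the first case the
  cell can be deleted, and it can be put back because the flag of the row above is smaller than
  \<open>x\<close>.\<close>

lemma tab_poly_remove_corner:
  assumes r: "r < length lam" "lam ! r > 0"
    and corner: "r + 1 < length lam \<Longrightarrow> lam ! (r + 1) < lam ! r"
    and flag: "\<phi> (r + 1) > 0" "r > 0 \<Longrightarrow> \<phi> r < \<phi> (r + 1)"
  shows "tab_poly lam \<phi> = tab_poly lam (\<phi>(r + 1 := \<phi> (r + 1) - 1))
    + var (\<phi> (r + 1)) * tab_poly (lam[r := lam ! r - 1]) \<phi>"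
proof -
  define c where "c = (r + 1, lam ! r)"
  define lam' where "lam' = lam[r := lam ! r - 1]"
  define x where "x = \<phi> (r + 1)"
  have c: "c \<in> cells lam" using r by (auto simp: c_def cells_def)
  have cells': "cells lam' = cells lam - {c}"
    using r by (auto simp: cells_def lam'_def c_def nth_list_update split: if_splits)
  let ?A = "{T \<in> flagged_tab lam \<phi>. T c \<noteq> x}" and ?B = "{T \<in> flagged_tab lam \<phi>. T c = x}"
  have A: "?A = flagged_tab lam (\<phi>(r + 1 := \<phi> (r + 1) - 1))"
  proof (rule set_eqI, rule iffI)
    fix T assume T: "T \<in> ?A"
    have "T (r + 1, j) \<le> \<phi> (r + 1) - 1" if j: "(r + 1, j) \<in> cells lam" for j
    proof -
      have "T (r + 1, j) \<le> T c"
        unfolding c_def by (rule flagged_tab_row_mono[of _ lam \<phi>]) (use T j c in \<open>auto simp: cells_def c_def\<close>)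
      moreover have "T c \<le> x" using T c by (auto simp: flagged_tab_def c_def x_def)
      ultimately show ?thesis using T by (auto simp: x_def)
    qed
    then show "T \<in> flagged_tab lam (\<phi>(r + 1 := \<phi> (r + 1) - 1))"
      using T by (auto simp: flagged_tab_def)
  next
    fix T assume T: "T \<in> flagged_tab lam (\<phi>(r + 1 := \<phi> (r + 1) - 1))"
    have *: "T (i, j) \<le> (\<phi>(r + 1 := \<phi> (r + 1) - 1)) i" if "(i, j) \<in> cells lam" for i j
      using T that unfolding flagged_tab_def by blast
    have "T c < x" using *[of "r+1" "lam ! r"] c flag by (auto simp: c_def x_def)
    moreover have "T (i, j) \<le> \<phi> i" if "(i, j) \<in> cells lam" for i j
      using *[OF that] by (cases "i = r + 1") auto
    ultimately show "T \<in> ?A" using T by (auto simp: flagged_tab_def)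
  qed
  have "(\<Sum>T\<in>?B. \<Prod>c\<in>cells lam. var (T c)) = (\<Sum>T\<in>flagged_tab lam' \<phi>. var x * (\<Prod>c\<in>cells lam'. var (T c)))"
  proof (rule sum.reindex_bij_witness[of _ "\<lambda>T. T(c := x)" "\<lambda>T. restrict T (cells lam')"])
    fix T assume T: "T \<in> ?B"
    show "(restrict T (cells lam'))(c := x) = T"
      using T c by (auto simp: fun_eq_iff cells' flagged_tab_def extensional_def)
    show "restrict T (cells lam') \<in> flagged_tab lam' \<phi>"
      using T by (auto simp: flagged_tab_def cells')
    have "(\<Prod>c\<in>cells lam. var (T c)) = var (T c) * (\<Prod>c\<in>cells lam'. var (T c))"
      unfolding cells' using c by (simp add: prod.remove)
    then show "var x * (\<Prod>c\<in>cells lam'. var (restrict T (cells lam') c)) = (\<Prod>c\<in>cells lam. var (T c))"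
      using T by simp
  next
    fix T assume T: "T \<in> flagged_tab lam' \<phi>"
    have Tle: "1 \<le> T (i, j) \<and> T (i, j) \<le> \<phi> i" if "(i, j) \<in> cells lam" "(i, j) \<noteq> c" for i j
      using T that by (auto simp: flagged_tab_def cells')
    show "restrict (T(c := x)) (cells lam') = T"
      using T by (auto simp: fun_eq_iff cells' flagged_tab_def extensional_def)
    have "T(c := x) \<in> flagged_tab lam \<phi>"
      unfolding flagged_tab_def mem_Collect_eq
    proof (intro conjI allI impI; (elim conjE)?)
      show "T(c := x) \<in> extensional (cells lam)"
        using T c by (auto simp: flagged_tab_def extensional_def cells')
    next
      fix i j assume ij: "(i, j) \<in> cells lam"
      show "1 \<le> (T(c := x)) (i, j)" "(T(c := x)) (i, j) \<le> \<phi> i"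
        using Tle[OF ij] flag(1) by (auto simp: x_def c_def)
    next
      fix i j assume ij: "(i, j) \<in> cells lam" and ij': "(i + 1, j) \<in> cells lam"
      have n: "(i, j) \<noteq> c" using corner ij' by (auto simp: c_def cells_def)
      \<comment> \<open>The only conflict possible in a column is with the cell directly above
        \<open>c\<close>, whose entry is at most \<open>\<phi> r < x\<close>.\<close>
      show "(T(c := x)) (i, j) < (T(c := x)) (i + 1, j)"
      proof (cases "(i + 1, j) = c")
        case True
        then have "i = r" "r > 0" using ij by (auto simp: c_def cells_def)
        then show ?thesis using Tle[OF ij n] flag(2) True n by (auto simp: x_def)
      next
        case False
        then show ?thesis using T ij ij' n by (auto simp: flagged_tab_def cells')
      qed
    next
      fix i j assume ij: "(i, j) \<in> cells lam" and ij': "(i, j + 1) \<in> cells lam"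
      have n: "(i, j) \<noteq> c" using ij' by (auto simp: c_def cells_def)
      show "(T(c := x)) (i, j) \<le> (T(c := x)) (i, j + 1)"
      proof (cases "(i, j + 1) = c")
        case True
        then show ?thesis using Tle[OF ij n] n by (auto simp: x_def c_def)
      next
        case False
        then show ?thesis using T ij ij' n by (auto simp: flagged_tab_def cells')
      qed
    qed
    then show "T(c := x) \<in> ?B" by simp
  qed
  then have B: "(\<Sum>T\<in>?B. \<Prod>c\<in>cells lam. var (T c)) = var x * tab_poly lam' \<phi>"
    by (simp add: tab_poly_def sum_distrib_left)
  have "flagged_tab lam \<phi> = ?A \<union> ?B" by auto
  then have "tab_poly lam \<phi> = (\<Sum>T\<in>?A. \<Prod>c\<in>cells lam. var (T c)) + (\<Sum>T\<in>?B. \<Prod>c\<in>cells lam. var (T c))"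
    unfolding tab_poly_def by (subst sum.union_disjoint[symmetric]) auto
  then show ?thesis unfolding B unfolding A by (simp add: tab_poly_def x_def lam'_def)
qed

section \<open>Determinants\<close>

definition leibniz_det :: "nat \<Rightarrow> (nat \<Rightarrow> nat \<Rightarrow> 'a::comm_ring_1) \<Rightarrow> 'a" where
  "leibniz_det n M = (\<Sum>p | p permutes {..<n}. of_int (sign p) * (\<Prod>i<n. M i (p i)))"

text \<open>Isolates the factor taken from row \<open>r\<close>, so that an operation on this row
  can be carried out under the sum.\<close>

lemma leibniz_det_row_expand:
  assumes "r < n"
  shows "leibniz_det n M = (\<Sum>p | p permutes {..<n}. M r (p r) * (of_int (sign p) * (\<Prod>i\<in>{..<n} - {r}. M i (p i))))"
  unfolding leibniz_det_def using assms by (intro sum.cong) (auto simp: prod.remove[of "{..<n}" r] ac_simps)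

lemma leibniz_det_row_linear:
  assumes r: "r < n" and row: "\<And>j. j < n \<Longrightarrow> M r j = A r j + c * B r j"
    and rest: "\<And>i j. i < n \<Longrightarrow> i \<noteq> r \<Longrightarrow> A i j = M i j" "\<And>i j. i < n \<Longrightarrow> i \<noteq> r \<Longrightarrow> B i j = M i j"
  shows "leibniz_det n M = leibniz_det n A + c * leibniz_det n B"
proof -
  have "M r (p r) = A r (p r) + c * B r (p r)" if "p permutes {..<n}" for p
    using permutes_in_image[OF that, of r] r by (intro row) auto
  then show ?thesis
    unfolding leibniz_det_row_expand[OF r] sum_distrib_left sum.distrib[symmetric]
    by (intro sum.cong) (auto simp: rest algebra_simps)
qed

lemma leibniz_det_row_0:
  assumes r: "r < n" and row: "\<And>j. j < n \<Longrightarrow> M r j = 0"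
  shows "leibniz_det n M = 0"
proof -
  have "M r (p r) = 0" if "p permutes {..<n}" for p
    using permutes_in_image[OF that, of r] r by (intro row) auto
  then show ?thesis unfolding leibniz_det_row_expand[OF r] by simp
qed

text \<open>Composition with the transposition of the two rows is a sign-reversing involution on the
  terms that preserves the products. The determinant thus equals its negative, and characteristic 0
  makes it vanish.\<close>

lemma leibniz_det_identical_rows:
  fixes M :: "nat \<Rightarrow> nat \<Rightarrow> 'a::{idom, ring_char_0}"
  assumes rs: "r < n" "s < n" "r \<noteq> s" and rows: "\<And>j. j < n \<Longrightarrow> M r j = M s j"
  shows "leibniz_det n M = 0"
proof -
  let ?t = "transpose r s"
  have t: "?t permutes {..<n}" using rs by (intro permutes_swap_id) auto
  have "leibniz_det n M = (\<Sum>p | p permutes {..<n}. of_int (sign (p \<circ> ?t)) * (\<Prod>i<n. M i ((p \<circ> ?t) i)))"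
    unfolding leibniz_det_def
    by (rule sum.reindex_bij_witness[of _ "\<lambda>p. p \<circ> ?t" "\<lambda>p. p \<circ> ?t"])
      (auto simp: comp_assoc intro: permutes_compose[OF t])
  also have "\<dots> = (\<Sum>p | p permutes {..<n}. - (of_int (sign p) * (\<Prod>i<n. M i (p i))))"
  proof (rule sum.cong, rule refl)
    fix p assume "p \<in> {p. p permutes {..<n}}"
    then have p: "p permutes {..<n}" by simp
    have "sign (p \<circ> ?t) = - sign p"
      using rs(3) permutes_imp_permutation[OF _ p] by (simp add: sign_compose permutation_swap_id sign_swap_id)
    moreover have "(\<Prod>i<n. M i ((p \<circ> ?t) i)) = (\<Prod>i<n. M i (p i))"
    proof (rule prod.reindex_bij_witness[of _ ?t ?t])
      fix i assume "i \<in> {..<n}"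
      moreover have "p k < n" if "k < n" for k using permutes_in_image[OF p, of k] that by simp
      ultimately show "M (?t i) (p (?t i)) = M i ((p \<circ> ?t) i)" "?t i \<in> {..<n}" "?t i \<in> {..<n}"
        using rows[of "p r"] rows[of "p s"] rs by (auto simp: transpose_def)
    qed auto
    ultimately show "of_int (sign (p \<circ> ?t)) * (\<Prod>i<n. M i ((p \<circ> ?t) i)) = - (of_int (sign p) * (\<Prod>i<n. M i (p i)))"
      by simp
  qed
  also have "\<dots> = - leibniz_det n M" by (simp add: leibniz_det_def sum_negf)
  finally show ?thesis using eq_neg_iff_add_eq_0 by (simp add: eq_neg_iff_add_eq_0 flip: mult_2)
qed

text \<open>A permutation other than the identity maps some index below itself, where the matrix is
  zero.\<close>

lemma leibniz_det_upper_unitriangular: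
  assumes "\<And>i j. j < i \<Longrightarrow> i < n \<Longrightarrow> M i j = 0" "\<And>i. i < n \<Longrightarrow> M i i = 1"
  shows "leibniz_det n M = 1"
proof -
  have "(\<Prod>i<n. M i (p i)) = 0" if p: "p permutes {..<n}" "p \<noteq> id" for p
  proof -
    obtain i where "i < n" "p i < i"
    proof (rule ccontr)
      assume "\<not> thesis"
      then have "p i \<ge> i" if "i \<in> {..<n}" for i using that \<open>\<And>i. i < n \<Longrightarrow> p i < i \<Longrightarrow> thesis\<close>
        by (meson lessThan_iff not_le)
      then show False using permutes_natset_ge[OF p(1)] p(2) by blast
    qed
    then show ?thesis using assms(1) by (intro prod_zero) auto
  qed
  then have "leibniz_det n M = (\<Sum>p\<in>{id}. of_int (sign p) * (\<Prod>i<n. M i (p i)))"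
    unfolding leibniz_det_def by (intro sum.mono_neutral_right) (auto simp: finite_permutations permutes_id)
  then show ?thesis using assms(2) by simp
qed

section \<open>The flagged Jacobi--Trudi formula\<close>

fun complete_sym_nat :: "nat \<Rightarrow> nat \<Rightarrow> int_mpoly" where
  "complete_sym_nat 0 k = 1"
| "complete_sym_nat (Suc n) 0 = 0"
| "complete_sym_nat (Suc n) (Suc k) = complete_sym_nat (Suc n) k + var (Suc k) * complete_sym_nat n (Suc k)"

text \<open>Integer degrees, because the entries below the diagonal of a Jacobi-Trudi matrix may
  have negative degree and must then vanish.\<close>

definition complete_sym :: "int \<Rightarrow> nat \<Rightarrow> int_mpoly" where
  "complete_sym n k = (if n < 0 then 0 else complete_sym_nat (nat n) k)"

lemma complete_sym_neg [simp]: "n < 0 \<Longrightarrow> complete_sym n k = 0"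
  by (simp add: complete_sym_def)

lemma complete_sym_0 [simp]: "complete_sym 0 k = 1"
  by (simp add: complete_sym_def)

lemma complete_sym_pos_0: "n > 0 \<Longrightarrow> complete_sym n 0 = 0"
  by (cases "nat n") (auto simp: complete_sym_def)

lemma complete_sym_Suc: "complete_sym n (Suc k) = complete_sym n k + var (Suc k) * complete_sym (n - 1) (Suc k)"
proof (cases "n > 0")
  case True
  then obtain m where "n = int (Suc m)" using zero_less_imp_eq_int by (metis Suc_pred)
  then show ?thesis by (simp add: complete_sym_def nat_add_distrib)
next
  case False
  then show ?thesis by (cases "n = 0") auto
qed

text \<open>Strong induction on an integer degree, grounded in the negative degrees. The recursions
  below step to \<open>n - 1\<close> and \<open>n - 2\<close> and may leave the nonnegative
  range.\<close>

lemma complete_sym_induct [case_names neg step]: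
  assumes "\<And>n. n < (0::int) \<Longrightarrow> P n" "\<And>n. (\<And>m. m < n \<Longrightarrow> P m) \<Longrightarrow> P n"
  shows "P n"
proof -
  have "\<forall>n < int k. P n" for k
  proof (induction k)
    case (Suc k)
    have "P (int k)" using Suc assms(2) by blast
    then show ?case using Suc by (metis int_ops(4) zless_add1_eq linorder_neqE_linordered_idom)
  qed (use assms in auto)
  then show ?thesis by (metis zle_iff_zadd int_one_le_iff_zero_less assms(1) linorder_not_less zless_add1_eq of_nat_Suc add.commute add_0)
qed

lemma swap_vars_complete_sym_less: "k < i \<Longrightarrow> swap_vars i (complete_sym n k) = complete_sym n k"
proof -
  assume "k < i"
  then have "swap_vars i (complete_sym_nat m k) = complete_sym_nat m k" for m
    by (induction m k rule: complete_sym_nat.induct) (auto simp: swap_vars_add swap_vars_mult swap_vars_var)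
  then show ?thesis by (simp add: complete_sym_def)
qed

text \<open>The coefficients are the elementary symmetric polynomials of the last two variables,
  which makes the symmetry in these variables visible and provable by induction on the
  degree.\<close>

lemma complete_sym_Suc_Suc:
  "complete_sym n (Suc (Suc k)) = complete_sym n k + (var (Suc k) + var (Suc (Suc k))) * complete_sym (n - 1) (Suc (Suc k))
    - var (Suc k) * var (Suc (Suc k)) * complete_sym (n - 2) (Suc (Suc k))"
  using complete_sym_Suc[of n "Suc k"] complete_sym_Suc[of n k] complete_sym_Suc[of "n - 1" "Suc k"]
  by (simp add: algebra_simps)

lemma swap_vars_complete_sym_Suc:
  assumes "i > 0"
  shows "swap_vars i (complete_sym n (Suc i)) = complete_sym n (Suc i)"
proof (induction n rule: complete_sym_induct)
  case (step n)
  obtain k where i: "i = Suc k" using assms gr0_implies_Suc by blast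
  have "swap_vars i (complete_sym n k) = complete_sym n k" using i by (intro swap_vars_complete_sym_less) auto
  then show ?case
    using step[of "n - 1"] step[of "n - 2"] unfolding i
    by (subst (1 2) complete_sym_Suc_Suc) (simp add: swap_vars_add swap_vars_diff swap_vars_mult swap_vars_var add.commute mult.commute)
qed auto

lemma swap_vars_complete_sym:
  assumes "i > 0" "k \<noteq> i"
  shows "swap_vars i (complete_sym n k) = complete_sym n k"
proof (cases "k < i")
  case True
  then show ?thesis by (rule swap_vars_complete_sym_less)
next
  case False
  then have "Suc i \<le> k" using assms by simp
  then show ?thesis
  proof (induction k arbitrary: n rule: dec_induct)
    case base
    then show ?case using assms swap_vars_complete_sym_Suc by simp
  next
    case (step k)
    show ?case
    proof (induction n rule: complete_sym_induct)
      case (step n)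
      have "swap_vars i (var (Suc k)) = var (Suc k)" using \<open>Suc i \<le> k\<close> by (simp add: swap_vars_var)
      then show ?case
        using step[of "n - 1"] \<open>\<And>n. swap_vars i (complete_sym n k) = complete_sym n k\<close>
        by (subst (1 2) complete_sym_Suc) (simp add: swap_vars_add swap_vars_mult)
    qed auto
  qed
qed

text \<open>Write \<open>complete_sym n i\<close> through the polynomials in \<open>i + 1\<close>
  variables. These are invariant under \<open>swap_vars i\<close>, so the divided difference only
  meets the coefficient \<open>- var (i + 1)\<close>, which it sends to 1.\<close>

lemma divided_diff_complete_sym:
  assumes "i > 0"
  shows "divided_diff i (complete_sym n i) = complete_sym (n - 1) (i + 1)"
proof (rule divided_diff_eqI)
  have h: "complete_sym n i = complete_sym n (i + 1) - var (i + 1) * complete_sym (n - 1) (i + 1)"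
    using complete_sym_Suc[of n i] by simp
  have "swap_vars i (complete_sym m (i + 1)) = complete_sym m (i + 1)" for m
    using assms by (intro swap_vars_complete_sym) auto
  then have "swap_vars i (complete_sym n i) = complete_sym n (i + 1) - var i * complete_sym (n - 1) (i + 1)"
    unfolding h by (simp only: swap_vars_diff swap_vars_mult swap_vars_var transpose_apply_second)
  then show "(var i - var (i + 1)) * complete_sym (n - 1) (i + 1) = complete_sym n i - swap_vars i (complete_sym n i)"
    by (simp add: h algebra_simps)
qed

text \<open>The Jacobi-Trudi matrix in which each row has its own set of variables. Matrix indices
  start at 0 and flags at 1, whence \<open>lam ! i\<close> next to
  \<open>\<phi> (i + 1)\<close>.\<close>

definition jacobi_trudi :: "nat list \<Rightarrow> (nat \<Rightarrow> nat) \<Rightarrow> int_mpoly" where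
  "jacobi_trudi lam \<phi> = leibniz_det (length lam) (\<lambda>i j. complete_sym (int (lam ! i) + int j - int i) (\<phi> (i + 1)))"

text \<open>Rows with a flag other than \<open>i\<close> are invariant under
  \<open>swap_vars i\<close>. In each term of the expansion along row \<open>k\<close> the operator
  therefore reaches the entry of row \<open>k\<close> alone, lowering its degree and raising its
  flag.\<close>

lemma divided_diff_jacobi_trudi:
  assumes "i > 0" "k < length lam" "lam ! k > 0" "\<phi> (k + 1) = i"
    and other: "\<And>k'. k' < length lam \<Longrightarrow> k' \<noteq> k \<Longrightarrow> \<phi> (k' + 1) \<noteq> i"
  shows "divided_diff i (jacobi_trudi lam \<phi>) = jacobi_trudi (lam[k := lam ! k - 1]) (\<phi>(k + 1 := i + 1))"
proof -
  let ?n = "length lam"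
  let ?M = "\<lambda>i j. complete_sym (int (lam ! i) + int j - int i) (\<phi> (i + 1))"
  let ?M' = "\<lambda>i' j. complete_sym (int (lam[k := lam ! k - 1] ! i') + int j - int i') ((\<phi>(k + 1 := i + 1)) (i' + 1))"
  have "divided_diff i (?M k (p k) * (of_int (sign p) * (\<Prod>i\<in>{..<?n} - {k}. ?M i (p i))))
      = ?M' k (p k) * (of_int (sign p) * (\<Prod>i\<in>{..<?n} - {k}. ?M' i (p i)))" for p
  proof -
    let ?g = "of_int (sign p) * (\<Prod>i\<in>{..<?n} - {k}. ?M i (p i))"
    have "swap_vars i (?M k' (p k')) = ?M k' (p k')" if "k' \<in> {..<?n} - {k}" for k'
      using other[of k'] that assms(1) by (intro swap_vars_complete_sym) auto
    then have "swap_vars i ?g = ?g"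
      by (simp add: swap_vars_mult swap_vars_prod)
    then have "divided_diff i (?g * ?M k (p k)) = ?g * divided_diff i (?M k (p k))"
      by (rule divided_diff_mult_left)
    also have "divided_diff i (?M k (p k)) = ?M' k (p k)"
      using divided_diff_complete_sym[OF assms(1)] assms by (simp add: of_nat_diff algebra_simps)
    finally have "divided_diff i (?M k (p k) * ?g) = ?M' k (p k) * ?g"
      by (simp only: mult.commute)
    moreover have "(\<Prod>i\<in>{..<?n} - {k}. ?M i (p i)) = (\<Prod>i\<in>{..<?n} - {k}. ?M' i (p i))"
      by (intro prod.cong) auto
    ultimately show ?thesis by metis
  qed
  then show ?thesis
    unfolding jacobi_trudi_def using assms(2) by (simp only: leibniz_det_row_expand[OF assms(2)] length_list_update divided_diff_sum)
qed

text \<open>The counterpart of \<open>tab_poly_remove_corner\<close>, from the recursion for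
  \<open>complete_sym\<close> in a single row. It does not ask for a corner at \<open>r\<close>,
  since it is also applied when the next row has the same length.\<close>

lemma jacobi_trudi_remove_corner:
  assumes r: "r < length lam" "lam ! r > 0" and flag: "\<phi> (r + 1) > 0"
  shows "jacobi_trudi lam \<phi> = jacobi_trudi lam (\<phi>(r + 1 := \<phi> (r + 1) - 1))
    + var (\<phi> (r + 1)) * jacobi_trudi (lam[r := lam ! r - 1]) \<phi>"
proof -
  have "complete_sym n (\<phi> (r + 1)) = complete_sym n (\<phi> (r + 1) - 1) + var (\<phi> (r + 1)) * complete_sym (n - 1) (\<phi> (r + 1))" for n
    using complete_sym_Suc[of n "\<phi> (r + 1) - 1"] flag by simp
  from this[of "int (lam ! r) + int _ - int r"] show ?thesis
    unfolding jacobi_trudi_def length_list_update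
    by (intro leibniz_det_row_linear[OF r(1)]) (use r(2) in \<open>auto simp: r(1) of_nat_diff algebra_simps\<close>)
qed

text \<open>Take the first row at which the shape drops, the flag repeats or the shape ends. Before
  it all rows have equal length and the flags increase strictly, which is the condition for
  reinserting a cell in row \<open>r + 1\<close>.\<close>

lemma first_corner:
  fixes lam :: "nat list" and \<phi> :: "nat \<Rightarrow> nat"
  assumes lam: "sorted_wrt (\<ge>) lam" "lam \<noteq> []"
    and flag: "\<And>i. 1 \<le> i \<Longrightarrow> i < length lam \<Longrightarrow> \<phi> i \<le> \<phi> (i + 1)"
  obtains r where "r < length lam" "r + 1 = length lam \<or> lam ! (r + 1) < lam ! r \<or> \<phi> (r + 1) = \<phi> (r + 2)"
    "lam ! r = lam ! 0" "r > 0 \<Longrightarrow> \<phi> r < \<phi> (r + 1)" "\<phi> 1 \<le> \<phi> (r + 1)"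
proof -
  define P where "P r \<longleftrightarrow> r < length lam \<and> (r + 1 = length lam \<or> lam ! (r + 1) < lam ! r \<or> \<phi> (r + 1) = \<phi> (r + 2))" for r
  have "P (length lam - 1)" using lam(2) by (simp add: P_def)
  then obtain r where r: "P r" and least: "\<And>s. s < r \<Longrightarrow> \<not> P s"
    using exists_least_iff[of P] by blast
  have before: "lam ! s = lam ! (s + 1) \<and> \<phi> (s + 1) < \<phi> (s + 2)" if "s < r" for s
  proof -
    have "s + 1 < length lam" using r that by (simp add: P_def)
    then show ?thesis
      using least[OF that] sorted_desc_nth_mono[OF lam(1), of s "s+1"] flag[of "s + 1"] by (auto simp: P_def)
  qed
  have "s \<le> r \<Longrightarrow> lam ! s = lam ! 0 \<and> \<phi> 1 \<le> \<phi> (s + 1)" for s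
  proof (induction s)
    case (Suc s)
    then show ?case using before[of s] by auto
  qed simp
  then have "lam ! r = lam ! 0" "\<phi> 1 \<le> \<phi> (r + 1)" by blast+
  moreover have "\<phi> r < \<phi> (r + 1)" if "r > 0" using before[of "r - 1"] that by simp
  ultimately show ?thesis using that[of r] r unfolding P_def by blast
qed

text \<open>
  Both sides satisfy the same recursion at the first row \<open>r\<close> in which \<open>\<lambda>\<close> drops or the flag stays constant.
  In the second case removing a cell makes two rows of the matrix equal.
\<close>

theorem tab_poly_eq_jacobi_trudi:
  assumes "sorted_wrt (\<ge>) lam" "\<And>i. 1 \<le> i \<Longrightarrow> i < length lam \<Longrightarrow> \<phi> i \<le> \<phi> (i + 1)"
  shows "tab_poly lam \<phi> = jacobi_trudi lam \<phi>"
  using assms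
proof (induction "sum_list lam + (\<Sum>i<length lam. \<phi> (i + 1))" arbitrary: lam \<phi> rule: less_induct)
  case less
  note lam = less.prems(1) and flag = less.prems(2)
  show ?case
  proof (cases "lam = [] \<or> lam ! 0 = 0")
    case True
    have zero: "lam ! i = 0" if "i < length lam" for i
      using True sorted_desc_nth_mono[OF lam, of 0 i] that by auto
    have no_cells: "cells lam = {}"
    proof -
      have "lam ! (i - 1) = 0" if "1 \<le> i" "i \<le> length lam" for i
        using that by (intro zero) auto
      then show ?thesis by (auto simp: cells_def)
    qed
    then have "flagged_tab lam \<phi> = {\<lambda>_. undefined}" by (auto simp: flagged_tab_def)
    then have "tab_poly lam \<phi> = 1" by (simp add: tab_poly_def no_cells)
    moreover have "jacobi_trudi lam \<phi> = 1"
      unfolding jacobi_trudi_def by (rule leibniz_det_upper_unitriangular) (auto simp: zero)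
    ultimately show ?thesis by simp
  next
    case False
    then have pos: "lam \<noteq> []" "lam ! 0 > 0" by auto
    show ?thesis
    proof (cases "\<phi> 1 = 0")
      case True
      \<comment> \<open>No entry is allowed in the first cell; correspondingly the first row of the
        matrix consists of polynomials of positive degree in no variables.\<close>
      have "(1, 1) \<in> cells lam" using pos by (auto simp: cells_def Suc_le_eq)
      then have "flagged_tab lam \<phi> = {}" using True by (force simp: flagged_tab_def)
      then have "tab_poly lam \<phi> = 0" by (simp add: tab_poly_def)
      moreover have "jacobi_trudi lam \<phi> = 0"
        unfolding jacobi_trudi_def by (rule leibniz_det_row_0[of 0]) (use pos True in \<open>auto intro: complete_sym_pos_0\<close>)
      ultimately show ?thesis by simp
    next
      case False
      obtain r where r: "r < length lam" "r + 1 = length lam \<or> lam ! (r + 1) < lam ! r \<or> \<phi> (r + 1) = \<phi> (r + 2)"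
        "lam ! r = lam ! 0" "r > 0 \<Longrightarrow> \<phi> r < \<phi> (r + 1)" "\<phi> 1 \<le> \<phi> (r + 1)"
        using first_corner[of lam \<phi>, OF lam pos(1) flag] by blast
      have r_pos: "lam ! r > 0" "\<phi> (r + 1) > 0" using r pos False by auto
      let ?\<phi> = "\<phi>(r + 1 := \<phi> (r + 1) - 1)" and ?lam = "lam[r := lam ! r - 1]"
      have "(\<Sum>i<length lam. ?\<phi> (i + 1)) < (\<Sum>i<length lam. \<phi> (i + 1))"
        by (rule sum_strict_mono_ex1) (use r r_pos in auto)
      moreover have flag': "?\<phi> i \<le> ?\<phi> (i + 1)" if "1 \<le> i" "i < length lam" for i
        using flag[OF that] r(4) that r by (cases "i = r") auto
      ultimately have 1: "tab_poly lam ?\<phi> = jacobi_trudi lam ?\<phi>"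
        using less.hyps[of lam ?\<phi>] lam by simp
      note jt = jacobi_trudi_remove_corner[of r lam \<phi>, OF r(1) r_pos]
      show ?thesis
      proof (cases "r + 1 < length lam \<longrightarrow> lam ! (r + 1) < lam ! r")
        case True
        have "sum_list ?lam < sum_list lam"
          using sum_list_update[OF r(1), of "lam ! r - 1"] elem_le_sum_list[OF r(1)] r_pos(1) by linarith
        moreover have "sorted_wrt (\<ge>) ?lam"
          unfolding sorted_wrt_iff_nth_less
        proof (intro allI impI)
          fix i j assume ij: "i < j" "j < length ?lam"
          have "lam ! j \<le> lam ! i" using sorted_desc_nth_mono[OF lam] ij by simp
          moreover have "lam ! j \<le> lam ! (r + 1)" if "i = r" using sorted_desc_nth_mono[OF lam, of "r+1" j] ij that by simp
          ultimately show "?lam ! j \<le> ?lam ! i"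
            using True ij r(1) by (auto simp: nth_list_update)
        qed
        ultimately have 2: "tab_poly ?lam \<phi> = jacobi_trudi ?lam \<phi>"
          using less.hyps[of ?lam \<phi>] flag by simp
        show ?thesis
          unfolding jt 1[symmetric] 2[symmetric]
          by (rule tab_poly_remove_corner) (use r r_pos True in auto)
      next
        case False
        then have eq: "r + 1 < length lam" "lam ! (r + 1) = lam ! r" "\<phi> (r + 1) = \<phi> (r + 2)"
          using r sorted_desc_nth_mono[OF lam, of r "r + 1"] by auto
        have "jacobi_trudi ?lam \<phi> = 0"
          unfolding jacobi_trudi_def
          by (rule leibniz_det_identical_rows[of r _ "r + 1"]) (use eq r_pos in \<open>auto simp: of_nat_diff algebra_simps\<close>)
        \<comment> \<open>Row \<open>r + 2\<close> has the same length and the same flag as row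
          \<open>r + 1\<close>, so strict columns already keep row \<open>r + 1\<close> one below
          that flag.\<close>
        moreover have "flagged_tab lam \<phi> = flagged_tab lam ?\<phi>"
        proof (rule equalityI; rule flagged_tab_subset[OF lam])
          show "\<exists>r'\<ge>k. r' \<le> length lam \<and> lam ! (r' - 1) = lam ! (k - 1) \<and> \<phi> r' \<le> ?\<phi> k + (r' - k)"
            if "1 \<le> k" "k \<le> length lam" for k
            using that eq by (cases "k = r + 1") (auto intro: exI[of _ k] exI[of _ "r + 2"])
          show "\<exists>r'\<ge>k. r' \<le> length lam \<and> lam ! (r' - 1) = lam ! (k - 1) \<and> ?\<phi> r' \<le> \<phi> k + (r' - k)"
            if "1 \<le> k" "k \<le> length lam" for k
            using that by (intro exI[of _ k]) auto
        qed
        ultimately show ?thesis using 1 jt by (simp add: tab_poly_def)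
      qed
    qed
  qed
qed

text \<open>The detour through the determinant is made on both sides, so both shapes must be
  partitions and both flags monotone.\<close>

corollary divided_diff_tab_poly:
  assumes "sorted_wrt (\<ge>) lam" "sorted_wrt (\<ge>) (lam[k := lam ! k - 1])"
    and "\<And>i. 1 \<le> i \<Longrightarrow> i < length lam \<Longrightarrow> \<phi> i \<le> \<phi> (i + 1)"
    and "\<And>j. 1 \<le> j \<Longrightarrow> j < length lam \<Longrightarrow> (\<phi>(k + 1 := i + 1)) j \<le> (\<phi>(k + 1 := i + 1)) (j + 1)"
    and "i > 0" "k < length lam" "lam ! k > 0" "\<phi> (k + 1) = i"
    and "\<And>k'. k' < length lam \<Longrightarrow> k' \<noteq> k \<Longrightarrow> \<phi> (k' + 1) \<noteq> i"
  shows "divided_diff i (tab_poly lam \<phi>) = tab_poly (lam[k := lam ! k - 1]) (\<phi>(k + 1 := i + 1))"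
  using divided_diff_jacobi_trudi[of i k lam \<phi>] assms
    tab_poly_eq_jacobi_trudi[of lam \<phi>] tab_poly_eq_jacobi_trudi[of "lam[k := lam ! k - 1]" "\<phi>(k + 1 := i + 1)"] by simp

section \<open>Schubert polynomials of vexillary permutations\<close>

definition sorted_parts :: "nat \<Rightarrow> (nat \<Rightarrow> nat) \<Rightarrow> nat list" where
  "sorted_parts m c = rev (sort (map c [1..<m+1]))"

definition last_ge :: "nat \<Rightarrow> (nat \<Rightarrow> nat) \<Rightarrow> nat \<Rightarrow> nat" where
  "last_ge m c b = Max {j \<in> {1..m}. b \<le> c j}"

text \<open>Zero entries of the code are kept as rows without cells. The shape then always has
  \<open>m\<close> rows, and a divided difference may empty a row without changing their
  number.\<close>

definition vex_poly :: "nat \<Rightarrow> (nat \<Rightarrow> nat) \<Rightarrow> int_mpoly" where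
  "vex_poly m c = tab_poly (sorted_parts m c) (\<lambda>r. last_ge m c (sorted_parts m c ! (r - 1)))"

lemma sorted_parts_cong: "(\<And>j. 1 \<le> j \<Longrightarrow> j \<le> m \<Longrightarrow> c j = c' j) \<Longrightarrow> sorted_parts m c = sorted_parts m c'"
  unfolding sorted_parts_def by (intro arg_cong[of _ _ rev] arg_cong[of _ _ sort]) auto

lemma last_ge_cong:
  assumes "\<And>j. 1 \<le> j \<Longrightarrow> j \<le> m \<Longrightarrow> c j = c' j"
  shows "last_ge m c b = last_ge m c' b"
proof -
  have "{j \<in> {1..m}. b \<le> c j} = {j \<in> {1..m}. b \<le> c' j}" using assms by auto
  then show ?thesis by (simp add: last_ge_def)
qed

lemma vex_poly_cong:
  assumes "\<And>j. 1 \<le> j \<Longrightarrow> j \<le> m \<Longrightarrow> c j = c' j"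
  shows "vex_poly m c = vex_poly m c'"
  using sorted_parts_cong[of m c c'] last_ge_cong[of m c c'] assms by (simp add: vex_poly_def)

lemma length_sorted_parts [simp]: "length (sorted_parts m c) = m"
  by (simp add: sorted_parts_def)

lemma set_sorted_parts: "set (sorted_parts m c) = c ` {1..m}"
  by (auto simp: sorted_parts_def)

lemma mset_sorted_parts: "mset (sorted_parts m c) = mset (map c [1..<m+1])"
  unfolding sorted_parts_def by (simp only: mset_rev mset_sort)

lemma sorted_wrt_sorted_parts: "sorted_wrt (\<ge>) (sorted_parts m c)"
  by (simp add: sorted_parts_def sorted_wrt_rev)

lemma sorted_parts_eqI:
  assumes "sorted_wrt (\<ge>) lam" "mset lam = mset (map c [1..<m+1])"
  shows "sorted_parts m c = lam"
proof -
  have "sort (map c [1..<m+1]) = rev lam"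
    using assms by (intro properties_for_sort) (auto simp: sorted_wrt_rev)
  then show ?thesis by (simp add: sorted_parts_def)
qed

text \<open>Transfers a count of positions in the code to a count of rows, used to find enough rows
  of one length.\<close>

lemma card_sorted_parts_eq: "card {s. s < m \<and> sorted_parts m c ! s = a} = card {j \<in> {1..m}. c j = a}"
proof -
  have "card {s. s < m \<and> sorted_parts m c ! s = a} = size (filter_mset (\<lambda>x. x = a) (mset (sorted_parts m c)))"
    using length_filter_conv_card[of "\<lambda>x. x = a" "sorted_parts m c"]
    by (metis length_sorted_parts mset_filter size_mset)
  also have "\<dots> = length (filter (\<lambda>x. x = a) (map c [1..<m+1]))"
    unfolding mset_sorted_parts by (metis mset_filter size_mset)
  also have "\<dots> = length (filter (\<lambda>j. c j = a) [1..<m+1])" by (simp add: filter_map comp_def del: upt_Suc)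
  also have "\<dots> = card (set (filter (\<lambda>j. c j = a) [1..<m+1]))"
    by (rule distinct_card[symmetric]) simp
  also have "set (filter (\<lambda>j. c j = a) [1..<m+1]) = {j \<in> {1..m}. c j = a}" by auto
  finally show ?thesis .
qed

lemma last_ge_eqI:
  assumes "1 \<le> j" "j \<le> m" "b \<le> c j" "\<And>j'. j < j' \<Longrightarrow> j' \<le> m \<Longrightarrow> c j' < b"
  shows "last_ge m c b = j"
  unfolding last_ge_def
proof (rule Max_eqI)
  show "y \<le> j" if "y \<in> {j \<in> {1..m}. b \<le> c j}" for y
    using assms(4)[of y] that by (cases "y \<le> j") auto
qed (use assms in auto)

lemma last_ge_ge: "1 \<le> j \<Longrightarrow> j \<le> m \<Longrightarrow> b \<le> c j \<Longrightarrow> j \<le> last_ge m c b"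
  unfolding last_ge_def by (rule Max_ge) auto

lemma last_ge_in:
  assumes "b \<in> c ` {1..m}"
  shows "1 \<le> last_ge m c b" "last_ge m c b \<le> m" "b \<le> c (last_ge m c b)"
proof -
  have "last_ge m c b \<in> {j \<in> {1..m}. b \<le> c j}"
    unfolding last_ge_def by (rule Max_in) (use assms in auto)
  then show "1 \<le> last_ge m c b" "last_ge m c b \<le> m" "b \<le> c (last_ge m c b)" by auto
qed

lemma last_ge_antimono:
  assumes "b' \<in> c ` {1..m}" "b \<le> b'"
  shows "last_ge m c b' \<le> last_ge m c b"
  using last_ge_in[OF assms(1)] assms(2) last_ge_ge[of "last_ge m c b'" m b c] by auto

text \<open>Once a position \<open>j\<close> meets the bound for both functions, only later
  positions can compete for the maximum.\<close>

lemma last_ge_eq_above: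
  assumes "1 \<le> j" "j \<le> m" "b \<le> c j" "b \<le> c' j" "\<And>k. j < k \<Longrightarrow> k \<le> m \<Longrightarrow> c' k = c k"
  shows "last_ge m c' b = last_ge m c b"
proof (rule antisym)
  have "last_ge m d b \<le> last_ge m d' b"
    if "b \<le> d j" "b \<le> d' j" "\<And>k. j < k \<Longrightarrow> k \<le> m \<Longrightarrow> d' k = d k" for d d'
  proof -
    have fin: "finite {j \<in> {1..m}. b \<le> d j}" "{j \<in> {1..m}. b \<le> d j} \<noteq> {}" using assms that by auto
    show ?thesis
      unfolding last_ge_def[of m d]
    proof (subst Max_le_iff[OF fin], rule ballI)
      fix k assume k: "k \<in> {j \<in> {1..m}. b \<le> d j}"
      show "k \<le> last_ge m d' b"
      proof (cases "k \<le> j")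
        case True
        then show ?thesis using last_ge_ge[of j m b d'] assms that by auto
      next
        case False
        then show ?thesis using last_ge_ge[of k m b d'] k that(3)[of k] by auto
      qed
    qed
  qed
  from this[of c' c] this[of c c'] show "last_ge m c' b \<le> last_ge m c b" "last_ge m c b \<le> last_ge m c' b"
    using assms by auto
qed

text \<open>
  Here \<open>c\<close> is the code of a vexillary permutation \<open>w\<close> and \<open>c(i := c (i+1) + 1, i+1 := c i)\<close> that of
  \<open>w s\<^sub>i\<close>, where \<open>i\<close> is an ascent of \<open>w\<close>. The flags of \<open>w s\<^sub>i\<close> are first changed, without affecting the
  tableaux, so that the flag \<open>i\<close> occurs in a single row; then the divided difference acts on that
  row alone.
\<close>

lemma divided_diff_vex_poly:
  fixes m i :: nat and c :: "nat \<Rightarrow> nat"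
  assumes i: "1 \<le> i" "i < m" and asc: "c i \<le> c (i+1)"
    and decr: "\<And>j. i + 1 \<le> j \<Longrightarrow> j < m \<Longrightarrow> c (j+1) \<le> c j"
    and gap: "\<And>j. 1 \<le> j \<Longrightarrow> j < i \<Longrightarrow> c i < c j \<Longrightarrow> c (i+1) < c j"
    and next_value: "\<And>j. 1 \<le> j \<Longrightarrow> j < i \<Longrightarrow> c j = c (i+1) + 1 \<Longrightarrow> c (i+1) + 1 \<le> c (i-1)"
  shows "divided_diff i (vex_poly m (c(i := c (i+1) + 1, i+1 := c i))) = vex_poly m c"
proof -
  define a where "a = c (i+1)"
  define c' where "c' = c(i := a + 1, i+1 := c i)"
  define lam where "lam = sorted_parts m c"
  have c': "c' i = a + 1" "c' (i+1) = c i" "\<And>j. j \<noteq> i \<Longrightarrow> j \<noteq> i + 1 \<Longrightarrow> c' j = c j"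
    by (auto simp: c'_def)
  have lam: "sorted_wrt (\<ge>) lam" "length lam = m" "set lam = c ` {1..m}"
    by (auto simp: lam_def sorted_wrt_sorted_parts set_sorted_parts)
  have decr': "c k \<le> c j" if "i + 1 \<le> j" "j \<le> k" "k \<le> m" for j k
    using that(2,3)
  proof (induction k rule: dec_induct)
    case (step k)
    then show ?case using decr[of k] that(1) by simp
  qed simp
  have after: "c j \<le> a" if "i + 1 \<le> j" "j \<le> m" for j
    using decr'[of "i+1" j] that by (simp add: a_def)
  have after': "c' j \<le> a" if "i < j" "j \<le> m" for j
    using after[of j] that asc by (cases "j = i + 1") (auto simp: c'_def a_def)
  have "a \<in> set lam" unfolding lam a_def using i by auto
  then have ex_k: "\<exists>s. s < m \<and> lam ! s = a" using lam by (auto simp: in_set_conv_nth)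
  \<comment> \<open>Passing from \<open>c\<close> to \<open>c'\<close> replaces one entry
    \<open>a\<close> by \<open>a + 1\<close>. The topmost row of length \<open>a\<close> is the one
    that can grow while the list stays sorted.\<close>
  define k where "k = (LEAST s. s < m \<and> lam ! s = a)"
  have k: "k < m" "lam ! k = a" using LeastI_ex[OF ex_k] by (auto simp: k_def)
  have before_k: "a < lam ! s" if "s < k" for s
  proof -
    have "\<not> (s < m \<and> lam ! s = a)"
      using that unfolding k_def by (rule not_less_Least)
    then show ?thesis using that k sorted_desc_nth_mono[OF lam(1), of s k] lam(2) by simp
  qed
  have after_k: "lam ! s \<le> a" if "k \<le> s" "s < m" for s
    using sorted_desc_nth_mono[OF lam(1), of k s] that k lam(2) by simp
  define lam' where "lam' = lam[k := a + 1]"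
  have lam'_nth: "lam' ! s = (if s = k then a + 1 else lam ! s)" if "s < m" for s
    using that lam(2) by (auto simp: lam'_def nth_list_update)
  have lam'_sorted: "sorted_wrt (\<ge>) lam'"
    unfolding sorted_wrt_iff_nth_less
  proof (intro allI impI)
    fix s t assume "s < t" "t < length lam'"
    then have st: "s < t" "t < m" "lam ! t \<le> lam ! s"
      using lam sorted_desc_nth_mono[OF lam(1), of s t] by (auto simp: lam'_def)
    then show "lam' ! t \<le> lam' ! s"
      using before_k[of s] after_k[of t] by (auto simp: lam'_nth)
  qed
  have upt_split: "mset (map d [1..<m+1]) = add_mset (d i) (add_mset (d (i+1)) (image_mset d (mset_set ({1..m} - {i,i+1}))))" for d :: "nat \<Rightarrow> nat"
  proof -
    have "mset (map d [1..<m+1]) = image_mset d (mset_set {1..<m+1})"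
      by (simp only: mset_map mset_upt)
    also have "{1..<m+1} = insert i (insert (i+1) ({1..m} - {i,i+1}))" using i by auto
    finally show ?thesis by simp
  qed
  have "mset lam' = mset (map c' [1..<m+1])"
  proof -
    have "mset lam' = add_mset (a + 1) (mset lam - {#a#})"
      unfolding lam'_def using k lam(2) by (simp add: mset_update)
    also have "mset lam = mset (map c [1..<m+1])" by (simp only: lam_def mset_sorted_parts)
    also have "add_mset (a + 1) (mset (map c [1..<m+1]) - {#a#}) = mset (map c' [1..<m+1])"
    proof -
      have "image_mset c' (mset_set ({1..m} - {i,i+1})) = image_mset c (mset_set ({1..m} - {i,i+1}))"
        by (intro image_mset_cong) (auto simp: c'_def)
      then show ?thesis unfolding upt_split using c'(1,2) by (simp add: a_def)
    qed
    finally show ?thesis .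
  qed
  with lam'_sorted have lam': "sorted_parts m c' = lam'" by (rule sorted_parts_eqI)
  \<comment> \<open>Entries above \<open>a + 1\<close> are common to both codes and lie to the left
    of \<open>i\<close>, since \<open>c i\<close> and everything from \<open>i + 1\<close> on are at
    most \<open>a\<close>.\<close>
  have flag_big: "last_ge m c' b = last_ge m c b" "last_ge m c b \<le> i - 1" if "b \<in> c ` {1..m}" "a + 1 < b" for b
  proof -
    have *: "b \<le> c j \<longleftrightarrow> b \<le> c' j" if "j \<in> {1..m}" for j
      using \<open>a + 1 < b\<close> asc by (auto simp: c'_def a_def)
    then have "{j \<in> {1..m}. b \<le> c' j} = {j \<in> {1..m}. b \<le> c j}" by blast
    then show "last_ge m c' b = last_ge m c b" by (simp add: last_ge_def)
    have "last_ge m c b \<noteq> i" "\<not> i + 1 \<le> last_ge m c b"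
      using last_ge_in[OF that(1)] after[of "last_ge m c b"] that(2) asc by (auto simp: a_def)
    then show "last_ge m c b \<le> i - 1" by simp
  qed
  \<comment> \<open>By \<open>next_value\<close> a part \<open>a + 1\<close> of \<open>c\<close> has
    flag exactly \<open>i - 1\<close>; in \<open>c'\<close> the new entry at \<open>i\<close> moves
    this flag to \<open>i\<close>.\<close>
  have flag_next: "last_ge m c (a + 1) = i - 1" if "a + 1 \<in> c ` {1..m}"
  proof -
    from that obtain j where "a + 1 = c j" "j \<in> {1..m}" by (rule imageE)
    then have j: "1 \<le> j" "j \<le> m" "c j = a + 1" by auto
    then have "j < i" using after[of j] asc by (cases j i rule: linorder_cases) (auto simp: a_def)
    then have "a + 1 \<le> c (i - 1)" using next_value[of j] j by (auto simp: a_def)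
    moreover have "c j' < a + 1" if "i - 1 < j'" "j' \<le> m" for j'
    proof (cases "j' = i")
      case False
      then have "i + 1 \<le> j'" using that by linarith
      then show ?thesis using after[of j'] that by simp
    qed (use asc in \<open>simp add: a_def\<close>)
    ultimately show ?thesis using \<open>j < i\<close> j(1) i by (intro last_ge_eqI) auto
  qed
  have flag_next': "last_ge m c' (a + 1) = i"
    using i c' after' by (intro last_ge_eqI) (auto simp: less_Suc_eq_le)
  have flag_small: "last_ge m c' b = last_ge m c b" "i + 1 \<le> last_ge m c b" if "b \<in> c' ` {1..m}" "b \<le> a" for b
  proof -
    from that(1) obtain j' where "b = c' j'" "j' \<in> {1..m}" by (rule imageE)
    then have j': "1 \<le> j'" "j' \<le> m" "c' j' = b" by auto
    have "j' \<noteq> i" using j'(3) c'(1) that(2) by auto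
    have "\<exists>j. 1 \<le> j \<and> j \<le> m \<and> c j = b \<and> j \<noteq> i + 1"
    proof (cases "j' = i + 1")
      case True
      then show ?thesis using i j' c'(2) by (intro exI[of _ i]) auto
    next
      case False
      then show ?thesis using j' c'(3)[of j'] \<open>j' \<noteq> i\<close> by (intro exI[of _ j']) auto
    qed
    then obtain j where j: "1 \<le> j" "j \<le> m" "c j = b" "j \<noteq> i + 1" by blast
    show "i + 1 \<le> last_ge m c b" using i that(2) by (intro last_ge_ge) (auto simp: a_def)
    show "last_ge m c' b = last_ge m c b"
    proof (cases "b \<le> c i")
      case True
      then show ?thesis using i asc by (intro last_ge_eq_above[of "i+1"]) (auto simp: c'_def a_def)
    next
      case False
      \<comment> \<open>By \<open>gap\<close> no entry before \<open>i\<close> lies in the interval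
        from \<open>c i + 1\<close> to \<open>a\<close>, so the value \<open>b\<close> occurs to the
        right of the two exchanged positions.\<close>
      then have "i + 2 \<le> j" using gap[of j] j that(2) by (cases j i rule: linorder_cases) (auto simp: a_def)
      then show ?thesis using j by (intro last_ge_eq_above[of j]) (auto simp: c'_def)
    qed
  qed
  \<comment> \<open>With respect to \<open>c'\<close> every row of length \<open>a + 1\<close> has
    flag \<open>i\<close>. The lowest of them, row \<open>k + 1\<close>, keeps it, and the ones
    above get \<open>i - 1\<close>, which strict columns enforce anyway. Now \<open>i\<close> occurs
    once.\<close>
  define \<phi> where "\<phi> r = (if r = k + 1 then i else if r \<le> k \<and> lam ! (r - 1) = a + 1 then i - 1 else last_ge m c' (lam ! (r - 1)))" for r
  have val: "lam ! s \<in> c ` {1..m}" if "s < m" for s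
    using that lam nth_mem[of s lam] by simp
  have val': "lam ! s \<in> c' ` {1..m}" if "s < m" "s \<noteq> k" for s
    using that nth_mem[of s lam'] lam(2) lam'_nth[of s] set_sorted_parts[of m c'] unfolding lam'
    by (simp add: lam'_def)
  have \<phi>_before: "\<phi> (s + 1) = last_ge m c (lam ! s)" "\<phi> (s + 1) \<le> i - 1" if sk: "s < k" for s
  proof -
    have "s < m" using sk k by simp
    from val[OF this] have v: "lam ! s \<in> c ` {1..m}" .
    consider "lam ! s = a + 1" | "a + 1 < lam ! s" using before_k[OF sk] by linarith
    then have "\<phi> (s + 1) = last_ge m c (lam ! s) \<and> \<phi> (s + 1) \<le> i - 1"
    proof cases
      case 1
      then have "\<phi> (s + 1) = i - 1" using sk by (simp add: \<phi>_def)
      moreover have "last_ge m c (lam ! s) = i - 1" using v unfolding 1 by (rule flag_next)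
      ultimately show ?thesis by simp
    next
      case 2
      then have "\<phi> (s + 1) = last_ge m c' (lam ! s)" using sk by (simp add: \<phi>_def)
      then show ?thesis using flag_big[OF v 2] by simp
    qed
    then show "\<phi> (s + 1) = last_ge m c (lam ! s)" "\<phi> (s + 1) \<le> i - 1" by auto
  qed
  have \<phi>_k: "\<phi> (k + 1) = i" by (simp add: \<phi>_def)
  have \<phi>_after: "\<phi> (s + 1) = last_ge m c (lam ! s)" "i + 1 \<le> \<phi> (s + 1)" if sk: "k < s" "s < m" for s
  proof -
    have "lam ! s \<in> c' ` {1..m}" "lam ! s \<le> a" using val'[of s] after_k[of s] sk by auto
    moreover have "\<phi> (s + 1) = last_ge m c' (lam ! s)" using sk by (simp add: \<phi>_def)
    ultimately show "\<phi> (s + 1) = last_ge m c (lam ! s)" "i + 1 \<le> \<phi> (s + 1)"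
      using flag_small[of "lam ! s"] by auto
  qed
  have anti: "last_ge m c (lam ! s) \<le> last_ge m c (lam ! (s + 1))" if "s + 1 < m" for s
    using that val[of s] sorted_desc_nth_mono[OF lam(1), of s "s+1"] lam(2) by (intro last_ge_antimono) auto
  \<comment> \<open>Needed for the flags before and after the divided difference, that is for
    \<open>e = i\<close> and \<open>e = i + 1\<close>.\<close>
  have mono: "(\<phi>(k + 1 := e)) r \<le> (\<phi>(k + 1 := e)) (r + 1)" if e: "i \<le> e" "e \<le> i + 1" and r: "1 \<le> r" "r < m" for e r
  proof -
    obtain s where s: "r = s + 1" "s + 1 < m" using r by (metis le_add_diff_inverse2)
    consider "s + 1 < k" | "s + 1 = k" | "s = k" | "k < s" by linarith
    then show ?thesis
    proof cases
      case 1
      then show ?thesis using s \<phi>_before(1)[of s] \<phi>_before(1)[of "s+1"] anti[of s] by auto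
    next
      case 2
      then show ?thesis using s \<phi>_before(2)[of s] e by auto
    next
      case 3
      then show ?thesis using s \<phi>_after(2)[of "s+1"] e by auto
    next
      case 4
      then show ?thesis using s \<phi>_after(1)[of s] \<phi>_after(1)[of "s+1"] anti[of s] by auto
    qed
  qed
  let ?E' = "\<lambda>r. last_ge m c' (lam' ! (r - 1))" and ?E = "\<lambda>r. last_ge m c (lam ! (r - 1))"
  have E': "?E' (s + 1) = (if s = k then i else if s < k \<and> lam ! s = a + 1 then i else \<phi> (s + 1))" if "s < m" for s
    using that k flag_next' by (auto simp: lam'_nth \<phi>_def)
  have "flagged_tab lam' ?E' = flagged_tab lam' \<phi>"
  proof (rule equalityI; rule flagged_tab_subset[OF lam'_sorted])
    fix r assume "1 \<le> r" "r \<le> length lam'"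
    then obtain s where s: "r = s + 1" "s < m" using lam(2) by (metis lam'_def le_add_diff_inverse2 length_list_update less_eq_Suc_le Suc_eq_plus1)
    show "\<exists>r'\<ge>r. r' \<le> length lam' \<and> lam' ! (r' - 1) = lam' ! (r - 1) \<and> ?E' r' \<le> \<phi> r + (r' - r)"
    proof (cases "s < k \<and> lam ! s = a + 1")
      case True
      then have "?E' (k + 1) \<le> \<phi> r + (k + 1 - r)" using E'[OF k(1)] i s by (auto simp: \<phi>_def)
      then show ?thesis
        using s True k lam(2) by (intro exI[of _ "k + 1"]) (simp add: lam'_nth, simp add: lam'_def)
    next
      case False
      then show ?thesis using E'[OF s(2)] s \<phi>_k lam(2) by (intro exI[of _ r]) (auto simp: lam'_def)
    qed
    have "\<phi> r \<le> ?E' r" using E'[OF s(2)] s \<phi>_k \<phi>_before(2)[of s] by auto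
    then show "\<exists>r'\<ge>r. r' \<le> length lam' \<and> lam' ! (r' - 1) = lam' ! (r - 1) \<and> \<phi> r' \<le> ?E' r + (r' - r)"
      using \<open>r \<le> length lam'\<close> by (intro exI[of _ r]) auto
  qed
  then have 1: "vex_poly m c' = tab_poly lam' \<phi>"
    by (simp add: vex_poly_def lam' tab_poly_def)
  have restore: "lam'[k := lam' ! k - 1] = lam" using k lam(2) list_update_id[of lam k] by (simp add: lam'_def)
  have 2: "divided_diff i (tab_poly lam' \<phi>) = tab_poly lam (\<phi>(k + 1 := i + 1))"
    unfolding restore[symmetric]
  proof (rule divided_diff_tab_poly)
    show "\<phi> j \<le> \<phi> (j + 1)" if "1 \<le> j" "j < length lam'" for j
      using mono[of i j] that lam(2) \<phi>_k by (auto simp: lam'_def split: if_splits)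
    show "(\<phi>(k + 1 := i + 1)) j \<le> (\<phi>(k + 1 := i + 1)) (j + 1)" if "1 \<le> j" "j < length lam'" for j
      using mono[of "i + 1" j] that lam(2) by (simp add: lam'_def)
    show "\<phi> (s + 1) \<noteq> i" if "s < length lam'" "s \<noteq> k" for s
      using \<phi>_before(2)[of s] \<phi>_after(2)[of s] that lam(2) i by (cases "s < k") (auto simp: lam'_def)
  qed (use i k lam lam'_sorted restore \<phi>_k in \<open>auto simp: lam'_def\<close>)
  have "flagged_tab lam (\<phi>(k + 1 := i + 1)) = flagged_tab lam ?E"
  proof (rule equalityI; rule flagged_tab_subset[OF lam(1)])
    fix r assume "1 \<le> r" "r \<le> length lam"
    then obtain s where s: "r = s + 1" "s < m" using lam(2) by (metis le_add_diff_inverse2 less_eq_Suc_le Suc_eq_plus1)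
    have same: "(\<phi>(k + 1 := i + 1)) r = ?E r" if "s \<noteq> k"
      using that s \<phi>_before(1)[of s] \<phi>_after(1)[of s] by (cases "s < k") auto
    have Ek: "i + 1 \<le> last_ge m c a" using i by (intro last_ge_ge) (auto simp: a_def)
    then have "(\<phi>(k + 1 := i + 1)) r \<le> ?E r" using same s k by (cases "s = k") auto
    then show "\<exists>r'\<ge>r. r' \<le> length lam \<and> lam ! (r' - 1) = lam ! (r - 1) \<and> (\<phi>(k + 1 := i + 1)) r' \<le> ?E r + (r' - r)"
      using \<open>r \<le> length lam\<close> by (intro exI[of _ r]) auto
    show "\<exists>r'\<ge>r. r' \<le> length lam \<and> lam ! (r' - 1) = lam ! (r - 1) \<and> ?E r' \<le> (\<phi>(k + 1 := i + 1)) r + (r' - r)"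
    proof (cases "s = k")
      case False
      then show ?thesis using same \<open>r \<le> length lam\<close> by (intro exI[of _ r]) auto
    next
      case True
      \<comment> \<open>The divided difference leaves the flag \<open>i + 1\<close> on row
        \<open>k + 1\<close>, whereas \<open>c\<close> prescribes \<open>i + 1 + t\<close>. The code
        equals \<open>a\<close> at all positions from \<open>i + 1\<close> to
        \<open>i + 1 + t\<close>, so at least \<open>t + 1\<close> rows have length
        \<open>a\<close>. The row \<open>t\<close> below row \<open>k + 1\<close> is one of them,
        and its flag \<open>i + 1 + t\<close> forces the sharper bound upwards.\<close>
      define t where "t = last_ge m c a - (i + 1)"
      have a_val: "a \<in> c ` {1..m}" using val[OF k(1)] k(2) by simp
      have "{i+1..last_ge m c a} \<subseteq> {j \<in> {1..m}. c j = a}"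
      proof
        fix j assume j: "j \<in> {i+1..last_ge m c a}"
        then show "j \<in> {j \<in> {1..m}. c j = a}"
          using after[of j] decr'[of j "last_ge m c a"] last_ge_in[OF a_val] by auto
      qed
      then have "card {i+1..last_ge m c a} \<le> card {j \<in> {1..m}. c j = a}" by (intro card_mono) auto
      then have many: "t < card {s. s < m \<and> lam ! s = a}"
        unfolding lam_def card_sorted_parts_eq using Ek by (simp add: t_def)
      have "k + t < m \<and> lam ! (k + t) = a"
      proof (rule ccontr)
        assume not: "\<not> (k + t < m \<and> lam ! (k + t) = a)"
        have "{s. s < m \<and> lam ! s = a} \<subseteq> {k..<k+t}"
        proof
          fix s assume s: "s \<in> {s. s < m \<and> lam ! s = a}"
          then have "k \<le> s" using before_k[of s] by (cases "k \<le> s") auto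
          moreover have "s < k + t"
          proof (rule ccontr)
            assume "\<not> s < k + t"
            then have "a \<le> lam ! (k + t)" "k + t < m"
              using s sorted_desc_nth_mono[OF lam(1), of "k + t" s] lam(2) by auto
            then show False using not after_k[of "k + t"] by auto
          qed
          ultimately show "s \<in> {k..<k+t}" by simp
        qed
        from card_mono[OF _ this] many show False by simp
      qed
      then show ?thesis
        using True s k lam(2) Ek by (intro exI[of _ "r + t"]) (auto simp: t_def)
    qed
  qed
  then have "tab_poly lam (\<phi>(k + 1 := i + 1)) = vex_poly m c"
    by (simp add: vex_poly_def tab_poly_def flip: lam_def)
  with 1 2 show ?thesis by (simp add: c'_def a_def)
qed

section \<open>Codes, ascents and the pattern 2143\<close>

locale interval_permutation =
  fixes w :: "nat \<Rightarrow> nat" and m :: nat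
  assumes w: "w permutes {1..m}"
begin

lemma perm_inject: "w i = w j \<longleftrightarrow> i = j"
  using permutes_inj[OF w] by (auto dest: injD)

lemma perm_less_imp_le:
  assumes "w j < w i" "i < j"
  shows "j \<le> m"
proof (rule ccontr)
  assume "\<not> j \<le> m"
  then have "w j = j" using w by (auto simp: permutes_def)
  then have "j < w i" using assms by simp
  then have "w i \<noteq> i" using assms by simp
  then have "i \<in> {1..m}" using w by (auto simp: permutes_def)
  then have "w i \<le> m" using permutes_in_image[OF w, of i] by simp
  then show False using \<open>j < w i\<close> \<open>\<not> j \<le> m\<close> by simp
qed

lemma finite_inversions: "finite {j. i < j \<and> w j < w i}"
  by (rule finite_subset[of _ "{..m}"]) (auto intro: perm_less_imp_le)

text \<open>Codes are compared through inclusion of the sets of inversions; the variant after it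
  gains 1 from an extra inversion \<open>x\<close>.\<close>

lemma code_mono_set:
  assumes "\<And>j. i < j \<Longrightarrow> w j < w i \<Longrightarrow> k < j \<and> w j < w k"
  shows "code w i \<le> code w k"
  unfolding code_def using assms by (intro card_mono finite_inversions) auto

lemma code_mono_set_insert:
  assumes "\<And>j. i < j \<Longrightarrow> w j < w i \<Longrightarrow> k < j \<and> w j < w k" and "k < x" "w x < w k" "\<not> (i < x \<and> w x < w i)"
  shows "code w i + 1 \<le> code w k"
proof -
  have "code w i + 1 = card (insert x {j. i < j \<and> w j < w i})"
    using assms(4) finite_inversions[of i] by (simp add: code_def)
  also have "\<dots> \<le> code w k"
    unfolding code_def using assms by (intro card_mono finite_inversions) auto
  finally show ?thesis .
qed

lemma code_le_ascent: "w i < w (i+1) \<Longrightarrow> code w i \<le> code w (i+1)"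
proof (rule code_mono_set)
  show "i + 1 < j \<and> w j < w (i+1)" if "w i < w (i+1)" "i < j" "w j < w i" for j
    using that by (cases "j = i + 1") auto
qed

lemma code_less_descent: "w (i+1) < w i \<Longrightarrow> code w (i+1) + 1 \<le> code w i"
  by (rule code_mono_set_insert[of _ _ "i+1"]) auto

lemma ascent_of_code_le:
  assumes "code w i \<le> code w (i+1)"
  shows "w i < w (i+1)"
  using code_less_descent[of i] perm_inject[of i "i+1"] assms by (cases "w i" "w (i+1)" rule: linorder_cases) auto

lemma code_transpose:
  assumes asc: "w i < w (i+1)"
  shows "code (w \<circ> transpose i (i+1)) = (code w)(i := code w (i+1) + 1, i+1 := code w i)"
proof
  fix k
  let ?s = "transpose i (i+1)"
  consider "k = i" | "k = i + 1" | "k < i" | "i + 1 < k" by linarith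
  then show "code (w \<circ> ?s) k = ((code w)(i := code w (i+1) + 1, i+1 := code w i)) k"
  proof cases
    case 1
    have "{j. i < j \<and> (w \<circ> ?s) j < (w \<circ> ?s) i} = insert (i+1) {j. i + 1 < j \<and> w j < w (i+1)}"
      using asc by (auto simp: transpose_def)
    then show ?thesis using 1 finite_inversions[of "i+1"] by (simp add: code_def)
  next
    case 2
    have "{j. i + 1 < j \<and> (w \<circ> ?s) j < (w \<circ> ?s) (i+1)} = {j. i < j \<and> w j < w i}"
      using asc by (auto simp: transpose_def Suc_lessI)
    then show ?thesis using 2 by (simp add: code_def)
  next
    case 3
    have "bij_betw ?s {j. k < j \<and> w j < w k} {j. k < j \<and> (w \<circ> ?s) j < (w \<circ> ?s) k}"
      by (rule bij_betw_byWitness[where f' = ?s]) (use 3 in \<open>auto simp: transpose_def\<close>)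
    then show ?thesis using 3 bij_betw_same_card by (fastforce simp: code_def)
  next
    case 4
    have "{j. k < j \<and> (w \<circ> ?s) j < (w \<circ> ?s) k} = {j. k < j \<and> w j < w k}"
      using 4 by (auto simp: transpose_def)
    then show ?thesis using 4 by (simp add: code_def)
  qed
qed

text \<open>The pattern can be tightened: the entry after \<open>x\<close> is either below
  \<open>w z\<close> and replaces \<open>x\<close>, or above it and replaces \<open>y\<close>. Once
  \<open>x\<close> and \<open>y\<close> are adjacent, all inversions of \<open>x\<close> are
  inversions of \<open>x + 1\<close>, and \<open>z\<close> is a further one, so the code increases
  there.\<close>

lemma no_132_if_code_decreasing:
  assumes decr: "\<And>j. l \<le> j \<Longrightarrow> j < m \<Longrightarrow> code w (j+1) \<le> code w j"
    and "l \<le> x" "x < y" "y < z" "w x < w z" "w z < w y"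
  shows False
  using assms(2-)
proof (induction "y - x" arbitrary: x y rule: less_induct)
  case less
  have "z \<le> m" using less.prems by (intro perm_less_imp_le)
  show False
  proof (cases "y = x + 1")
    case True
    have "code w x + 1 \<le> code w (x+1)"
    proof (rule code_mono_set_insert)
      show "x + 1 < j \<and> w j < w (x+1)" if "x < j" "w j < w x" for j
        using that less.prems True by (cases "j = x + 1") auto
    qed (use less.prems True in auto)
    then show False using decr[of x] less.prems \<open>z \<le> m\<close> True by simp
  next
    case False
    show False
    proof (cases "w (x + 1) < w z")
      case True
      moreover have "y - (x + 1) < y - x" using less.prems by linarith
      ultimately show False using less.hyps[of y "x + 1"] less.prems False by simp
    next
      assume "\<not> w (x + 1) < w z"
      then have "w z < w (x + 1)" using perm_inject[of z "x+1"] less.prems False by simp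
      moreover have "x + 1 - x < y - x" using less.prems False by linarith
      ultimately show False using less.hyps[of "x + 1" x] less.prems by simp
    qed
  qed
qed

text \<open>The bound \<open>d \<le> m\<close> of the definition comes for free, because
  \<open>c\<close> and \<open>d\<close> form an inversion.\<close>

lemma vexillaryD:
  assumes "vexillary m w" "1 \<le> a" "a < b" "b < c" "c < d" "w b < w a" "w a < w d" "w d < w c"
  shows False
  using perm_less_imp_le[OF assms(8,5)] assms unfolding vexillary_def by blast

text \<open>The last three letters of 2143 form a pattern 132.\<close>

lemma vexillary_if_code_decreasing:
  assumes "\<And>j. 1 \<le> j \<Longrightarrow> j < m \<Longrightarrow> code w (j+1) \<le> code w j"
  shows "vexillary m w"
  unfolding vexillary_def
proof
  assume "\<exists>a b c d. 1 \<le> a \<and> a < b \<and> b < c \<and> c < d \<and> d \<le> m \<and> w b < w a \<and> w a < w d \<and> w d < w c"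
  then obtain a b c d where "1 \<le> a" "a < b" "b < c" "c < d" "w b < w a" "w a < w d" "w d < w c" by blast
  then show False using no_132_if_code_decreasing[OF assms, of 1 b c d] by simp
qed

text \<open>A 2143 of \<open>w s_i\<close> is one of \<open>w\<close>, at exchanged positions,
  unless two consecutive letters sit at \<open>i\<close> and \<open>i + 1\<close>. As letters 2 and
  1 they give a 132 of \<open>w\<close> from \<open>i + 1\<close> on, against the decreasing code.
  As letters 1 and 4 they contradict the ascent. As letters 4 and 3 they can be replaced by the
  positions \<open>i + 1\<close> and \<open>z\<close>, giving a 2143 of \<open>w\<close>.\<close>

lemma vexillary_transpose_last_ascent:
  assumes vex: "vexillary m w" and i: "1 \<le> i" "i < m" "w i < w (i+1)"
    and decr: "\<And>j. i + 1 \<le> j \<Longrightarrow> j < m \<Longrightarrow> code w (j+1) \<le> code w j"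
    and z: "i + 1 < z" "w i < w z" "w z < w (i+1)"
  shows "vexillary m (w \<circ> transpose i (i+1))"
  unfolding vexillary_def
proof
  let ?s = "transpose i (i+1)"
  let ?v = "w \<circ> ?s"
  assume "\<exists>a b c d. 1 \<le> a \<and> a < b \<and> b < c \<and> c < d \<and> d \<le> m \<and> ?v b < ?v a \<and> ?v a < ?v d \<and> ?v d < ?v c"
  then obtain a b c d where p: "1 \<le> a" "a < b" "b < c" "c < d" "d \<le> m" and v: "?v b < ?v a" "?v a < ?v d" "?v d < ?v c" by blast
  have order: "?s x < ?s y" if "x < y" "\<not> (x = i \<and> y = i + 1)" for x y
    using that by (auto simp: transpose_def)
  have "1 \<le> ?s a" using p i by (auto simp: transpose_def)
  consider "a = i" "b = i + 1" | "b = i" "c = i + 1" | "c = i" "d = i + 1"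
    | "?s a < ?s b" "?s b < ?s c" "?s c < ?s d"
    using order p by metis
  then show False
  proof cases
    case 1
    then have "w (i+1) < w d" "w d < w c" using v p by (auto simp: transpose_def split: if_splits)
    then show False using no_132_if_code_decreasing[OF decr, of "i+1" "i+1" c d] p 1 by simp
  next
    case 2
    then show False using v i by (auto simp: transpose_def split: if_splits)
  next
    case 3
    then have "w b < w a" "w a < w z" using v p z by (auto simp: transpose_def split: if_splits)
    then show False using vexillaryD[OF vex, of a b "i+1" z] p 3 z by simp
  next
    case 4
    then show False using vexillaryD[OF vex \<open>1 \<le> ?s a\<close>] v by simp
  qed
qed

text \<open>If \<open>w i < w j\<close>, every inversion of \<open>i + 1\<close> is one of
  \<open>j\<close>, as otherwise \<open>j\<close>, \<open>i\<close>, \<open>i + 1\<close>,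
  \<open>x\<close> form 2143; with the inversion at \<open>i\<close> itself this gives the jump by
  1. If \<open>w j < w i\<close>, then \<open>code w j \<le> code w i\<close>, by the 2143 at
  \<open>j\<close>, \<open>x\<close>, \<open>i + 1\<close>, \<open>z\<close>. When the jump is
  exactly 1, \<open>j\<close> has no other inversions. So \<open>i - 1\<close> is not one of them,
  \<open>w (i - 1)\<close> is at least \<open>w j\<close>, and it inherits them all.\<close>

lemma vexillary_code_gaps:
  assumes vex: "vexillary m w" and i: "w i < w (i+1)"
    and z: "i + 1 < z" "w i < w z" "w z < w (i+1)" and j: "1 \<le> j" "j < i"
  shows "code w i < code w j \<Longrightarrow> code w (i+1) < code w j"
    and "code w j = code w (i+1) + 1 \<Longrightarrow> code w (i+1) + 1 \<le> code w (i-1)"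
proof -
  have ji: "w i < w j" if "code w i < code w j"
  proof (rule ccontr)
    assume "\<not> w i < w j"
    then have less: "w j < w i" using perm_inject[of i j] j by simp
    have "code w j \<le> code w i"
    proof (rule code_mono_set)
      fix x assume x: "j < x" "w x < w j"
      have "i \<le> x" using vexillaryD[OF vex j(1) x(1), of "i+1" z] x less z by (cases "i \<le> x") auto
      then show "i < x \<and> w x < w i" using x less by (cases "x = i") auto
    qed
    then show False using that by simp
  qed
  have between: "w x < w j" if "w i < w j" "i + 1 < x" "w x < w (i+1)" for x
  proof (rule ccontr)
    assume "\<not> w x < w j"
    then have "w j < w x" using perm_inject[of x j] j that(2) by simp
    then show False using vexillaryD[OF vex j(1), of i "i+1" x] j that by simp
  qed
  have i_in: "code w (i+1) + 1 \<le> code w j" if "w i < w j"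
  proof (rule code_mono_set_insert)
    show "j < x \<and> w x < w j" if "i + 1 < x" "w x < w (i+1)" for x
      using between[OF \<open>w i < w j\<close> that] that j by simp
  qed (use that j in auto)
  show "code w (i+1) < code w j" if "code w i < code w j"
    using i_in[OF ji[OF that]] by simp
  show "code w (i+1) + 1 \<le> code w (i-1)" if eq: "code w j = code w (i+1) + 1"
  proof -
    have lt: "w i < w j" using ji eq code_le_ascent[OF i] by simp
    let ?I = "insert i {x. i + 1 < x \<and> w x < w (i+1)}"
    have card: "card ?I = code w (i+1) + 1"
      using finite_inversions[of "i+1"] by (simp add: code_def)
    have "?I \<subseteq> {x. j < x \<and> w x < w j}" using between[OF lt] lt j by auto
    then have I: "?I = {x. j < x \<and> w x < w j}"
      using eq card finite_inversions[of j] by (intro card_subset_eq) (auto simp: code_def)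
    show ?thesis
    proof (cases "j = i - 1")
      case True
      then show ?thesis using eq by simp
    next
      case False
      have "i - 1 \<notin> ?I" using j by auto
      then have "\<not> (j < i - 1 \<and> w (i-1) < w j)" unfolding I by simp
      then have less: "w j < w (i-1)" using perm_inject[of "i-1" j] False j by (auto simp: not_less)
      have "?I \<subseteq> {x. i - 1 < x \<and> w x < w (i-1)}"
      proof
        fix x assume x: "x \<in> ?I"
        then have "w x < w j" unfolding I by simp
        moreover have "i \<le> x" using x by auto
        ultimately show "x \<in> {x. i - 1 < x \<and> w x < w (i-1)}" using less j by simp
      qed
      then have "card ?I \<le> code w (i-1)"
        unfolding code_def by (intro card_mono finite_inversions)
      then show ?thesis using card by simp
    qed
  qed
qed

text \<open>If the code has an ascent, the last one is taken; it comes with the witness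
  \<open>z\<close> that the preceding lemmas require. Otherwise the code decreases weakly, and the
  first ascent of \<open>w\<close> keeps it so after the exchange, which implies
  vexillarity.\<close>

lemma vexillary_ascent_exists:
  assumes vex: "vexillary m w" and "w \<noteq> longest_perm m"
  obtains i where "1 \<le> i" "i < m" "w i < w (i+1)" "vexillary m (w \<circ> transpose i (i+1))"
    "\<And>j. i + 1 \<le> j \<Longrightarrow> j < m \<Longrightarrow> code w (j+1) \<le> code w j"
    "\<And>j. 1 \<le> j \<Longrightarrow> j < i \<Longrightarrow> code w i < code w j \<Longrightarrow> code w (i+1) < code w j"
    "\<And>j. 1 \<le> j \<Longrightarrow> j < i \<Longrightarrow> code w j = code w (i+1) + 1 \<Longrightarrow> code w (i+1) + 1 \<le> code w (i-1)"
proof (cases "\<exists>i. 1 \<le> i \<and> i < m \<and> code w i < code w (i+1)")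
  case True
  define I where "I = {i. 1 \<le> i \<and> i < m \<and> code w i < code w (i+1)}"
  define i where "i = Max I"
  have fin: "finite I" "I \<noteq> {}" using True by (auto simp: I_def)
  then have "i \<in> I" unfolding i_def by (rule Max_in)
  then have i: "1 \<le> i" "i < m" "code w i < code w (i+1)" by (auto simp: I_def)
  have decr: "code w (j+1) \<le> code w j" if "i + 1 \<le> j" "j < m" for j
  proof (rule ccontr)
    assume "\<not> code w (j+1) \<le> code w j"
    then have "j \<in> I" using that by (simp add: I_def)
    then have "j \<le> i" using fin by (simp add: i_def)
    then show False using that by simp
  qed
  have asc: "w i < w (i+1)" using i by (intro ascent_of_code_le) simp
  \<comment> \<open>A strict increase of the code must come from an inversion of
    \<open>i + 1\<close> that is not one of \<open>i\<close>.\<close>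
  have "\<exists>z. i + 1 < z \<and> w i < w z \<and> w z < w (i+1)"
  proof (rule ccontr)
    assume no: "\<nexists>z. i + 1 < z \<and> w i < w z \<and> w z < w (i+1)"
    have "code w (i+1) \<le> code w i"
    proof (rule code_mono_set)
      fix x assume x: "i + 1 < x" "w x < w (i+1)"
      then have "\<not> w i < w x" using no by blast
      then show "i < x \<and> w x < w i" using x perm_inject[of i x] by auto
    qed
    then show False using i by simp
  qed
  then obtain z where z: "i + 1 < z" "w i < w z" "w z < w (i+1)" by blast
  show ?thesis
    by (rule that[OF i(1,2) asc vexillary_transpose_last_ascent[OF vex i(1,2) asc decr z] decr
      vexillary_code_gaps[OF vex asc z]])
next
  case False
  then have decr: "\<And>j. 1 \<le> j \<Longrightarrow> j < m \<Longrightarrow> code w (j+1) \<le> code w j" by (meson not_le)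
  define P where "P i \<longleftrightarrow> 1 \<le> i \<and> i < m \<and> w i < w (i+1)" for i
  have "\<exists>i. P i"
    unfolding P_def using no_ascent_imp_longest[OF w] assms(2) by (meson not_le)
  then obtain i where "P i" and least: "\<And>j. j < i \<Longrightarrow> \<not> P j"
    using exists_least_iff[of P] by blast
  then have i: "1 \<le> i" "i < m" "w i < w (i+1)" by (auto simp: P_def)
  have eq: "code w (i+1) = code w i" using code_le_ascent[OF i(3)] decr[OF i(1,2)] by simp
  have prev: "code w (i+1) + 1 \<le> code w (i-1)" if "1 < i"
  proof -
    have "\<not> P (i - 1)" using least[of "i - 1"] that by simp
    then have "w i < w (i-1)" using that i perm_inject[of "i-1" i] by (simp add: P_def) linarith
    then show ?thesis using code_less_descent[of "i-1"] that eq by simp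
  qed
  interpret v: interval_permutation "w \<circ> transpose i (i+1)" m
    by unfold_locales (use w i in \<open>intro permutes_comp_transpose\<close>)
  \<comment> \<open>The exchange raises only the code at \<open>i\<close>, by 1, and
    \<open>prev\<close> leaves room for that: just before the first ascent \<open>w\<close>
    descends.\<close>
  have decr': "code (w \<circ> transpose i (i+1)) (j+1) \<le> code (w \<circ> transpose i (i+1)) j" if "1 \<le> j" "j < m" for j
    unfolding code_transpose[OF i(3)]
    using decr[OF that] decr[of i] decr[of "i+1"] prev eq that i by auto
  have "vexillary m (w \<circ> transpose i (i+1))"
    using v.vexillary_if_code_decreasing[OF decr'] by blast
  then show ?thesis using i decr eq prev by (intro that[of i]) auto
qed

end

section \<open>The base case of the induction: the staircase shape\<close>

lemma code_longest_perm:
  assumes "1 \<le> i" "i \<le> m"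
  shows "code (longest_perm m) i = m - i"
proof -
  have "{j. i < j \<and> longest_perm m j < longest_perm m i} = {i+1..m}"
    using assms by (auto simp: longest_perm_def split: if_splits)
  then show ?thesis by (simp add: code_def)
qed

text \<open>Row \<open>i\<close> of the staircase has flag \<open>i\<close>, and strict columns
  force its entries to be at least \<open>i\<close>. Hence there is a single tableau.\<close>

lemma vex_poly_longest_perm: "vex_poly m (code (longest_perm m)) = (\<Prod>i\<in>{1..<m}. var i ^ (m - i))"
proof -
  define lam where "lam = map (\<lambda>j. m - j) [1..<m+1]"
  have nth: "lam ! (i - 1) = m - i" if "1 \<le> i" "i \<le> m" for i
    using that by (auto simp: lam_def nth_append simp del: upt_Suc)
  have sorted: "sorted_wrt (\<ge>) lam"
    by (auto simp: lam_def sorted_wrt_map sorted_wrt_iff_nth_less simp del: upt_Suc)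
  have lam: "sorted_parts m (\<lambda>j. m - j) = lam"
    using sorted by (rule sorted_parts_eqI) (simp only: lam_def)
  have len: "length lam = m" by (simp add: lam_def)
  have cells: "cells lam = Sigma {1..m} (\<lambda>i. {1..m-i})"
    using nth len by (auto simp: cells_def)
  have flag: "last_ge m (\<lambda>j. m - j) (lam ! (i - 1)) = i" if "1 \<le> i" "i \<le> m" for i
    unfolding nth[OF that] using that by (intro last_ge_eqI) auto
  have "flagged_tab lam (\<lambda>r. last_ge m (\<lambda>j. m - j) (lam ! (r - 1))) = {restrict fst (cells lam)}" (is "?L = ?R")
  proof (rule set_eqI, rule iffI)
    fix T assume T: "T \<in> ?L"
    have "T (i, j) = i" if ij: "(i, j) \<in> cells lam" for i j
    proof (rule antisym)
      have i: "1 \<le> i" "i \<le> m" using ij by (auto simp: cells)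
      have "T (i, j) \<le> last_ge m (\<lambda>j. m - j) (lam ! (i - 1))" using T ij unfolding flagged_tab_def by blast
      then show "T (i, j) \<le> i" unfolding flag[OF i] .
      have "(1, j) \<in> cells lam" using cells_up[OF sorted ij, of 1] i by simp
      then have "1 \<le> T (1, j)" using T by (simp add: flagged_tab_def)
      moreover have "T (1, j) + (i - 1) \<le> T (i, j)"
        using flagged_tab_column_mono[OF T sorted ij, of 1] i by simp
      ultimately show "i \<le> T (i, j)" using i by simp
    qed
    moreover have "T \<in> extensional (cells lam)" using T by (simp add: flagged_tab_def)
    ultimately have "T = restrict fst (cells lam)"
      by - (rule extensionalityI[OF _ restrict_extensional], auto)
    then show "T \<in> ?R" by simp
  next
    fix T assume "T \<in> ?R"
    moreover have "1 \<le> i \<and> i \<le> last_ge m (\<lambda>j. m - j) (lam ! (i - 1))" if "(i, j) \<in> cells lam" for i j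
      using that flag[of i] by (simp add: cells)
    ultimately show "T \<in> ?L" by (simp add: flagged_tab_def)
  qed
  then have "vex_poly m (\<lambda>j. m - j) = (\<Prod>c\<in>cells lam. var (fst c))"
    by (simp add: vex_poly_def lam tab_poly_def)
  also have "\<dots> = (\<Prod>i\<in>{1..m}. \<Prod>j\<in>{1..m-i}. var i)"
    unfolding cells by (subst prod.Sigma) (auto simp: case_prod_unfold)
  also have "\<dots> = (\<Prod>i\<in>{1..m}. var i ^ (m - i))" by simp
  also have "\<dots> = (\<Prod>i\<in>{1..<m}. var i ^ (m - i))"
    by (rule prod.mono_neutral_right) auto
  finally show ?thesis
    using vex_poly_cong[of m "code (longest_perm m)" "\<lambda>j. m - j"] code_longest_perm by simp
qed

theorem schubert_vexillary:
  assumes "w permutes {1..m}" "vexillary m w"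
  shows "schubert m w = vex_poly m (code w)"
proof -
  have "is_schubert m w (vex_poly m (code w))"
    using assms
  proof (induction "perm_moment m w" arbitrary: w rule: less_induct)
    case less
    interpret interval_permutation w m by unfold_locales (fact less.prems(1))
    show ?case
    proof (cases "w = longest_perm m")
      case True
      then show ?thesis using is_schubert.longest[of m] by (simp add: vex_poly_longest_perm)
    next
      case False
      show ?thesis
      proof (rule vexillary_ascent_exists[OF less.prems(2) False])
        fix i
        assume i: "1 \<le> i" "i < m" "w i < w (i+1)" and v: "vexillary m (w \<circ> transpose i (i+1))"
          and c: "\<And>j. i + 1 \<le> j \<Longrightarrow> j < m \<Longrightarrow> code w (j+1) \<le> code w j"
          "\<And>j. 1 \<le> j \<Longrightarrow> j < i \<Longrightarrow> code w i < code w j \<Longrightarrow> code w (i+1) < code w j"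
          "\<And>j. 1 \<le> j \<Longrightarrow> j < i \<Longrightarrow> code w j = code w (i+1) + 1 \<Longrightarrow> code w (i+1) + 1 \<le> code w (i-1)"
        have "is_schubert m (w \<circ> transpose i (i+1)) (vex_poly m (code (w \<circ> transpose i (i+1))))"
          using less.hyps[OF perm_moment_comp_transpose[OF i] permutes_comp_transpose[OF w i(1,2)] v] .
        then have "is_schubert m w (divided_diff i (vex_poly m (code (w \<circ> transpose i (i+1)))))"
          by (rule is_schubert_ascent[OF _ i])
        moreover have "divided_diff i (vex_poly m ((code w)(i := code w (i+1) + 1, i+1 := code w i))) = vex_poly m (code w)"
          by (rule divided_diff_vex_poly[OF i(1,2) code_le_ascent[OF i(3)]]) (rule c; assumption)+
        ultimately show ?thesis unfolding code_transpose[OF i(3)] by simp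
      qed
    qed
  qed
  then show ?thesis by (rule schubert_eqI)
qed

section \<open>Reverse plane partitions with prescribed strictness\<close>

definition descent_seqs :: "(nat \<Rightarrow> bool) \<Rightarrow> nat \<Rightarrow> nat \<Rightarrow> (nat \<Rightarrow> nat) set" where
  "descent_seqs D n m = {s \<in> extensional {1..n}. (\<forall>k. 1 \<le> k \<and> k \<le> n \<longrightarrow> s k \<le> m) \<and>
     (\<forall>k. 1 \<le> k \<and> k < n \<longrightarrow> s k \<le> s (k+1) \<and> (D k \<longrightarrow> s k < s (k+1)))}"

lemma finite_descent_seqs [simp]: "finite (descent_seqs D n m)"
proof (rule finite_subset)
  show "descent_seqs D n m \<subseteq> PiE {1..n} (\<lambda>_. {..m})" by (auto simp: descent_seqs_def PiE_def)
qed (auto intro: finite_PiE)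

lemma card_descent_seqs_0: "card (descent_seqs D 0 m) = 1"
proof -
  have "descent_seqs D 0 m = {\<lambda>_. undefined}" by (auto simp: descent_seqs_def)
  then show ?thesis by simp
qed

lemma descent_seqs_le:
  assumes "s \<in> descent_seqs D n m" "1 \<le> k" "k \<le> k'" "k' \<le> n"
  shows "s k \<le> s k'"
  using assms(3,4)
proof (induction k' rule: dec_induct)
  case (step l)
  have "s l \<le> s (Suc l)" using assms(1,2) step unfolding descent_seqs_def by auto
  then show ?case using step by simp
qed simp

text \<open>Deleting a last entry \<open>m\<close> leaves \<open>n\<close> entries bounded by
  \<open>m\<close>, or by \<open>m - 1\<close> if the last step is strict.\<close>

lemma card_descent_seqs_max:
  "card {s \<in> descent_seqs D (Suc n) m. s (Suc n) = m}
     = (if n \<ge> 1 \<and> D n then (if m = 0 then 0 else card (descent_seqs D n (m - 1))) else card (descent_seqs D n m))"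
proof -
  define strict where "strict \<longleftrightarrow> n \<ge> 1 \<and> D n"
  have mem: "s \<in> descent_seqs D n m' \<longleftrightarrow> s(Suc n := m) \<in> descent_seqs D (Suc n) m"
    if "s \<in> extensional {1..n}" and m': "if strict then m = Suc m' else m' = m" for s m'
  proof -
    let ?t = "s(Suc n := m)"
    have ext: "?t \<in> extensional {1..Suc n}" using that(1) by (auto simp: extensional_def)
    have last: "(\<forall>k. 1 \<le> k \<and> k < Suc n \<longrightarrow> ?t k \<le> ?t (k+1) \<and> (D k \<longrightarrow> ?t k < ?t (k+1)))
      \<longleftrightarrow> (\<forall>k. 1 \<le> k \<and> k < n \<longrightarrow> s k \<le> s (k+1) \<and> (D k \<longrightarrow> s k < s (k+1))) \<and> (n \<ge> 1 \<longrightarrow> s n \<le> m \<and> (D n \<longrightarrow> s n < m))"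
    proof -
      have "(\<forall>k. 1 \<le> k \<and> k < Suc n \<longrightarrow> P k) \<longleftrightarrow> (\<forall>k. 1 \<le> k \<and> k < n \<longrightarrow> P k) \<and> (n \<ge> 1 \<longrightarrow> P n)" for P
        unfolding less_Suc_eq by blast
      then show ?thesis by simp
    qed
    have bound: "(\<forall>k. 1 \<le> k \<and> k \<le> Suc n \<longrightarrow> ?t k \<le> m) \<longleftrightarrow> (\<forall>k. 1 \<le> k \<and> k \<le> n \<longrightarrow> s k \<le> m)"
    proof -
      have "(\<forall>k. 1 \<le> k \<and> k \<le> Suc n \<longrightarrow> P k) \<longleftrightarrow> (\<forall>k. 1 \<le> k \<and> k \<le> n \<longrightarrow> P k) \<and> P (Suc n)" for P
        unfolding le_Suc_eq by auto
      then show ?thesis by simp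
    qed
    have le: "s k \<le> m'" if s: "\<forall>k. 1 \<le> k \<and> k < n \<longrightarrow> s k \<le> s (k+1) \<and> (D k \<longrightarrow> s k < s (k+1))"
      "n \<ge> 1 \<longrightarrow> s n \<le> m \<and> (D n \<longrightarrow> s n < m)" "1 \<le> k" "k \<le> n" for k
    proof -
      have "s k \<le> s n" using s(4)
      proof (induction rule: inc_induct)
        case (step l)
        then show ?case using s(1,3) le_trans[of "s l" "s (Suc l)" "s n"] by simp
      qed simp
      also have "s n \<le> m'" using s m' by (auto simp: strict_def split: if_splits)
      finally show ?thesis .
    qed
    have m: "m' \<le> m" using m' by (auto split: if_splits)
    show ?thesis
    proof
      assume s: "s \<in> descent_seqs D n m'"
      then have "n \<ge> 1 \<longrightarrow> s n \<le> m'" by (simp add: descent_seqs_def)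
      then have "n \<ge> 1 \<longrightarrow> s n \<le> m \<and> (D n \<longrightarrow> s n < m)"
        using m' by (auto simp: strict_def split: if_splits)
      then show "?t \<in> descent_seqs D (Suc n) m"
        unfolding descent_seqs_def mem_Collect_eq bound last
        using s ext m by (auto simp: descent_seqs_def intro: le_trans)
    next
      assume "?t \<in> descent_seqs D (Suc n) m"
      then show "s \<in> descent_seqs D n m'"
        unfolding descent_seqs_def mem_Collect_eq bound last using le that(1) by blast
    qed
  qed
  have reindex: "card {s \<in> descent_seqs D (Suc n) m. s (Suc n) = m} = card (descent_seqs D n m')"
    if m': "if strict then m = Suc m' else m' = m" for m'
  proof (rule bij_betw_same_card, rule bij_betw_byWitness[where f = "\<lambda>s. restrict s {1..n}" and f' = "\<lambda>s. s(Suc n := m)"])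
    have upd: "(restrict s {1..n})(Suc n := m) = s" if "s \<in> descent_seqs D (Suc n) m" "s (Suc n) = m" for s
      using that by (auto simp: descent_seqs_def extensional_def fun_eq_iff)
    then show "\<forall>s\<in>{s \<in> descent_seqs D (Suc n) m. s (Suc n) = m}. (restrict s {1..n})(Suc n := m) = s" by blast
    show "(\<lambda>s. restrict s {1..n}) ` {s \<in> descent_seqs D (Suc n) m. s (Suc n) = m} \<subseteq> descent_seqs D n m'"
    proof (intro image_subsetI)
      fix s assume "s \<in> {s \<in> descent_seqs D (Suc n) m. s (Suc n) = m}"
      then have s: "s \<in> descent_seqs D (Suc n) m" "(restrict s {1..n})(Suc n := m) = s" using upd by blast+
      show "restrict s {1..n} \<in> descent_seqs D n m'"
        unfolding mem[OF restrict_extensional m'] s(2) by (rule s(1))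
    qed
    show "\<forall>s\<in>descent_seqs D n m'. restrict (s(Suc n := m)) {1..n} = s"
      by (auto simp: descent_seqs_def extensional_def fun_eq_iff)
    have "s \<in> extensional {1..n}" if "s \<in> descent_seqs D n m'" for s using that by (simp add: descent_seqs_def)
    then show "(\<lambda>s. s(Suc n := m)) ` descent_seqs D n m' \<subseteq> {s \<in> descent_seqs D (Suc n) m. s (Suc n) = m}"
      using mem[OF _ m'] by auto
  qed
  show ?thesis
  proof (cases "strict \<and> m = 0")
    case True
    have "s (Suc n) \<noteq> m" if "s \<in> descent_seqs D (Suc n) m" for s
    proof -
      have "s n < s (Suc n)" using that True unfolding descent_seqs_def strict_def by auto
      then show ?thesis using True by simp
    qed
    then have empty: "{s \<in> descent_seqs D (Suc n) m. s (Suc n) = m} = {}" by blast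
    show ?thesis unfolding empty using True by (simp add: strict_def)
  next
    case False
    then show ?thesis
      using reindex[of "if strict then m - 1 else m"] by (auto simp: strict_def)
  qed
qed

text \<open>Either the last and largest entry attains the bound or the bound can be lowered. For
  generating functions in \<open>m\<close> this difference is multiplication by
  \<open>1 - fps_X\<close>.\<close>

lemma card_descent_seqs_Suc:
  "card (descent_seqs D (Suc n) m) = (if m = 0 then 0 else card (descent_seqs D (Suc n) (m - 1)))
     + card {s \<in> descent_seqs D (Suc n) m. s (Suc n) = m}"
proof -
  have "{s \<in> descent_seqs D (Suc n) m. s (Suc n) \<noteq> m} = (if m = 0 then {} else descent_seqs D (Suc n) (m - 1))"
  proof (rule set_eqI)
    fix s
    have "s k \<le> m - 1" if "s \<in> descent_seqs D (Suc n) m" "s (Suc n) \<noteq> m" "1 \<le> k" "k \<le> Suc n" for k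
    proof -
      have "s (Suc n) \<le> m" using that(1) by (simp add: descent_seqs_def)
      then show ?thesis using descent_seqs_le[OF that(1,3,4)] that(2) by simp
    qed
    moreover have "s (Suc n) = 0" if "s \<in> descent_seqs D (Suc n) 0" using that by (simp add: descent_seqs_def)
    moreover have "s (Suc n) \<le> m - 1" if "s \<in> descent_seqs D (Suc n) (m - 1)" using that by (simp add: descent_seqs_def)
    ultimately show "s \<in> {s \<in> descent_seqs D (Suc n) m. s (Suc n) \<noteq> m} \<longleftrightarrow> s \<in> (if m = 0 then {} else descent_seqs D (Suc n) (m - 1))"
      by (cases "m = 0") (auto simp: descent_seqs_def)
  qed
  moreover have "card (descent_seqs D (Suc n) m) = card {s \<in> descent_seqs D (Suc n) m. s (Suc n) \<noteq> m} + card {s \<in> descent_seqs D (Suc n) m. s (Suc n) = m}"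
    by (subst card_Un_disjoint[symmetric]) (auto intro: arg_cong[of _ _ card])
  ultimately show ?thesis by simp
qed

text \<open>Each further entry contributes a factor \<open>1 / (1 - X)\<close>, and
  \<open>X / (1 - X)\<close> after a strict step. Since the series runs over the bound
  \<open>m\<close>, the empty sequence already contributes \<open>1 / (1 - X)\<close>, whence the
  exponent \<open>Suc n\<close>.\<close>

lemma descent_seqs_gf:
  "Abs_fps (\<lambda>m. of_nat (card (descent_seqs D n m))) * (1 - fps_X) ^ Suc n
     = (fps_X :: 'a::comm_ring_1 fps) ^ card {k. 1 \<le> k \<and> k < n \<and> D k}"
proof (induction n)
  case 0
  have "Abs_fps (\<lambda>m. 1 :: 'a) * (1 - fps_X) = 1"
    by (rule fps_ext) (auto simp: algebra_simps fps_X_mult_nth)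
  then show ?case by (simp add: card_descent_seqs_0)
next
  case (Suc n)
  let ?G = "\<lambda>n. Abs_fps (\<lambda>m. of_nat (card (descent_seqs D n m))) :: 'a fps"
  have step: "?G (Suc n) * (1 - fps_X) = (if n \<ge> 1 \<and> D n then fps_X else 1) * ?G n"
  proof (rule fps_ext)
    fix m
    have "fps_nth (?G (Suc n) * (1 - fps_X)) m = of_nat (card {s \<in> descent_seqs D (Suc n) m. s (Suc n) = m})"
      using arg_cong[OF card_descent_seqs_Suc[of D n m], of of_nat]
      by (cases "m = 0") (auto simp: right_diff_distrib mult.commute[of _ fps_X])
    then show "fps_nth (?G (Suc n) * (1 - fps_X)) m = fps_nth ((if n \<ge> 1 \<and> D n then fps_X else 1) * ?G n) m"
      by (simp add: card_descent_seqs_max)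
  qed
  have desc: "card {k. 1 \<le> k \<and> k < Suc n \<and> D k} = card {k. 1 \<le> k \<and> k < n \<and> D k} + (if n \<ge> 1 \<and> D n then 1 else 0)"
  proof (cases "n \<ge> 1 \<and> D n")
    case True
    then have "{k. 1 \<le> k \<and> k < Suc n \<and> D k} = insert n {k. 1 \<le> k \<and> k < n \<and> D k}"
      by (auto simp: less_Suc_eq)
    then show ?thesis using True by simp
  next
    case False
    then have "{k. 1 \<le> k \<and> k < Suc n \<and> D k} = {k. 1 \<le> k \<and> k < n \<and> D k}"
      by (auto simp: less_Suc_eq)
    then show ?thesis unfolding if_not_P[OF False] by simp
  qed
  have "?G (Suc n) * (1 - fps_X) ^ Suc (Suc n) = (?G (Suc n) * (1 - fps_X)) * (1 - fps_X) ^ Suc n"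
    by (simp add: mult.assoc)
  also have "\<dots> = (if n \<ge> 1 \<and> D n then fps_X else 1) * (?G n * (1 - fps_X) ^ Suc n)"
    unfolding step by (simp only: mult.assoc)
  also have "\<dots> = fps_X ^ card {k. 1 \<le> k \<and> k < Suc n \<and> D k}"
    unfolding Suc.IH desc by simp
  finally show ?case .
qed

section \<open>Standardization of labeled fillings\<close>

definition labeled_partitions :: "nat list \<Rightarrow> (nat \<times> nat \<Rightarrow> nat) \<Rightarrow> nat \<Rightarrow> (nat \<times> nat \<Rightarrow> nat) set" where
  "labeled_partitions lam \<omega> m = {S \<in> extensional (cells lam). (\<forall>c\<in>cells lam. S c \<le> m) \<and>
     (\<forall>i j. (i, j) \<in> cells lam \<and> (i+1, j) \<in> cells lam \<longrightarrow>
        S (i, j) \<le> S (i+1, j) \<and> (\<omega> (i, j) > \<omega> (i+1, j) \<longrightarrow> S (i, j) < S (i+1, j))) \<and>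
     (\<forall>i j. (i, j) \<in> cells lam \<and> (i, j+1) \<in> cells lam \<longrightarrow>
        S (i, j) \<le> S (i, j+1) \<and> (\<omega> (i, j) > \<omega> (i, j+1) \<longrightarrow> S (i, j) < S (i, j+1)))}"

abbreviation tab_descent :: "nat list \<Rightarrow> (nat \<times> nat \<Rightarrow> nat) \<Rightarrow> (nat \<times> nat \<Rightarrow> nat) \<Rightarrow> nat \<Rightarrow> bool" where
  "tab_descent lam \<omega> T k \<equiv> \<omega> (inv_into (cells lam) T k) > \<omega> (inv_into (cells lam) T (k+1))"

text \<open>Ties between equal entries are broken by the labels, which makes the cells linearly
  ordered; \<open>standardization\<close> is the rank in this order.\<close>

definition refined_less :: "(nat \<times> nat \<Rightarrow> nat) \<Rightarrow> (nat \<times> nat \<Rightarrow> nat) \<Rightarrow> nat \<times> nat \<Rightarrow> nat \<times> nat \<Rightarrow> bool" where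
  "refined_less \<omega> S c c' \<longleftrightarrow> S c < S c' \<or> S c = S c' \<and> \<omega> c < \<omega> c'"

definition standardization :: "nat list \<Rightarrow> (nat \<times> nat \<Rightarrow> nat) \<Rightarrow> (nat \<times> nat \<Rightarrow> nat) \<Rightarrow> nat \<times> nat \<Rightarrow> nat" where
  "standardization lam \<omega> S = (\<lambda>c\<in>cells lam. card {c' \<in> cells lam. refined_less \<omega> S c' c} + 1)"

context
  fixes lam :: "nat list" and \<omega> :: "nat \<times> nat \<Rightarrow> nat"
  assumes \<omega>: "labeling lam \<omega>"
begin

lemma inj_labeling: "c \<in> cells lam \<Longrightarrow> c' \<in> cells lam \<Longrightarrow> \<omega> c = \<omega> c' \<longleftrightarrow> c = c'"
  using \<omega> by (auto simp: labeling_def bij_betw_def inj_on_def)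

lemma card_cells: "card (cells lam) = sum_list lam"
  using \<omega> bij_betw_same_card by (fastforce simp: labeling_def)

lemma refined_less_total:
  "c \<in> cells lam \<Longrightarrow> c' \<in> cells lam \<Longrightarrow> c \<noteq> c' \<Longrightarrow> refined_less \<omega> S c c' \<or> refined_less \<omega> S c' c"
  using inj_labeling[of c c'] by (auto simp: refined_less_def)

lemma standardization_less:
  assumes "c \<in> cells lam" "c' \<in> cells lam" "refined_less \<omega> S c c'"
  shows "standardization lam \<omega> S c < standardization lam \<omega> S c'"
proof -
  have "{d \<in> cells lam. refined_less \<omega> S d c} \<subset> {d \<in> cells lam. refined_less \<omega> S d c'}"
    using assms by (auto simp: refined_less_def)
  then have "card {d \<in> cells lam. refined_less \<omega> S d c} < card {d \<in> cells lam. refined_less \<omega> S d c'}"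
    by (intro psubset_card_mono) auto
  then show ?thesis using assms by (simp add: standardization_def)
qed

lemma standardization_less_iff:
  assumes "c \<in> cells lam" "c' \<in> cells lam"
  shows "standardization lam \<omega> S c < standardization lam \<omega> S c' \<longleftrightarrow> refined_less \<omega> S c c'"
proof (cases "c = c'")
  case True
  then show ?thesis by (simp add: refined_less_def)
next
  case False
  then show ?thesis
    using standardization_less[OF assms, of S] standardization_less[OF assms(2,1), of S] refined_less_total[OF assms False, of S]
    by (meson less_asym)
qed

lemma standardization_bij: "bij_betw (standardization lam \<omega> S) (cells lam) {1..sum_list lam}"
proof -
  have inj: "inj_on (standardization lam \<omega> S) (cells lam)"
    by (rule inj_onI) (metis standardization_less refined_less_total less_irrefl)
  moreover have "standardization lam \<omega> S ` cells lam \<subseteq> {1..sum_list lam}"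
  proof
    fix k assume "k \<in> standardization lam \<omega> S ` cells lam"
    then obtain c where c: "c \<in> cells lam" "k = standardization lam \<omega> S c" by blast
    have "{c' \<in> cells lam. refined_less \<omega> S c' c} \<subset> cells lam"
      using c(1) by (auto simp: refined_less_def)
    then have "card {c' \<in> cells lam. refined_less \<omega> S c' c} < sum_list lam"
      using psubset_card_mono[of "cells lam"] by (simp add: card_cells)
    then show "k \<in> {1..sum_list lam}" using c by (simp add: standardization_def)
  qed
  then have "standardization lam \<omega> S ` cells lam = {1..sum_list lam}"
    using inj by (intro card_subset_eq) (auto simp: card_image card_cells)
  ultimately show ?thesis by (simp add: bij_betw_def)
qed

text \<open>Strictness is prescribed exactly where the labels decrease, so adjacent cells with equal
  entries have increasing labels and are in the right refined order.\<close>

lemma standardization_SYT: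
  assumes "S \<in> labeled_partitions lam \<omega> m"
  shows "standardization lam \<omega> S \<in> SYT lam"
proof -
  have less: "refined_less \<omega> S c c'" if "c \<in> cells lam" "c' \<in> cells lam" "c \<noteq> c'" "S c \<le> S c' \<and> (\<omega> c > \<omega> c' \<longrightarrow> S c < S c')" for c c'
    using that inj_labeling[of c c'] unfolding refined_less_def by linarith
  have "refined_less \<omega> S (i, j) (i+1, j)" if "(i, j) \<in> cells lam" "(i+1, j) \<in> cells lam" for i j
    by (rule less[OF that]) (use assms that in \<open>simp_all add: labeled_partitions_def\<close>)
  moreover have "refined_less \<omega> S (i, j) (i, j+1)" if "(i, j) \<in> cells lam" "(i, j+1) \<in> cells lam" for i j
    by (rule less[OF that]) (use assms that in \<open>simp_all add: labeled_partitions_def\<close>)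
  ultimately show ?thesis
    using standardization_bij[of S] standardization_less[of _ _ S] by (auto simp: SYT_def standardization_def)
qed

text \<open>Where \<open>s\<close> is constant, \<open>T\<close> has no descents, so along such a
  stretch the labels increase strictly. Chaining neighbouring values of \<open>T\<close> gives the
  claim.\<close>

lemma descent_seqs_refined_less:
  assumes T: "T \<in> SYT lam" and s: "s \<in> descent_seqs (tab_descent lam \<omega> T) (sum_list lam) m"
    and c: "c \<in> cells lam" "c' \<in> cells lam" "T c < T c'"
  shows "refined_less \<omega> (\<lambda>c\<in>cells lam. s (T c)) c c'"
proof -
  have bij: "bij_betw T (cells lam) {1..sum_list lam}" using T by (simp add: SYT_def)
  have inv: "inv_into (cells lam) T (T d) = d" if "d \<in> cells lam" for d
    using bij that by (simp add: bij_betw_def)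
  have "s k \<le> s l \<and> (s k = s l \<longrightarrow> \<omega> (inv_into (cells lam) T k) < \<omega> (inv_into (cells lam) T l))"
    if kl: "1 \<le> k" "Suc k \<le> l" "l \<le> sum_list lam" for k l
  proof -
    have one: "s k \<le> s (k+1) \<and> (s k = s (k+1) \<longrightarrow> \<omega> (inv_into (cells lam) T k) < \<omega> (inv_into (cells lam) T (k+1)))"
      if k: "1 \<le> k" "k < sum_list lam" for k
    proof -
      have "inv_into (cells lam) T k \<in> cells lam" "inv_into (cells lam) T (k+1) \<in> cells lam"
        using bij k by (auto intro!: inv_into_into simp: bij_betw_def)
      moreover have "inv_into (cells lam) T k \<noteq> inv_into (cells lam) T (k+1)"
        using bij k inv_into_injective[of "cells lam" T k "k+1"] by (auto simp: bij_betw_def)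
      ultimately have "\<omega> (inv_into (cells lam) T k) \<noteq> \<omega> (inv_into (cells lam) T (k+1))"
        using inj_labeling by blast
      moreover have "s k \<le> s (k+1) \<and> (tab_descent lam \<omega> T k \<longrightarrow> s k < s (k+1))"
        using s k unfolding descent_seqs_def by blast
      ultimately show ?thesis by auto
    qed
    show ?thesis
      using kl(2,3)
    proof (induction l rule: dec_induct)
      case base
      then show ?case using one[of k] kl by simp
    next
      case (step l)
      then show ?case using one[of l] kl(1) by fastforce
    qed
  qed
  from this[of "T c" "T c'"] show ?thesis
    using c bij_betwE[OF bij] by (auto simp: refined_less_def inv)
qed

lemma standardization_descent_seq:
  assumes T: "T \<in> SYT lam" and s: "s \<in> descent_seqs (tab_descent lam \<omega> T) (sum_list lam) m"
  shows "standardization lam \<omega> (\<lambda>c\<in>cells lam. s (T c)) = T"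
proof (rule extensionalityI)
  let ?S = "\<lambda>c\<in>cells lam. s (T c)"
  have bij: "bij_betw T (cells lam) {1..sum_list lam}" using T by (simp add: SYT_def)
  show "standardization lam \<omega> ?S \<in> extensional (cells lam)" by (simp add: standardization_def)
  show "T \<in> extensional (cells lam)" using T by (simp add: SYT_def)
  fix c assume c: "c \<in> cells lam"
  have iff: "refined_less \<omega> ?S c' c \<longleftrightarrow> T c' < T c" if "c' \<in> cells lam" for c'
  proof (cases "T c' = T c")
    case True
    then have "c' = c" using bij that c by (auto simp: bij_betw_def inj_on_def)
    then show ?thesis by (simp add: refined_less_def)
  next
    case False
    then show ?thesis
      using descent_seqs_refined_less[OF T s that c] descent_seqs_refined_less[OF T s c that]
      by (auto simp: refined_less_def linorder_neq_iff)
  qed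
  have Tc: "T c \<in> {1..sum_list lam}" using bij c by (auto simp: bij_betw_def)
  have eq: "{c' \<in> cells lam. refined_less \<omega> ?S c' c} = {c' \<in> cells lam. T c' < T c}" using iff by blast
  have "card {c' \<in> cells lam. T c' < T c} = card (T ` {c' \<in> cells lam. T c' < T c})"
    using bij by (intro card_image[symmetric]) (auto simp: bij_betw_def inj_on_def)
  also have "T ` {c' \<in> cells lam. T c' < T c} = {k \<in> {1..sum_list lam}. k < T c}"
    using bij by (auto simp: bij_betw_def image_iff)
  also have "\<dots> = {1..<T c}" using Tc by auto
  finally show "standardization lam \<omega> ?S c = T c" unfolding standardization_def eq[symmetric] using c Tc by simp
qed

text \<open>The fundamental lemma on P-partitions for the poset of cells, whose linear extensions
  are the standard tableaux: reading a filling along its standardization gives a sequence that is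
  strict at the descents, and the tableau can be recovered from the filling.\<close>

lemma labeled_partitions_bij:
  "bij_betw (\<lambda>(T, s). \<lambda>c\<in>cells lam. s (T c))
     (SIGMA T:SYT lam. descent_seqs (tab_descent lam \<omega> T) (sum_list lam) m) (labeled_partitions lam \<omega> m)"
proof (rule bij_betw_byWitness[where f' = "\<lambda>S. (standardization lam \<omega> S,
    \<lambda>k\<in>{1..sum_list lam}. S (inv_into (cells lam) (standardization lam \<omega> S) k))"])
  let ?n = "sum_list lam" and ?st = "standardization lam \<omega>"
  let ?X = "SIGMA T:SYT lam. descent_seqs (tab_descent lam \<omega> T) ?n m"
  have inv: "inv_into (cells lam) T k \<in> cells lam" "T (inv_into (cells lam) T k) = k"
    if "bij_betw T (cells lam) {1..?n}" "1 \<le> k" "k \<le> ?n" for T k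
    using that by (auto simp: bij_betw_def intro: inv_into_into f_inv_into_f)
  show "\<forall>x\<in>?X. (?st (case x of (T, s) \<Rightarrow> \<lambda>c\<in>cells lam. s (T c)),
      \<lambda>k\<in>{1..?n}. (case x of (T, s) \<Rightarrow> \<lambda>c\<in>cells lam. s (T c)) (inv_into (cells lam) (?st (case x of (T, s) \<Rightarrow> \<lambda>c\<in>cells lam. s (T c))) k)) = x"
  proof (intro ballI, elim SigmaE)
    fix x T s assume x: "x = (T, s)" and T: "T \<in> SYT lam" and s: "s \<in> descent_seqs (tab_descent lam \<omega> T) ?n m"
    have bij: "bij_betw T (cells lam) {1..?n}" using T by (simp add: SYT_def)
    have "(\<lambda>k\<in>{1..?n}. (\<lambda>c\<in>cells lam. s (T c)) (inv_into (cells lam) T k)) = s"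
      by (rule extensionalityI[of _ "{1..?n}"]) (use s inv[OF bij] in \<open>auto simp: descent_seqs_def\<close>)
    then show "(?st (case x of (T, s) \<Rightarrow> \<lambda>c\<in>cells lam. s (T c)),
      \<lambda>k\<in>{1..?n}. (case x of (T, s) \<Rightarrow> \<lambda>c\<in>cells lam. s (T c)) (inv_into (cells lam) (?st (case x of (T, s) \<Rightarrow> \<lambda>c\<in>cells lam. s (T c))) k)) = x"
      unfolding x prod.case standardization_descent_seq[OF T s] by simp
  qed
  show "\<forall>S\<in>labeled_partitions lam \<omega> m. (case (?st S, \<lambda>k\<in>{1..?n}. S (inv_into (cells lam) (?st S) k)) of (T, s) \<Rightarrow> \<lambda>c\<in>cells lam. s (T c)) = S"
  proof
    fix S assume S: "S \<in> labeled_partitions lam \<omega> m"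
    show "(case (?st S, \<lambda>k\<in>{1..?n}. S (inv_into (cells lam) (?st S) k)) of (T, s) \<Rightarrow> \<lambda>c\<in>cells lam. s (T c)) = S"
      by (rule extensionalityI[of _ "cells lam"])
        (use S standardization_bij[of S] bij_betwE[OF standardization_bij[of S]]
          in \<open>auto simp: labeled_partitions_def bij_betw_def\<close>)
  qed
  show "(\<lambda>(T, s). \<lambda>c\<in>cells lam. s (T c)) ` ?X \<subseteq> labeled_partitions lam \<omega> m"
  proof (intro image_subsetI, elim SigmaE)
    fix x T s assume x: "x = (T, s)" and T: "T \<in> SYT lam" and s: "s \<in> descent_seqs (tab_descent lam \<omega> T) ?n m"
    let ?S = "\<lambda>c\<in>cells lam. s (T c)"
    have bij: "bij_betw T (cells lam) {1..?n}" using T by (simp add: SYT_def)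
    have "?S c \<le> m" if "c \<in> cells lam" for c
      using that s bij_betwE[OF bij] by (auto simp: descent_seqs_def)
    moreover have "?S c \<le> ?S c' \<and> (\<omega> c > \<omega> c' \<longrightarrow> ?S c < ?S c')" if "c \<in> cells lam" "c' \<in> cells lam" "T c < T c'" for c c'
      using descent_seqs_refined_less[OF T s that] by (auto simp: refined_less_def)
    moreover have "T (i, j) < T (i+1, j)" if "(i, j) \<in> cells lam" "(i+1, j) \<in> cells lam" for i j
      using T that unfolding SYT_def by blast
    moreover have "T (i, j) < T (i, j+1)" if "(i, j) \<in> cells lam" "(i, j+1) \<in> cells lam" for i j
      using T that unfolding SYT_def by blast
    ultimately show "(case x of (T, s) \<Rightarrow> \<lambda>c\<in>cells lam. s (T c)) \<in> labeled_partitions lam \<omega> m"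
      unfolding x prod.case labeled_partitions_def mem_Collect_eq by (intro conjI restrict_extensional) blast+
  qed
  show "(\<lambda>S. (?st S, \<lambda>k\<in>{1..?n}. S (inv_into (cells lam) (?st S) k))) ` labeled_partitions lam \<omega> m \<subseteq> ?X"
  proof (intro image_subsetI SigmaI)
    fix S assume S: "S \<in> labeled_partitions lam \<omega> m"
    show "?st S \<in> SYT lam" using S by (rule standardization_SYT)
    let ?c = "inv_into (cells lam) (?st S)"
    note inv = inv[OF standardization_bij[of S]]
    have less: "refined_less \<omega> S (?c k) (?c (k+1))" if "1 \<le> k" "k < ?n" for k
      using inv[of k] inv[of "k+1"] that standardization_less_iff[of "?c k" "?c (k+1)" S] by simp
    have "S (?c k) \<le> m" if "1 \<le> k" "k \<le> ?n" for k
      using inv[of k] that S by (simp add: labeled_partitions_def)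
    moreover have "S (?c k) \<le> S (?c (k+1)) \<and> (tab_descent lam \<omega> (?st S) k \<longrightarrow> S (?c k) < S (?c (k+1)))"
      if "1 \<le> k" "k < ?n" for k
      using less[OF that] unfolding refined_less_def by linarith
    ultimately show "(\<lambda>k\<in>{1..?n}. S (?c k)) \<in> descent_seqs (tab_descent lam \<omega> (?st S)) ?n m"
      by (simp add: descent_seqs_def)
  qed
qed

lemma finite_SYT: "finite (SYT lam)"
proof (rule finite_subset)
  show "SYT lam \<subseteq> PiE (cells lam) (\<lambda>_. {1..sum_list lam})"
  proof
    fix T assume "T \<in> SYT lam"
    then have "bij_betw T (cells lam) {1..sum_list lam}" "T \<in> extensional (cells lam)" by (simp_all add: SYT_def)
    then show "T \<in> PiE (cells lam) (\<lambda>_. {1..sum_list lam})"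
      unfolding PiE_def Pi_def bij_betw_def by blast
  qed
qed (auto intro: finite_PiE)

theorem labeled_partitions_gf:
  "Abs_fps (\<lambda>m. of_nat (card (labeled_partitions lam \<omega> m))) * (1 - fps_X) ^ Suc (sum_list lam)
     = (\<Sum>T\<in>SYT lam. (fps_X :: 'a::comm_ring_1 fps) ^ des lam \<omega> T)"
proof -
  let ?D = "tab_descent lam \<omega>" and ?n = "sum_list lam"
  have "card (labeled_partitions lam \<omega> m) = (\<Sum>T\<in>SYT lam. card (descent_seqs (?D T) ?n m))" for m
    using bij_betw_same_card[OF labeled_partitions_bij[of m]] finite_SYT by (simp add: card_SigmaI)
  then have "Abs_fps (\<lambda>m. of_nat (card (labeled_partitions lam \<omega> m)) :: 'a)
      = (\<Sum>T\<in>SYT lam. Abs_fps (\<lambda>m. of_nat (card (descent_seqs (?D T) ?n m))))"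
    by (intro fps_ext) (simp add: fps_sum_nth)
  then show ?thesis
    by (simp only: sum_distrib_right descent_seqs_gf des_def)
qed

end

section \<open>Counting flagged tableaux\<close>

lemma eval_mpoly_1: "eval_mpoly (\<lambda>_. 1) f = (\<Sum>a\<in>Poly_Mapping.keys f. Poly_Mapping.lookup f a)"
  by (simp add: eval_mpoly_def)

lemma eval_mpoly_1_add: "eval_mpoly (\<lambda>_. 1) (f + g) = eval_mpoly (\<lambda>_. 1) f + eval_mpoly (\<lambda>_. 1) g"
  unfolding eval_mpoly_1 by (rule setsum_keys_plus_distrib) auto

lemma eval_mpoly_1_sum: "eval_mpoly (\<lambda>_. 1) (sum f A) = (\<Sum>x\<in>A. eval_mpoly (\<lambda>_. 1) (f x))"
  by (induction A rule: infinite_finite_induct) (simp_all add: eval_mpoly_1_add, simp_all add: eval_mpoly_def)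

lemma eval_mpoly_1_prod_var: "eval_mpoly (\<lambda>_. 1) (\<Prod>x\<in>A. var (g x)) = 1"
proof -
  have "\<exists>a. (\<Prod>x\<in>A. var (g x)) = Poly_Mapping.single a 1"
  proof (induction A rule: infinite_finite_induct)
    case (insert x A)
    then obtain a where "(\<Prod>x\<in>A. var (g x)) = Poly_Mapping.single a 1" by blast
    then show ?case using insert by (auto simp: var_def mult_single)
  qed (auto intro: exI[of _ 0])
  then show ?thesis by (auto simp: eval_mpoly_1)
qed

lemma eval_tab_poly: "eval_mpoly (\<lambda>_. 1) (tab_poly lam \<phi>) = int (card (flagged_tab lam \<phi>))"
  by (simp add: tab_poly_def eval_mpoly_1_sum eval_mpoly_1_prod_var)

section \<open>Shape and flag of a permutation\<close>

lemma code_outside: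
  assumes "u permutes {1..m}" "i \<notin> {1..m}"
  shows "code u i = 0"
proof -
  interpret interval_permutation u m by unfold_locales fact
  have "u i = i" using assms by (simp add: permutes_def)
  then have "{j. i < j \<and> u j < u i} = {}"
    using perm_less_imp_le[of _ i] assms(2) by fastforce
  then show ?thesis by (simp only: code_def card.empty)
qed

lemma shift_perm_permutes:
  assumes u: "u permutes {1..m}"
  shows "shift_perm j u permutes {1..j+m}"
proof (rule bij_imp_permutes)
  have in_range: "1 \<le> v (i - j) \<and> v (i - j) \<le> m" if "v permutes {1..m}" "j < i" "i \<le> j + m" for v i
    using permutes_in_image[OF that(1), of "i - j"] that by auto
  have maps: "shift_perm j v i \<in> {1..j+m}" if "v permutes {1..m}" "i \<in> {1..j+m}" for v i
    using in_range[OF that(1), of i] that(2) by (cases "i \<le> j") (auto simp: shift_perm_def)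
  have inverse: "shift_perm j v' (shift_perm j v i) = i"
    if "v permutes {1..m}" "\<And>x. v' (v x) = x" "i \<in> {1..j+m}" for v v' i
    using in_range[OF that(1), of i] that(2,3) by (cases "i \<le> j") (auto simp: shift_perm_def)
  note u' = permutes_inv[OF u]
  show "bij_betw (shift_perm j u) {1..j+m} {1..j+m}"
    by (rule bij_betw_byWitness[where f' = "shift_perm j (inv u)"])
      (use maps[OF u] maps[OF u'] inverse[OF u] inverse[OF u'] permutes_inverses[OF u] in blast)+
  show "shift_perm j u i = i" if "i \<notin> {1..j+m}" for i
  proof (cases "i \<le> j")
    case False
    then have "i - j \<notin> {1..m}" using that by auto
    then have "u (i - j) = i - j" using u by (simp add: permutes_def)
    then show ?thesis using False by (simp add: shift_perm_def)
  qed (simp add: shift_perm_def)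
qed

lemma code_shift_perm:
  assumes u: "u permutes {1..m}"
  shows "code (shift_perm j u) i = (if i \<le> j then 0 else code u (i - j))"
proof (cases "i \<le> j")
  case True
  then have "{k. i < k \<and> shift_perm j u k < shift_perm j u i} = {}" by (auto simp: shift_perm_def)
  then show ?thesis using True by (simp only: code_def card.empty if_True)
next
  case False
  have "bij_betw (\<lambda>k. j + k) {k. i - j < k \<and> u k < u (i - j)} {k. i < k \<and> shift_perm j u k < shift_perm j u i}"
    by (rule bij_betw_byWitness[where f' = "\<lambda>k. k - j"]) (use False in \<open>auto simp: shift_perm_def\<close>)
  from bij_betw_same_card[OF this] show ?thesis using False by (simp add: code_def)
qed

lemma vexillary_shift_perm:
  assumes u: "u permutes {1..m}" and vex: "vexillary m u"
  shows "vexillary (j + m) (shift_perm j u)"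
  unfolding vexillary_def
proof
  let ?w = "shift_perm j u"
  assume "\<exists>a b c d. 1 \<le> a \<and> a < b \<and> b < c \<and> c < d \<and> d \<le> j + m \<and> ?w b < ?w a \<and> ?w a < ?w d \<and> ?w d < ?w c"
  then obtain a b c d where p: "1 \<le> a" "a < b" "b < c" "c < d" "d \<le> j + m" and w: "?w b < ?w a" "?w a < ?w d" "?w d < ?w c"
    by blast
  \<comment> \<open>No inversion starts at one of the fixed positions \<open>1,...,j\<close>, so the
    whole pattern lies in the shifted copy of \<open>u\<close>.\<close>
  have "j < a" using w(1) p(2) by (auto simp: shift_perm_def split: if_splits)
  then have "1 \<le> a - j" "a - j < b - j" "b - j < c - j" "c - j < d - j" "d - j \<le> m"
    "u (b - j) < u (a - j)" "u (a - j) < u (d - j)" "u (d - j) < u (c - j)"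
    using p w by (auto simp: shift_perm_def split: if_splits)
  then show False using vex unfolding vexillary_def by blast
qed

lemma shape_eq: "shape m u = rev (sort (filter (\<lambda>x. x > 0) (map (code u) [1..<m+1])))"
proof -
  have "[code u i. i \<leftarrow> is, code u i > 0] = filter (\<lambda>x. x > 0) (map (code u) is)" for "is"
    by (induction "is") auto
  then show ?thesis by (simp only: shape_def)
qed

lemma sorted_shape: "sorted_wrt (\<ge>) (shape m u)"
  unfolding shape_eq sorted_wrt_rev by simp

lemma mset_shape: "mset (shape m u) = mset (filter (\<lambda>x. x > 0) (map (code u) [1..<m+1]))"
  unfolding shape_eq by (simp only: mset_rev mset_sort)

lemma set_shape: "set (shape m u) = {x \<in> code u ` {1..m}. x > 0}"
  unfolding shape_eq by auto

text \<open>\<open>shape\<close> drops the zero entries of the code while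
  \<open>sorted_parts\<close> keeps them; the \<open>j\<close> new fixed points add further
  zeros.\<close>

lemma sorted_parts_shift_perm:
  assumes u: "u permutes {1..m}"
  obtains z where "sorted_parts (j + m) (code (shift_perm j u)) = shape m u @ replicate z 0"
proof -
  let ?c = "code (shift_perm j u)"
  define M where "M = mset (map ?c [1..<j+m+1])"
  have upt: "[1..<j+m+1] = [1..<j+1] @ map (\<lambda>i. i + j) [1..<m+1]"
  proof -
    have "map (\<lambda>i. i + j) [1..<m+1] = [j+1..<j+1+m]" by (induction m) auto
    then show ?thesis using upt_add_eq_append[of 1 "j + 1" m] by (simp del: upt_Suc)
  qed
  have "filter (\<lambda>x. x > 0) (map ?c [1..<j+m+1]) = filter (\<lambda>x. x > 0) (map (code u) [1..<m+1])"
    unfolding upt map_append filter_append map_map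
    by (auto simp: code_shift_perm[OF u] comp_def filter_empty_conv simp del: upt_Suc intro!: arg_cong[of _ _ "filter _"])
  then have pos: "filter_mset (\<lambda>x. x > 0) M = mset (shape m u)"
    unfolding M_def mset_filter[symmetric] mset_shape by (rule arg_cong)
  have "M = filter_mset (\<lambda>x. x > 0) M + filter_mset (\<lambda>x. x = 0) M"
    by (subst multiset_partition[of M "\<lambda>x. x > 0"]) simp
  then have "mset (shape m u @ replicate (count M 0) 0) = M"
    unfolding pos filter_eq_replicate_mset by simp
  moreover have "sorted_wrt (\<ge>) (shape m u @ replicate (count M 0) 0)"
    unfolding sorted_wrt_append using sorted_shape by (auto simp: sorted_wrt_iff_nth_less[of _ "replicate _ _"])
  ultimately show thesis unfolding M_def by (intro that sorted_parts_eqI) auto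
qed

lemma cells_append_zeros: "cells (lam @ replicate z 0) = cells lam"
  by (auto simp: cells_def nth_append split: if_splits)

lemma last_ge_shift_perm:
  assumes u: "u permutes {1..m}" and b: "b \<in> code u ` {1..m}" "b > 0"
  shows "last_ge (j + m) (code (shift_perm j u)) b = j + last_ge m (code u) b"
proof (rule last_ge_eqI)
  note in_range = last_ge_in[OF b(1)]
  show "1 \<le> j + last_ge m (code u) b" "j + last_ge m (code u) b \<le> j + m"
    "b \<le> code (shift_perm j u) (j + last_ge m (code u) b)"
    using in_range by (auto simp: code_shift_perm[OF u])
  show "code (shift_perm j u) k < b" if "j + last_ge m (code u) b < k" "k \<le> j + m" for k
  proof -
    have "1 \<le> k - j" "k - j \<le> m" "\<not> k \<le> j" "\<not> k - j \<le> last_ge m (code u) b" using that by linarith+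
    moreover from this have "\<not> b \<le> code u (k - j)" using last_ge_ge[of "k - j" m b "code u"] by blast
    ultimately show ?thesis by (simp add: code_shift_perm[OF u])
  qed
qed

text \<open>Larger parts have smaller last positions, so mapping over the decreasing shape already
  produces a sorted list. The maximum over all positions is one over \<open>{1..m}\<close>, because
  the code vanishes elsewhere and the bound is positive.\<close>

lemma flag_eq:
  assumes u: "u permutes {1..m}"
  shows "flag m u = map (last_ge m (code u)) (shape m u)"
proof -
  have max: "Max {j. code u j \<ge> b} = last_ge m (code u) b" if "b > 0" for b
  proof -
    have "{j. code u j \<ge> b} = {j \<in> {1..m}. b \<le> code u j}"
      using code_outside[OF u] that by fastforce
    then show ?thesis by (simp add: last_ge_def)
  qed
  have "[Max {j. code u j \<ge> code u i}. i \<leftarrow> is, code u i > 0] = map (last_ge m (code u)) (filter (\<lambda>x. x > 0) (map (code u) is))" for "is"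
    by (induction "is") (auto simp: max)
  then have "flag m u = sort (map (last_ge m (code u)) (filter (\<lambda>x. x > 0) (map (code u) [1..<m+1])))"
    by (simp only: flag_def)
  also have "\<dots> = map (last_ge m (code u)) (shape m u)"
  proof (rule properties_for_sort)
    show "mset (map (last_ge m (code u)) (shape m u)) = mset (map (last_ge m (code u)) (filter (\<lambda>x. x > 0) (map (code u) [1..<m+1])))"
      unfolding mset_map mset_shape ..
    have "last_ge m (code u) x \<le> last_ge m (code u) y" if "x \<in> set (shape m u)" "y \<le> x" for x y
      using that by (intro last_ge_antimono) (auto simp: set_shape)
    then show "sorted (map (last_ge m (code u)) (shape m u))"
      using sorted_shape[of m u] by (auto simp: sorted_wrt_iff_nth_less)
  qed
  finally show ?thesis .
qed

text \<open>\<open>1^j x u\<close> has the code of \<open>u\<close> preceded by \<open>j\<close>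
  zeros: the rows with cells are the same and each flag moves up by \<open>j\<close>.\<close>

lemma nu_eq_card_flagged_tab:
  assumes u: "u permutes {1..m}" and vex: "vexillary m u"
  shows "nu m u j = int (card (flagged_tab (shape m u) (\<lambda>r. j + last_ge m (code u) (shape m u ! (r - 1)))))"
proof -
  let ?c = "code (shift_perm j u)" and ?lam = "shape m u"
  obtain z where z: "sorted_parts (j + m) ?c = ?lam @ replicate z 0"
    using sorted_parts_shift_perm[OF u] by blast
  have "last_ge (j + m) ?c ((?lam @ replicate z 0) ! (r - 1)) = j + last_ge m (code u) (?lam ! (r - 1))"
    if "(r, k) \<in> cells ?lam" for r k
  proof -
    have "r - 1 < length ?lam" using that by (auto simp: cells_def)
    then have "?lam ! (r - 1) \<in> set ?lam" by simp
    then show ?thesis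
      using \<open>r - 1 < length ?lam\<close> last_ge_shift_perm[OF u, of "?lam ! (r - 1)" j] by (auto simp: set_shape nth_append)
  qed
  then have "flagged_tab (?lam @ replicate z 0) (\<lambda>r. last_ge (j + m) ?c ((?lam @ replicate z 0) ! (r - 1)))
      = flagged_tab ?lam (\<lambda>r. j + last_ge m (code u) (?lam ! (r - 1)))"
    unfolding flagged_tab_def cells_append_zeros by (intro Collect_cong) auto
  then show ?thesis
    unfolding nu_def schubert_vexillary[OF shift_perm_permutes[OF u] vexillary_shift_perm[OF u vex]]
    by (simp add: vex_poly_def z eval_tab_poly)
qed

section \<open>Blocks of a partition\<close>

lemma length_concat_replicate: "length (concat (map (\<lambda>q. replicate (f q) (g q)) [1..<n+1])) = (\<Sum>q=1..n. f q)"
  by (induction n) auto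

lemma nth_concat_replicate:
  assumes "1 \<le> q" "q \<le> n" "(\<Sum>k=1..q-1. f k) \<le> i" "i < (\<Sum>k=1..q. f k)"
  shows "concat (map (\<lambda>q. replicate (f q) (g q)) [1..<n+1]) ! i = g q"
  using assms
proof (induction n)
  case (Suc n)
  have app: "concat (map (\<lambda>q. replicate (f q) (g q)) [1..<Suc n+1])
      = concat (map (\<lambda>q. replicate (f q) (g q)) [1..<n+1]) @ replicate (f (Suc n)) (g (Suc n))"
    by simp
  show ?case
  proof (cases "q = Suc n")
    case True
    then show ?thesis using Suc.prems length_concat_replicate[of f g n] unfolding app by (simp add: nth_append del: upt_Suc)
  next
    case False
    then have "q \<le> n" using Suc.prems by simp
    then have "(\<Sum>k=1..q. f k) \<le> (\<Sum>k=1..n. f k)" by (intro sum_mono2) auto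
    then show ?thesis using Suc \<open>q \<le> n\<close> length_concat_replicate[of f g n] unfolding app by (simp add: nth_append del: upt_Suc)
  qed
qed simp

lemma block_of_index:
  fixes f :: "nat \<Rightarrow> nat"
  assumes "i < (\<Sum>k=1..n. f k)"
  shows "\<exists>q. 1 \<le> q \<and> q \<le> n \<and> (\<Sum>k=1..q-1. f k) \<le> i \<and> i < (\<Sum>k=1..q. f k)"
  using assms
proof (induction n)
  case (Suc n)
  show ?case
  proof (cases "i < (\<Sum>k=1..n. f k)")
    case True
    then show ?thesis using Suc.IH le_SucI by blast
  next
    case False
    then show ?thesis using Suc.prems by (intro exI[of _ "Suc n"]) auto
  qed
qed simp

lemma count_concat_replicate:
  "count (mset (concat (map (\<lambda>q. replicate (f q) (g q)) [1..<n+1]))) x = (\<Sum>q=1..n. if g q = x then f q else 0)"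
  by (induction n) auto

lemma block_part_less:
  assumes "1 \<le> q" "q < q'" "q' \<le> num_blocks lam"
  shows "block_part lam q' < block_part lam q"
proof -
  let ?xs = "sorted_list_of_set (set lam)"
  have len: "length ?xs = num_blocks lam" by (simp add: num_blocks_def)
  have "sorted_wrt (<) ?xs" by (rule strict_sorted_list_of_set)
  then show ?thesis
    using assms len by (auto simp: block_part_def rev_nth sorted_wrt_iff_nth_less)
qed

lemma block_part_image: "block_part lam ` {1..num_blocks lam} = set lam"
proof -
  let ?xs = "rev (sorted_list_of_set (set lam))"
  have len: "length ?xs = num_blocks lam" by (simp add: num_blocks_def)
  have shift: "f ` {1..n} = (\<lambda>i. f (Suc i)) ` {..<n}" for f :: "nat \<Rightarrow> nat" and n
    using image_image[of f Suc "{..<n}"] by (simp add: image_Suc_lessThan)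
  have "block_part lam ` {1..num_blocks lam} = (\<lambda>i. ?xs ! i) ` {..<num_blocks lam}"
    unfolding shift by (simp add: block_part_def)
  also have "\<dots> = set ?xs" using len by (auto simp: set_conv_nth[of ?xs] simp del: set_rev)
  finally have "set ?xs = block_part lam ` {1..num_blocks lam}" ..
  then show ?thesis by simp
qed

text \<open>Both lists are weakly decreasing and have the same multiset of entries.\<close>

lemma partition_eq_concat_blocks:
  assumes "sorted_wrt (\<ge>) lam"
  shows "lam = concat (map (\<lambda>q. replicate (block_mult lam q) (block_part lam q)) [1..<num_blocks lam + 1])" (is "_ = ?R")
proof -
  have "sorted_wrt (\<ge>) (concat (map (\<lambda>q. replicate (block_mult lam q) (block_part lam q)) [1..<n + 1]))"
    if "n \<le> num_blocks lam" for n
    using that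
  proof (induction n)
    case (Suc n)
    then show ?case
      using block_part_less[of _ "Suc n" lam] by (auto simp: sorted_wrt_append sorted_wrt_iff_nth_less[of _ "replicate _ _"] less_imp_le)
  qed simp
  then have sorted: "sorted_wrt (\<ge>) ?R" by simp
  have inj: "inj_on (block_part lam) {1..num_blocks lam}"
    by (rule linorder_inj_onI') (metis atLeastAtMost_iff block_part_less less_irrefl)
  have "count (mset ?R) x = count (mset lam) x" for x
  proof -
    have "count (mset ?R) x = (\<Sum>q=1..num_blocks lam. if block_part lam q = x then count (mset lam) (block_part lam q) else 0)"
      unfolding count_concat_replicate by (simp only: block_mult_def count_mset)
    also have "\<dots> = (\<Sum>y\<in>block_part lam ` {1..num_blocks lam}. if y = x then count (mset lam) y else 0)"
      by (subst sum.reindex[OF inj]) (simp add: comp_def)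
    also have "\<dots> = (\<Sum>y\<in>set lam. if y = x then count (mset lam) y else 0)"
      by (simp only: block_part_image)
    also have "\<dots> = count (mset lam) x" by (simp add: count_mset_0_iff)
    finally show ?thesis .
  qed
  then have "mset ?R = mset lam" by (rule multiset_eqI)
  then have "sort lam = rev lam" "sort lam = rev ?R"
    using assms sorted by (auto intro!: properties_for_sort simp: sorted_wrt_rev simp del: upt_Suc)
  then show ?thesis by (metis rev_is_rev_conv)
qed

lemma length_eq_sum_block_mult:
  assumes "sorted_wrt (\<ge>) lam"
  shows "length lam = (\<Sum>q=1..num_blocks lam. block_mult lam q)"
  using arg_cong[OF partition_eq_concat_blocks[OF assms], of length] unfolding length_concat_replicate .

text \<open>\<open>block_end lam q\<close> is the last row of length
  \<open>block_part lam q\<close>, so the two numbers are the coordinates of a corner cell.\<close>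

lemma block_end_in_range:
  assumes lam: "sorted_wrt (\<ge>) lam" and q: "1 \<le> q" "q \<le> num_blocks lam"
  shows "1 \<le> block_end lam q" "block_end lam q \<le> length lam" "lam ! (block_end lam q - 1) = block_part lam q"
proof -
  have "block_part lam q \<in> set lam" using q by (auto simp flip: block_part_image)
  then have mult: "block_mult lam q > 0" by (simp add: block_mult_def count_list_0_iff flip: neq0_conv)
  have split: "block_end lam q = (\<Sum>k=1..q-1. block_mult lam k) + block_mult lam q"
    using q by (cases q) (auto simp: block_end_def)
  then show "1 \<le> block_end lam q" using mult by simp
  show "block_end lam q \<le> length lam"
    unfolding block_end_def length_eq_sum_block_mult[OF lam] using q by (intro sum_mono2) auto
  have "concat (map (\<lambda>q. replicate (block_mult lam q) (block_part lam q)) [1..<num_blocks lam + 1]) ! (block_end lam q - 1) = block_part lam q"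
    using mult split by (intro nth_concat_replicate[OF q]) (auto simp: block_end_def)
  then show "lam ! (block_end lam q - 1) = block_part lam q"
    unfolding partition_eq_concat_blocks[OF lam, symmetric] .
qed

text \<open>\<open>lam\<close> and \<open>sig_flag\<close> are concatenations with the same block
  lengths, so an index falls into the same block of both.\<close>

lemma sig_flag_nth:
  assumes lam: "sorted_wrt (\<ge>) lam" and i: "1 \<le> i" "i \<le> length lam"
  obtains q where "1 \<le> q" "q \<le> num_blocks lam" "lam ! (i - 1) = block_part lam q" "i \<le> block_end lam q"
    "sig_flag lam \<epsilon> N ! (i - 1) = N + 1 - int (sig_F \<epsilon> (block_part lam q)) + sig_Ebar \<epsilon> (block_end lam q)"
proof -
  have "i - 1 < (\<Sum>q=1..num_blocks lam. block_mult lam q)"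
    using i unfolding length_eq_sum_block_mult[OF lam, symmetric] by simp
  from block_of_index[OF this] obtain q where q: "1 \<le> q" "q \<le> num_blocks lam"
    "(\<Sum>k=1..q-1. block_mult lam k) \<le> i - 1" "i - 1 < (\<Sum>k=1..q. block_mult lam k)" by blast
  have nth: "concat (map (\<lambda>q. replicate (block_mult lam q) (g q)) [1..<num_blocks lam + 1]) ! (i - 1) = g q" for g :: "nat \<Rightarrow> 'b"
    using q by (rule nth_concat_replicate)
  have "lam ! (i - 1) = block_part lam q"
    using nth[of "block_part lam"] unfolding partition_eq_concat_blocks[OF lam, symmetric] .
  moreover have "i \<le> block_end lam q" using q(4) by (simp add: block_end_def)
  ultimately show thesis
    using q nth[of "\<lambda>q. N + 1 - int (sig_F \<epsilon> (block_part lam q)) + sig_Ebar \<epsilon> (block_end lam q)"]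
    by (intro that) (auto simp only: sig_flag_def)
qed

section \<open>From flagged tableaux to labeled partitions\<close>

context
  fixes lam :: "nat list" and \<epsilon> :: signature and \<omega> :: "nat \<times> nat \<Rightarrow> nat"
  assumes lam: "sorted_wrt (\<ge>) lam" and sig: "is_signature lam \<epsilon>" and comp: "compatible lam \<epsilon> \<omega>"
begin

text \<open>Compatibility makes the comparison of labels in two adjacent rows independent of the
  column, which is why row sums of signature entries can record the strict steps.\<close>

lemma sig_E_Suc:
  assumes "(i, k) \<in> cells lam" "(i + 1, k) \<in> cells lam"
  shows "sig_E \<epsilon> (i + 1) = sig_E \<epsilon> i + (if \<omega> (i, k) > \<omega> (i + 1, k) then 1 else 0)"
    and "fst \<epsilon> i = (if \<omega> (i, k) > \<omega> (i + 1, k) then 1 else 0)"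
proof -
  have i: "1 \<le> i" "i < length lam" using assms by (auto simp: cells_def)
  then have "fst \<epsilon> i \<in> {0, 1}" using sig by (simp add: is_signature_def)
  moreover have "\<omega> (i, k) > \<omega> (i + 1, k) \<longleftrightarrow> fst \<epsilon> i = 1"
    using comp assms unfolding compatible_def by blast
  ultimately show e: "fst \<epsilon> i = (if \<omega> (i, k) > \<omega> (i + 1, k) then 1 else 0)" by auto
  show "sig_E \<epsilon> (i + 1) = sig_E \<epsilon> i + (if \<omega> (i, k) > \<omega> (i + 1, k) then 1 else 0)"
    unfolding e[symmetric] using i by (simp add: sig_E_def)
qed

lemma sig_F_Suc:
  assumes "(i, k) \<in> cells lam" "(i, k + 1) \<in> cells lam"
  shows "sig_F \<epsilon> (k + 1) = sig_F \<epsilon> k + (if \<omega> (i, k) > \<omega> (i, k + 1) then 1 else 0)"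
    and "snd \<epsilon> k = (if \<omega> (i, k) > \<omega> (i, k + 1) then 1 else 0)"
proof -
  \<comment> \<open>The signature is constrained below the first part, so the column index has to be
    compared with row 1.\<close>
  have "(1, k + 1) \<in> cells lam" using cells_up[OF lam assms(2), of 1] assms by (auto simp: cells_def)
  then have k: "1 \<le> k" "k < hd lam" using assms(1) by (cases lam; auto simp: cells_def)+
  then have "snd \<epsilon> k \<in> {0, 1}" using sig by (simp add: is_signature_def)
  moreover have "\<omega> (i, k) > \<omega> (i, k + 1) \<longleftrightarrow> snd \<epsilon> k = 1"
    using comp assms unfolding compatible_def by blast
  ultimately show f: "snd \<epsilon> k = (if \<omega> (i, k) > \<omega> (i, k + 1) then 1 else 0)" by auto
  show "sig_F \<epsilon> (k + 1) = sig_F \<epsilon> k + (if \<omega> (i, k) > \<omega> (i, k + 1) then 1 else 0)"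
    unfolding f[symmetric] using k by (simp add: sig_F_def)
qed

text \<open>Walking along the first row and down column \<open>k\<close> collects all the forced
  strict steps. The bound keeps the inverse of the shift within the natural numbers and excludes
  fillings with too small a maximum.\<close>

lemma labeled_partition_ge:
  assumes S: "S \<in> labeled_partitions lam \<omega> m" and c: "(i, k) \<in> cells lam"
  shows "sig_F \<epsilon> k + sig_E \<epsilon> i \<le> S (i, k)"
proof -
  have ik: "1 \<le> i" "1 \<le> k" using c by (auto simp: cells_def)
  have vert: "S (i, k) + fst \<epsilon> i \<le> S (i + 1, k)" if "(i, k) \<in> cells lam" "(i + 1, k) \<in> cells lam" for i k
    using S that unfolding sig_E_Suc(2)[OF that] labeled_partitions_def by (auto simp: Suc_le_eq)
  have horiz: "S (i, k) + snd \<epsilon> k \<le> S (i, k + 1)" if "(i, k) \<in> cells lam" "(i, k + 1) \<in> cells lam" for i k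
    using S that unfolding sig_F_Suc(2)[OF that] labeled_partitions_def by (auto simp: Suc_le_eq)
  have "(1, k) \<in> cells lam" using cells_up[OF lam c, of 1] ik by simp
  then have "sum (snd \<epsilon>) {1..<k} \<le> S (1, k)"
    using row_mono[of lam S "snd \<epsilon>" 1 k 1, OF horiz] ik by simp
  moreover have "S (1, k) + sum (fst \<epsilon>) {1..<i} \<le> S (i, k)"
    using column_mono[of lam S "fst \<epsilon>" i k 1, OF lam vert c] ik by simp
  ultimately show ?thesis by (simp add: sig_E_def sig_F_def)
qed

text \<open>
  The bijection is \<open>S(i,k) = T(i,k) + F\<^sub>k + E\<^sub>i - i\<close>; both flags and the upper bound on \<open>S\<close> need only be
  checked in the corner cells of the diagram.
\<close>

lemma card_flagged_tab_eq_labeled_partitions: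
  assumes corner: "\<And>i. 1 \<le> i \<Longrightarrow> i \<le> length lam \<Longrightarrow> \<exists>R\<ge>i. R \<le> length lam \<and> lam ! (R - 1) = lam ! (i - 1) \<and>
      \<phi> R = \<phi> i \<and> \<phi> i + sig_F \<epsilon> (lam ! (i - 1)) + sig_E \<epsilon> R = K + R"
  shows "card (flagged_tab lam \<phi>) = card (labeled_partitions lam \<omega> K)"
proof (rule bij_betw_same_card)
  \<comment> \<open>Subtraction is truncated here: \<open>T_ge\<close> makes it exact in
    \<open>f\<close>, and \<open>labeled_partition_ge\<close> does so in \<open>g\<close>.\<close>
  define f where "f T = (\<lambda>c\<in>cells lam. T c + sig_F \<epsilon> (snd c) + sig_E \<epsilon> (fst c) - fst c)" for T :: "nat \<times> nat \<Rightarrow> nat"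
  define g where "g S = (\<lambda>c\<in>cells lam. S c + fst c - (sig_F \<epsilon> (snd c) + sig_E \<epsilon> (fst c)))" for S :: "nat \<times> nat \<Rightarrow> nat"
  have T_ge: "i \<le> T (i, k)" if T: "T \<in> flagged_tab lam \<phi>" and c: "(i, k) \<in> cells lam" for T i k
  proof -
    have i: "1 \<le> i" using c by (auto simp: cells_def)
    have "(1, k) \<in> cells lam" using cells_up[OF lam c, of 1] i by simp
    then have "1 \<le> T (1, k)" using T unfolding flagged_tab_def by blast
    then show ?thesis using flagged_tab_column_mono[OF T lam c, of 1] i by simp
  qed
  have corner': "\<exists>R\<ge>i. (R, lam ! (i - 1)) \<in> cells lam \<and> (R, k) \<in> cells lam \<and> (i, lam ! (i - 1)) \<in> cells lam \<and> k \<le> lam ! (i - 1) \<and>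
      \<phi> R = \<phi> i \<and> \<phi> i + sig_F \<epsilon> (lam ! (i - 1)) + sig_E \<epsilon> R = K + R"
    if c: "(i, k) \<in> cells lam" for i k
  proof -
    have i: "1 \<le> i" "i \<le> length lam" "1 \<le> k" "k \<le> lam ! (i - 1)" using c by (auto simp: cells_def)
    from corner[OF i(1,2)] obtain R where R: "i \<le> R" "R \<le> length lam" "lam ! (R - 1) = lam ! (i - 1)"
      "\<phi> R = \<phi> i" "\<phi> i + sig_F \<epsilon> (lam ! (i - 1)) + sig_E \<epsilon> R = K + R" by blast
    then show ?thesis using i by (intro exI[of _ R]) (auto simp: cells_def)
  qed
  show "bij_betw f (flagged_tab lam \<phi>) (labeled_partitions lam \<omega> K)"
  proof (rule bij_betw_byWitness[where f' = g])
    show "\<forall>T\<in>flagged_tab lam \<phi>. g (f T) = T"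
    proof
      fix T assume T: "T \<in> flagged_tab lam \<phi>"
      show "g (f T) = T"
      proof (rule extensionalityI[of _ "cells lam"])
        show "g (f T) c = T c" if "c \<in> cells lam" for c
          using that T_ge[OF T, of "fst c" "snd c"] by (simp add: f_def g_def)
      qed (use T in \<open>auto simp: g_def flagged_tab_def\<close>)
    qed
    show "\<forall>S\<in>labeled_partitions lam \<omega> K. f (g S) = S"
    proof
      fix S assume S: "S \<in> labeled_partitions lam \<omega> K"
      show "f (g S) = S"
      proof (rule extensionalityI[of _ "cells lam"])
        show "f (g S) c = S c" if "c \<in> cells lam" for c
          using that labeled_partition_ge[OF S, of "fst c" "snd c"] by (simp add: f_def g_def)
      qed (use S in \<open>auto simp: f_def labeled_partitions_def\<close>)
    qed
    show "f ` flagged_tab lam \<phi> \<subseteq> labeled_partitions lam \<omega> K"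
    proof (rule image_subsetI)
      fix T assume T: "T \<in> flagged_tab lam \<phi>"
      have f: "f T (i, k) + i = T (i, k) + sig_F \<epsilon> k + sig_E \<epsilon> i" if "(i, k) \<in> cells lam" for i k
        using that T_ge[OF T that] by (simp add: f_def)
      have vert: "f T (i, k) + (if \<omega> (i, k) > \<omega> (i + 1, k) then 1 else 0) \<le> f T (i + 1, k)"
        if c: "(i, k) \<in> cells lam" "(i + 1, k) \<in> cells lam" for i k
      proof -
        have "T (i, k) < T (i + 1, k)" using T c unfolding flagged_tab_def by blast
        then show ?thesis using f[OF c(1)] f[OF c(2)] sig_E_Suc(1)[OF c] by linarith
      qed
      have horiz: "f T (i, k) + (if \<omega> (i, k) > \<omega> (i, k + 1) then 1 else 0) \<le> f T (i, k + 1)"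
        if c: "(i, k) \<in> cells lam" "(i, k + 1) \<in> cells lam" for i k
      proof -
        have "T (i, k) \<le> T (i, k + 1)" using T c unfolding flagged_tab_def by blast
        then show ?thesis using f[OF c(1)] f[OF c(2)] sig_F_Suc(1)[OF c] by linarith
      qed
      have bound: "f T (i, k) \<le> K" if c: "(i, k) \<in> cells lam" for i k
      proof -
        let ?p = "lam ! (i - 1)"
        obtain R where R: "i \<le> R" "(R, ?p) \<in> cells lam" "(i, ?p) \<in> cells lam" "k \<le> ?p"
          "\<phi> R = \<phi> i" "\<phi> i + sig_F \<epsilon> ?p + sig_E \<epsilon> R = K + R" using corner'[OF c] by blast
        have ik: "1 \<le> i" "1 \<le> k" using c by (auto simp: cells_def)
        have h: "f T (i, k) + 0 \<le> f T (i, k + 1)" if "(i, k) \<in> cells lam" "(i, k + 1) \<in> cells lam" for i k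
          using horiz[OF that] by simp
        have v: "f T (i, k) + 0 \<le> f T (i + 1, k)" if "(i, k) \<in> cells lam" "(i + 1, k) \<in> cells lam" for i k
          using vert[OF that] by simp
        \<comment> \<open>The path runs to the end of the row and down to the corner
          \<open>(R, ?p)\<close>, where the flag translates into the bound \<open>K\<close>.\<close>
        have "f T (i, k) \<le> f T (i, ?p)"
          using row_mono[of lam "f T" "\<lambda>_. 0" i ?p k, OF h R(3) ik(2) R(4)] by simp
        also have "\<dots> \<le> f T (R, ?p)"
          using column_mono[of lam "f T" "\<lambda>_. 0" R ?p i, OF lam v R(2) ik(1) R(1)] by simp
        also have "\<dots> \<le> K"
        proof -
          have "T (R, ?p) \<le> \<phi> R" using T R(2) unfolding flagged_tab_def by blast
          then show ?thesis using f[OF R(2)] R(5,6) by linarith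
        qed
        finally show ?thesis .
      qed
      show "f T \<in> labeled_partitions lam \<omega> K"
        unfolding labeled_partitions_def mem_Collect_eq
      proof (intro conjI allI impI ballI; (elim conjE)?)
        show "f T \<in> extensional (cells lam)" by (simp add: f_def)
        show "f T c \<le> K" if "c \<in> cells lam" for c using bound[of "fst c" "snd c"] that by simp
      next
        fix i k assume c: "(i, k) \<in> cells lam" "(i + 1, k) \<in> cells lam"
        show "f T (i, k) \<le> f T (i + 1, k)" using vert[OF c] by simp
        show "f T (i, k) < f T (i + 1, k)" if "\<omega> (i + 1, k) < \<omega> (i, k)" using vert[OF c] that by simp
      next
        fix i k assume c: "(i, k) \<in> cells lam" "(i, k + 1) \<in> cells lam"
        show "f T (i, k) \<le> f T (i, k + 1)" using horiz[OF c] by simp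
        show "f T (i, k) < f T (i, k + 1)" if "\<omega> (i, k + 1) < \<omega> (i, k)" using horiz[OF c] that by simp
      qed
    qed
    show "g ` labeled_partitions lam \<omega> K \<subseteq> flagged_tab lam \<phi>"
    proof (rule image_subsetI)
      fix S assume S: "S \<in> labeled_partitions lam \<omega> K"
      have g: "g S (i, k) + (sig_F \<epsilon> k + sig_E \<epsilon> i) = S (i, k) + i" if "(i, k) \<in> cells lam" for i k
        using that labeled_partition_ge[OF S that] by (simp add: g_def)
      have vert: "g S (i, k) + 1 \<le> g S (i + 1, k)" if c: "(i, k) \<in> cells lam" "(i + 1, k) \<in> cells lam" for i k
      proof -
        have "S (i, k) \<le> S (i + 1, k) \<and> (\<omega> (i, k) > \<omega> (i + 1, k) \<longrightarrow> S (i, k) < S (i + 1, k))"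
          using S c unfolding labeled_partitions_def by blast
        then show ?thesis using g[OF c(1)] g[OF c(2)] sig_E_Suc(1)[OF c] by (auto split: if_splits)
      qed
      have horiz: "g S (i, k) + 0 \<le> g S (i, k + 1)" if c: "(i, k) \<in> cells lam" "(i, k + 1) \<in> cells lam" for i k
      proof -
        have "S (i, k) \<le> S (i, k + 1) \<and> (\<omega> (i, k) > \<omega> (i, k + 1) \<longrightarrow> S (i, k) < S (i, k + 1))"
          using S c unfolding labeled_partitions_def by blast
        then show ?thesis using g[OF c(1)] g[OF c(2)] sig_F_Suc(1)[OF c] by (auto split: if_splits)
      qed
      have lower: "1 \<le> g S (i, k)" if c: "(i, k) \<in> cells lam" for i k
        using g[OF c] labeled_partition_ge[OF S c] c by (auto simp: cells_def)
      have bound: "g S (i, k) \<le> \<phi> i" if c: "(i, k) \<in> cells lam" for i k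
      proof -
        let ?p = "lam ! (i - 1)"
        obtain R where R: "i \<le> R" "(R, ?p) \<in> cells lam" "(i, ?p) \<in> cells lam" "k \<le> ?p"
          "\<phi> R = \<phi> i" "\<phi> i + sig_F \<epsilon> ?p + sig_E \<epsilon> R = K + R" using corner'[OF c] by blast
        have ik: "1 \<le> i" "1 \<le> k" using c by (auto simp: cells_def)
        \<comment> \<open>The same path; at the corner the bound \<open>K\<close> translates back
          into the flag, which row \<open>i\<close> shares with row \<open>R\<close>.\<close>
        have "g S (i, k) \<le> g S (i, ?p)"
          using row_mono[of lam "g S" "\<lambda>_. 0" i ?p k, OF horiz R(3) ik(2) R(4)] by simp
        also have "\<dots> \<le> g S (R, ?p)"
          using column_mono[of lam "g S" "\<lambda>_. 1" R ?p i, OF lam vert R(2) ik(1) R(1)] by simp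
        also have "\<dots> \<le> \<phi> i"
        proof -
          have "S (R, ?p) \<le> K" using S R(2) unfolding labeled_partitions_def by blast
          then show ?thesis using g[OF R(2)] R(6) by linarith
        qed
        finally show ?thesis .
      qed
      show "g S \<in> flagged_tab lam \<phi>"
        unfolding flagged_tab_def mem_Collect_eq
      proof (intro conjI allI impI; (elim conjE)?)
        show "g S \<in> extensional (cells lam)" by (simp add: g_def)
        show "g S (i, k) < g S (i + 1, k)" if "(i, k) \<in> cells lam" "(i + 1, k) \<in> cells lam" for i k
          using vert[OF that] by simp
        show "g S (i, k) \<le> g S (i, k + 1)" if "(i, k) \<in> cells lam" "(i, k + 1) \<in> cells lam" for i k
          using horiz[OF that] by simp
      qed (use lower bound in blast)+
    qed
  qed
qed

end

text \<open>At the corner cell of a block attaining the maximum, the forced strict steps alone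
  exceed \<open>m\<close>.\<close>

lemma labeled_partitions_empty:
  assumes lam: "sorted_wrt (\<ge>) lam" "0 \<notin> set lam" "lam \<noteq> []" and sig: "is_signature lam \<epsilon>" and comp: "compatible lam \<epsilon> \<omega>"
    and m: "m < Max ((\<lambda>q. sig_F \<epsilon> (block_part lam q) + sig_E \<epsilon> (block_end lam q)) ` {1..num_blocks lam})"
  shows "labeled_partitions lam \<omega> m = {}"
proof (rule equals0I)
  fix S assume S: "S \<in> labeled_partitions lam \<omega> m"
  let ?A = "(\<lambda>q. sig_F \<epsilon> (block_part lam q) + sig_E \<epsilon> (block_end lam q)) ` {1..num_blocks lam}"
  have "num_blocks lam > 0" using lam(3) by (simp add: num_blocks_def card_gt_0_iff)
  then have "Max ?A \<in> ?A" by (intro Max_in) auto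
  then obtain q where q: "1 \<le> q" "q \<le> num_blocks lam" "Max ?A = sig_F \<epsilon> (block_part lam q) + sig_E \<epsilon> (block_end lam q)"
    by auto
  note R = block_end_in_range[OF lam(1) q(1,2)]
  have "block_part lam q \<in> set lam" using q by (auto simp flip: block_part_image)
  then have "(block_end lam q, block_part lam q) \<in> cells lam"
    using R lam(2) by (auto simp: cells_def Suc_le_eq intro: gr0I)
  then have "Max ?A \<le> S (block_end lam q, block_part lam q)" "S (block_end lam q, block_part lam q) \<le> m"
    using labeled_partition_ge[OF lam(1) sig comp S] S unfolding q(3) labeled_partitions_def by blast+
  then show False using m by simp
qed

text \<open>An empty shape would give \<open>u 1 = 1\<close>, against indecomposability at
  \<open>i = 1\<close>. It guarantees that the maximum defining \<open>N\<close> ranges over a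
  nonempty set.\<close>

lemma shape_nonempty:
  assumes u: "u permutes {1..m}" and "m \<ge> 2" and indec: "indecomposable m u"
  shows "shape m u \<noteq> []"
proof
  assume "shape m u = []"
  then have "set (shape m u) = {}" by (simp only: set_empty)
  then have empty: "{x \<in> code u ` {1..m}. x > 0} = {}" unfolding set_shape .
  have "1 \<in> {1..m}" using assms(2) by simp
  then have in_image: "code u 1 \<in> code u ` {1..m}" by (rule imageI)
  have code: "code u 1 = 0"
  proof (rule ccontr)
    assume "code u 1 \<noteq> 0"
    then have "code u 1 \<in> {x \<in> code u ` {1..m}. x > 0}" using in_image by (intro CollectI conjI) (simp_all only: neq0_conv)
    then show False unfolding empty by (rule emptyE)
  qed
  have "1 \<in> u ` {1..m}" unfolding permutes_image[OF u] by fact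
  then obtain k where "1 = u k" "k \<in> {1..m}" by (rule imageE)
  then have k: "k \<in> {1..m}" "u k = 1" by simp_all
  interpret interval_permutation u m by unfold_locales fact
  have no_inv: "{j. 1 < j \<and> u j < u 1} = {}" using code finite_inversions[of 1] by (simp add: code_def)
  have "u 1 \<ge> 1" using permutes_in_image[OF u, of 1] assms(2) by simp
  then have "u 1 = 1"
  proof (cases "k = 1")
    case False
    then have "\<not> u k < u 1" using no_inv k(1) by auto
    then show ?thesis using k(2) \<open>u 1 \<ge> 1\<close> by simp
  qed (use k in simp)
  then have "u ` {1..1} = {1..1}" by simp
  moreover have "u ` {1..1} \<noteq> {1..1}"
    using indec assms(2) unfolding indecomposable_def by (elim allE[of _ 1]) simp
  ultimately show False by contradiction
qed

theorem theorem7p10: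
  fixes p n N :: nat and u :: "nat \<Rightarrow> nat" and lam :: "nat list"
    and \<epsilon> :: signature and \<omega> :: "nat \<times> nat \<Rightarrow> nat"
  assumes "p \<ge> 1"
    and "u permutes {1..p+1}"
    and "indecomposable (p+1) u"
    and "vexillary (p+1) u"
    and "lam = shape (p+1) u"
    and "sum_list lam + 1 = n"
    and "is_signature lam \<epsilon>"
    and "map int (flag (p+1) u) = sig_flag lam \<epsilon> (int N)"
    and "N = Max ((\<lambda>q. sig_F \<epsilon> (block_part lam q) + sig_E \<epsilon> (block_end lam q)) ` {1..num_blocks lam})"
    and "labeling lam \<omega>"
    and "compatible lam \<epsilon> \<omega>"
  shows "fps_to_fls (Abs_fps (\<lambda>j. of_int (nu (p+1) u j))) =
    (\<Sum>T\<in>SYT lam. fls_X powi (int (des lam \<omega> T) - int N)) / (1 - fls_X :: rat fls) ^ n"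
proof -
  let ?A = "\<lambda>m. card (labeled_partitions lam \<omega> m)"
  have sorted: "sorted_wrt (\<ge>) lam" and nonempty: "lam \<noteq> []" and positive: "0 \<notin> set lam"
    using sorted_shape shape_nonempty[OF assms(2) _ assms(3)] assms(1) unfolding assms(5) set_shape by simp_all
  have count: "nu (p+1) u j = int (?A (N + j))" for j
  proof -
    let ?\<phi> = "\<lambda>r. j + last_ge (p+1) (code u) (lam ! (r - 1))"
    have "\<exists>R\<ge>i. R \<le> length lam \<and> lam ! (R - 1) = lam ! (i - 1) \<and> ?\<phi> R = ?\<phi> i \<and>
        ?\<phi> i + sig_F \<epsilon> (lam ! (i - 1)) + sig_E \<epsilon> R = N + j + R" if i: "1 \<le> i" "i \<le> length lam" for i
    proof -
      obtain q where q: "1 \<le> q" "q \<le> num_blocks lam" "lam ! (i - 1) = block_part lam q" "i \<le> block_end lam q"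
        "sig_flag lam \<epsilon> (int N) ! (i - 1) = int N + 1 - int (sig_F \<epsilon> (block_part lam q)) + sig_Ebar \<epsilon> (block_end lam q)"
        using sig_flag_nth[OF sorted i] by blast
      note R = block_end_in_range[OF sorted q(1,2)]
      have "sig_flag lam \<epsilon> (int N) ! (i - 1) = int (last_ge (p+1) (code u) (lam ! (i - 1)))"
        unfolding assms(8)[symmetric] flag_eq[OF assms(2)] assms(5)[symmetric] using i by simp
      then have "int (last_ge (p+1) (code u) (lam ! (i - 1))) = int N + 1 - int (sig_F \<epsilon> (lam ! (i - 1))) + sig_Ebar \<epsilon> (block_end lam q)"
        unfolding q(5) q(3) by simp
      \<comment> \<open>The \<open>+ 1\<close> of \<open>sig_flag\<close> cancels the
        \<open>- 1\<close> of \<open>sig_Ebar\<close>, leaving the balance required at the last row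
        of the block.\<close>
      then have "?\<phi> i + sig_F \<epsilon> (lam ! (i - 1)) + sig_E \<epsilon> (block_end lam q) = N + j + block_end lam q"
        unfolding sig_Ebar_def by linarith
      then show ?thesis using R q(3,4) by (intro exI[of _ "block_end lam q"]) simp
    qed
    from card_flagged_tab_eq_labeled_partitions[OF sorted assms(7,11), of ?\<phi> "N + j", OF this]
    show ?thesis unfolding nu_eq_card_flagged_tab[OF assms(2,4)] assms(5)[symmetric] by simp
  qed
  \<comment> \<open>With no fillings below \<open>N\<close>, the series over all bounds is
    \<open>fps_X ^ N\<close> times the series of \<open>nu\<close>.\<close>
  have vanish: "?A m = 0" if "m < N" for m
    using labeled_partitions_empty[OF sorted positive nonempty assms(7,11), of m] that assms(9) by simp
  let ?G = "Abs_fps (\<lambda>j. of_int (nu (p+1) u j)) :: rat fps"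
  have "Abs_fps (\<lambda>m. of_nat (?A m)) = fps_X ^ N * ?G"
    by (rule fps_ext) (auto simp: fps_X_power_mult_nth count[simplified] vanish)
  then have eq: "fps_X ^ N * ?G * (1 - fps_X) ^ n = (\<Sum>T\<in>SYT lam. fps_X ^ des lam \<omega> T)"
    using labeled_partitions_gf[OF assms(10), where 'a = rat] assms(6) by (simp only: Suc_eq_plus1)
  have fls_sum: "fps_to_fls (\<Sum>T\<in>B. f T) = (\<Sum>T\<in>B. fps_to_fls (f T))" for f :: "(nat \<times> nat \<Rightarrow> nat) \<Rightarrow> rat fps" and B
    by (induction B rule: infinite_finite_induct) simp_all
  \<comment> \<open>Laurent series over the rationals form a field, in which the powers of
    \<open>fls_X\<close> and \<open>1 - fls_X\<close> can be divided out.\<close>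
  have "fls_X ^ N * fps_to_fls ?G * (1 - fls_X) ^ n = (\<Sum>T\<in>SYT lam. fls_X ^ des lam \<omega> T)"
    using arg_cong[OF eq, of fps_to_fls] by (simp add: fls_sum fls_times_fps_to_fls fps_to_fls_power)
  moreover have "g = w / x / y" if "x * g * y = w" "x \<noteq> 0" "y \<noteq> 0" for g w x y :: "rat fls"
    using that by (auto simp: field_simps)
  moreover have "(1 - fls_X :: rat fls) \<noteq> 0"
  proof -
    have "fls_nth (1 - fls_X :: rat fls) 0 \<noteq> 0" by simp
    then show ?thesis by (metis fls_zero_nth)
  qed
  ultimately have "fps_to_fls ?G = (\<Sum>T\<in>SYT lam. fls_X ^ des lam \<omega> T) / fls_X ^ N / (1 - fls_X) ^ n"
    by (metis fls_X_nonzero power_not_zero)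
  moreover have "fls_X powi (int (des lam \<omega> T) - int N) = fls_X ^ des lam \<omega> T / (fls_X ^ N :: rat fls)" for T
    by (subst power_int_diff, simp) (simp only: power_int_of_nat)
  ultimately show ?thesis by (simp only: sum_divide_distrib)
qed

end
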